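(* Let $n\ge2$ and let $(M_p)_{p\in\mathbb{N}}$ be a sequence of positive reals with $M_0=1$ satisfying $(M.0)$, $(M.1)$, $(M.2)'$ and $(QA)$. Let $\ast$ be $\{M_p\}$ (Roumieu case) or $(M_p)$ (Beurling case). A quasianalytic ultradistribution $f\in\mathfrak{B}^\ast(\mathbb{R}^n)$ is rotation invariant if and only if $f=f_S$, where $f_S$ is the spherical mean of $f$.
   Context: Conditions on the sequence: $(M.0)$: in the Roumieu case there are $C,\ell>0$ with $p!\le C\ell^pM_p$ for all $p\in\mathbb{N}$; in the Beurling case for each $\ell>0$ there is $C=C_\ell>0$ with $p!\le C\ell^pM_p$ for all $p$. $(M.1)$: $M_p^2\le M_{p-1}M_{p+1}$ for $p\ge1$. $(M.2)'$: there are $A,H>0$ with $M_{p+1}\le AH^pM_p$ for all $p\in\mathbb{N}$. $(QA)$: $\sum_{p=1}^\infty M_{p-1}/M_p=\infty$. Spaces. For $\Omega\subseteq\mathbb{R}^n$ open, $K\Subset\Omega$ (a compact subset with non-empty interior) and $h>0$, $\mathcal{E}^{\{M_p\},h}(K)$ is the space of $\varphi\in C^\infty(\Omega)$ with $\sup_{x\in K,\alpha\in\mathbb{N}^n}\frac{|\varphi^{(\alpha)}(x)|}{h^{|\alpha|}M_{|\alpha|}}<\infty$ (this quantity being the seminorm). Then $\mathcal{E}^{\{M_p\}}(\Omega)=\varprojlim_{K\Subset\Omega}\varinjlim_{h\to\infty}\mathcal{E}^{\{M_p\},h}(K)$ and $\mathcal{E}^{(M_p)}(\Omega)=\varprojlim_{K\Subset\Omega}\varprojlim_{h\to0^+}\mathcal{E}^{\{M_p\},h}(K)$;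 ${\mathcal{E}^\ast}'(\Omega)$ is the topological dual. Restrictions to $\Omega$ of elements of $\mathcal{E}^\ast(\mathbb{R}^n)$ are dense in $\mathcal{E}^\ast(\Omega)$, so ${\mathcal{E}^\ast}'(\Omega)\subseteq{\mathcal{E}^\ast}'(\mathbb{R}^n)$. Supports. A compact $K\subseteq\mathbb{R}^n$ is a $\ast$-carrier of $f\in{\mathcal{E}^\ast}'(\mathbb{R}^n)$ if $f\in{\mathcal{E}^\ast}'(\Omega)$ for every open neighborhood $\Omega$ of $K$. It is known that each $f\in{\mathcal{E}^\ast}'(\mathbb{R}^n)$ has a smallest $\ast$-carrier, called its support. For $K$ compact, ${\mathcal{E}^\ast}'[K]$ denotes the space of $f\in{\mathcal{E}^\ast}'(\mathbb{R}^n)$ with support in $K$. The sheaf $\mathfrak{B}^\ast$. It is known that there is an (up to isomorphism) unique flabby sheaf $\mathfrak{B}^\ast$ on $\mathbb{R}^n$ whose space of global sections with support in $K$ is precisely ${\mathcal{E}^\ast}'[K]$, for every compact $K\subset\mathbb{R}^n$. On every bounded open set $\Omega$ its sections are $\mathfrak{B}^\ast(\Omega)={\mathcal{E}^\ast}'[\overline\Omega]/{\mathcal{E}^\ast}'[\partial\Omega]$; write $[g]$ for the class of $g\in{\mathcal{E}^\ast}'[\overline\Omega]$. Elements of $\mathfrak{B}^\ast(\mathbb{R}^n)$ are called $\ast$-quasianalytic ultradistributions on $\mathbb{R}^n$ (hyperfunctions if $\ast=\{p!\}$). Rotations and spherical means. For $g\in{\mathcal{E}^\ast}'(\mathbb{R}^n)$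 and $T\in SO(n)$, $g(Tx)$ is defined by $\langle g(Tx),\varphi(x)\rangle=\langle g(x),\varphi(T^{-1}x)\rangle$, and the spherical mean $g_S$ by $\langle g_S,\varphi\rangle=\langle g,\varphi_S\rangle$, where $\varphi_S(x)=\frac{1}{|\mathbb{S}^{n-1}|}\int_{\mathbb{S}^{n-1}}\varphi(|x|\omega)\,d\omega$, for $\varphi\in\mathcal{E}^\ast(\mathbb{R}^n)$. Both operations preserve ${\mathcal{E}^\ast}'[K]$ when $K$ is a rotation invariant compact set. Hence, for $\Omega$ a bounded rotation invariant open set and $f=[g]\in\mathfrak{B}^\ast(\Omega)$ with $g\in{\mathcal{E}^\ast}'[\overline\Omega]$, one defines $f_S=[g_S]\in\mathfrak{B}^\ast(\Omega)$ and $f(Tx)=[g(Tx)]$, and $f$ is called rotation invariant if $f(Tx)=f$ in $\mathfrak{B}^\ast(\Omega)$ for all $T\in SO(n)$. By the sheaf property one obtains $f_S\in\mathfrak{B}^\ast(\mathbb{R}^n)$ for every $f\in\mathfrak{B}^\ast(\mathbb{R}^n)$: it is the global section whose restriction to each bounded rotation invariant open $\Omega$ is $(f|_\Omega)_S$. An $f\in\mathfrak{B}^\ast(\mathbb{R}^n)$ is rotation invariant if its restriction to $\Omega$ is rotation invariant for every rotation invariant bounded open set $\Omega$. *)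

theory Defs
  imports "HOL-Analysis.Analysis"
begin

section \<open>Weight sequences\<close>

datatype regularity = Roumieu | Beurling

definition cond_M0 :: "regularity \<Rightarrow> (nat \<Rightarrow> real) \<Rightarrow> bool" where
  "cond_M0 r M \<longleftrightarrow> (case r of
      Roumieu \<Rightarrow> \<exists>C>0. \<exists>l>0. \<forall>p. fact p \<le> C * l ^ p * M p
    | Beurling \<Rightarrow> \<forall>l>0. \<exists>C>0. \<forall>p. fact p \<le> C * l ^ p * M p)"

definition cond_M1 :: "(nat \<Rightarrow> real) \<Rightarrow> bool" where
  "cond_M1 M \<longleftrightarrow> (\<forall>p\<ge>1. (M p)\<^sup>2 \<le> M (p - 1) * M (p + 1))"

definition cond_M2' :: "(nat \<Rightarrow> real) \<Rightarrow> bool" where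
  "cond_M2' M \<longleftrightarrow> (\<exists>A>0. \<exists>H>0. \<forall>p. M (p + 1) \<le> A * H ^ p * M p)"

text \<open>For a positive sequence, divergence of the series means that it is not summable.\<close>

definition cond_QA :: "(nat \<Rightarrow> real) \<Rightarrow> bool" where
  "cond_QA M \<longleftrightarrow> \<not> summable (\<lambda>p. M p / M (Suc p))"


section \<open>Spaces of ultradifferentiable functions\<close>

text \<open>
  Partial derivatives are indexed by lists of coordinate directions.  For smooth functions the
  order in the list is irrelevant, so that the lists of length \<open>p\<close> yield precisely the
  derivatives of multi-index \<open>\<alpha>\<close> with \<open>|\<alpha>| = p\<close>.
\<close>

definition pderiv_dir :: "'n::finite \<Rightarrow> (real^'n \<Rightarrow> complex) \<Rightarrow> real^'n \<Rightarrow> complex" where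
  "pderiv_dir i \<phi> x = frechet_derivative \<phi> (at x) (axis i 1)"

primrec pderivs :: "'n::finite list \<Rightarrow> (real^'n \<Rightarrow> complex) \<Rightarrow> real^'n \<Rightarrow> complex" where
  "pderivs [] \<phi> = \<phi>"
| "pderivs (i # is) \<phi> = pderiv_dir i (pderivs is \<phi>)"

text \<open>
  A function on an open set is represented by its extension by zero to the whole space; in this
  way distinct members of the following set are distinct functions on \<open>\<Omega>\<close>.  No regularity is
  required on the boundary of \<open>\<Omega>\<close>.
\<close>

definition smooth_funs :: "(real^'n::finite) set \<Rightarrow> (real^'n \<Rightarrow> complex) set" where
  "smooth_funs \<Omega> = {\<phi>. (\<forall>is. \<forall>x\<in>\<Omega>. pderivs is \<phi> differentiable (at x)) \<and> (\<forall>x. x \<notin> \<Omega> \<longrightarrow> \<phi> x = 0)}"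

definition restrict0 :: "(real^'n::finite) set \<Rightarrow> (real^'n \<Rightarrow> complex) \<Rightarrow> real^'n \<Rightarrow> complex" where
  "restrict0 \<Omega> \<phi> = (\<lambda>x. if x \<in> \<Omega> then \<phi> x else 0)"

definition compact_in :: "(real^'n::finite) set \<Rightarrow> (real^'n) set \<Rightarrow> bool" where
  "compact_in K \<Omega> \<longleftrightarrow> compact K \<and> K \<subseteq> \<Omega> \<and> interior K \<noteq> {}"

definition deriv_ratios ::
    "(nat \<Rightarrow> real) \<Rightarrow> real \<Rightarrow> (real^'n::finite) set \<Rightarrow> (real^'n \<Rightarrow> complex) \<Rightarrow> real set" where
  "deriv_ratios M h K \<phi> =
     {cmod (pderivs is \<phi> x) / (h ^ length is * M (length is)) |x is. x \<in> K}"

definition ud_seminorm ::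
    "(nat \<Rightarrow> real) \<Rightarrow> real \<Rightarrow> (real^'n::finite) set \<Rightarrow> (real^'n \<Rightarrow> complex) \<Rightarrow> real" where
  "ud_seminorm M h K \<phi> = Sup (deriv_ratios M h K \<phi>)"

definition ud_step ::
    "(nat \<Rightarrow> real) \<Rightarrow> (real^'n::finite) set \<Rightarrow> real \<Rightarrow> (real^'n) set \<Rightarrow> (real^'n \<Rightarrow> complex) set" where
  "ud_step M \<Omega> h K = {\<phi> \<in> smooth_funs \<Omega>. bdd_above (deriv_ratios M h K \<phi>)}"

definition ud_funs ::
    "regularity \<Rightarrow> (nat \<Rightarrow> real) \<Rightarrow> (real^'n::finite) set \<Rightarrow> (real^'n \<Rightarrow> complex) set" where
  "ud_funs r M \<Omega> = {\<phi> \<in> smooth_funs \<Omega>. \<forall>K. compact_in K \<Omega> \<longrightarrow> (case r of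
      Roumieu \<Rightarrow> \<exists>h>0. \<phi> \<in> ud_step M \<Omega> h K
    | Beurling \<Rightarrow> \<forall>h>0. \<phi> \<in> ud_step M \<Omega> h K)}"

definition seminorm_on :: "('x \<Rightarrow> complex) set \<Rightarrow> (('x \<Rightarrow> complex) \<Rightarrow> real) \<Rightarrow> bool" where
  "seminorm_on V p \<longleftrightarrow>
     (\<forall>\<phi>\<in>V. 0 \<le> p \<phi>) \<and>
     (\<forall>\<phi>\<in>V. \<forall>\<psi>\<in>V. p (\<lambda>x. \<phi> x + \<psi> x) \<le> p \<phi> + p \<psi>) \<and>
     (\<forall>c. \<forall>\<phi>\<in>V. p (\<lambda>x. c * \<phi> x) = cmod c * p \<phi>)"

text \<open>
  A system of seminorms generating the topology.  The continuous seminorms of a locally convex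
  inductive limit are the seminorms on the union whose restriction to each step is continuous; the
  topology of a projective limit is generated by the continuous seminorms of its factors.
\<close>

definition ud_seminorms ::
    "regularity \<Rightarrow> (nat \<Rightarrow> real) \<Rightarrow> (real^'n::finite) set \<Rightarrow> ((real^'n \<Rightarrow> complex) \<Rightarrow> real) set" where
  "ud_seminorms r M \<Omega> = (case r of
      Roumieu \<Rightarrow> {p. \<exists>K. compact_in K \<Omega> \<and> seminorm_on (\<Union>h\<in>{0<..}. ud_step M \<Omega> h K) p \<and>
                    (\<forall>h>0. \<exists>C. \<forall>\<phi>\<in>ud_step M \<Omega> h K. p \<phi> \<le> C * ud_seminorm M h K \<phi>)}
    | Beurling \<Rightarrow> {ud_seminorm M h K |h K. 0 < h \<and> compact_in K \<Omega>})"

text \<open>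
  The topological dual.  Functionals are set to zero outside the function space, so that equality
  in HOL is equality of functionals.  The finite set of seminorms may be empty: for empty \<open>\<Omega>\<close>
  there are no seminorms at all, and the dual is \<open>{0}\<close>.
\<close>

definition ud_dual ::
    "regularity \<Rightarrow> (nat \<Rightarrow> real) \<Rightarrow> (real^'n::finite) set \<Rightarrow> ((real^'n \<Rightarrow> complex) \<Rightarrow> complex) set" where
  "ud_dual r M \<Omega> = {u.
     (\<forall>\<phi>\<in>ud_funs r M \<Omega>. \<forall>\<psi>\<in>ud_funs r M \<Omega>. u (\<lambda>x. \<phi> x + \<psi> x) = u \<phi> + u \<psi>) \<and>
     (\<forall>c. \<forall>\<phi>\<in>ud_funs r M \<Omega>. u (\<lambda>x. c * \<phi> x) = c * u \<phi>) \<and>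
     (\<forall>\<phi>. \<phi> \<notin> ud_funs r M \<Omega> \<longrightarrow> u \<phi> = 0) \<and>
     (\<exists>P C. finite P \<and> P \<subseteq> ud_seminorms r M \<Omega> \<and>
        (\<forall>\<phi>\<in>ud_funs r M \<Omega>. cmod (u \<phi>) \<le> C * (\<Sum>p\<in>P. p \<phi>)))}"


section \<open>Carriers and supports\<close>

text \<open>
  The dual over \<open>\<Omega>\<close> as a subspace of the dual over the whole space, by transposing restriction.
\<close>

definition ud_dual_in ::
    "regularity \<Rightarrow> (nat \<Rightarrow> real) \<Rightarrow> (real^'n::finite) set \<Rightarrow> ((real^'n \<Rightarrow> complex) \<Rightarrow> complex) set" where
  "ud_dual_in r M \<Omega> = {f \<in> ud_dual r M UNIV.
     \<exists>u\<in>ud_dual r M \<Omega>. \<forall>\<phi>\<in>ud_funs r M UNIV. f \<phi> = u (restrict0 \<Omega> \<phi>)}"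

definition carrier_of ::
    "regularity \<Rightarrow> (nat \<Rightarrow> real) \<Rightarrow> ((real^'n::finite \<Rightarrow> complex) \<Rightarrow> complex) \<Rightarrow> (real^'n) set \<Rightarrow> bool" where
  "carrier_of r M f K \<longleftrightarrow> compact K \<and> (\<forall>\<Omega>. open \<Omega> \<and> K \<subseteq> \<Omega> \<longrightarrow> f \<in> ud_dual_in r M \<Omega>)"

definition is_support ::
    "regularity \<Rightarrow> (nat \<Rightarrow> real) \<Rightarrow> ((real^'n::finite \<Rightarrow> complex) \<Rightarrow> complex) \<Rightarrow> (real^'n) set \<Rightarrow> bool" where
  "is_support r M f S \<longleftrightarrow> carrier_of r M f S \<and> (\<forall>K. carrier_of r M f K \<longrightarrow> S \<subseteq> K)"

definition ud_dual_supp ::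
    "regularity \<Rightarrow> (nat \<Rightarrow> real) \<Rightarrow> (real^'n::finite) set \<Rightarrow> ((real^'n \<Rightarrow> complex) \<Rightarrow> complex) set" where
  "ud_dual_supp r M K = {f \<in> ud_dual r M UNIV. \<exists>S. is_support r M f S \<and> S \<subseteq> K}"


section \<open>Rotations and spherical means of functionals\<close>

text \<open>
  Surface measure on the unit sphere, as a measure on the ambient space: \<open>n\<close> times the Lebesgue
  measure of the cone over a set (polar coordinates).
\<close>

definition sphere_measure :: "(real^'n::finite) measure" where
  "sphere_measure =
     scale_measure (of_nat CARD('n)) (distr (restrict_space lborel (ball 0 1)) borel sgn)"

definition fun_spherical_mean :: "(real^'n::finite \<Rightarrow> complex) \<Rightarrow> real^'n \<Rightarrow> complex" where
  "fun_spherical_mean \<phi> x =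
     (LINT \<omega>|sphere_measure. \<phi> (norm x *\<^sub>R \<omega>)) /\<^sub>R measure (sphere_measure :: (real^'n) measure) UNIV"

definition dual_spherical_mean ::
    "regularity \<Rightarrow> (nat \<Rightarrow> real) \<Rightarrow> ((real^'n::finite \<Rightarrow> complex) \<Rightarrow> complex)
      \<Rightarrow> (real^'n \<Rightarrow> complex) \<Rightarrow> complex" where
  "dual_spherical_mean r M g =
     (\<lambda>\<phi>. if \<phi> \<in> ud_funs r M UNIV then g (fun_spherical_mean \<phi>) else 0)"

definition dual_rotate ::
    "regularity \<Rightarrow> (nat \<Rightarrow> real) \<Rightarrow> real^'n^'n \<Rightarrow> ((real^'n::finite \<Rightarrow> complex) \<Rightarrow> complex)
      \<Rightarrow> (real^'n \<Rightarrow> complex) \<Rightarrow> complex" where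
  "dual_rotate r M T g =
     (\<lambda>\<phi>. if \<phi> \<in> ud_funs r M UNIV then g (\<lambda>x. \<phi> (matrix_inv T *v x)) else 0)"

definition rotation_invariant_set :: "(real^'n::finite) set \<Rightarrow> bool" where
  "rotation_invariant_set A \<longleftrightarrow> (\<forall>T :: real^'n^'n. rotation_matrix T \<longrightarrow> (\<lambda>x. T *v x) ` A = A)"

definition admissible :: "(real^'n::finite) set \<Rightarrow> bool" where
  "admissible \<Omega> \<longleftrightarrow> open \<Omega> \<and> bounded \<Omega> \<and> rotation_invariant_set \<Omega>"


section \<open>The sheaf of quasianalytic ultradistributions\<close>

text \<open>
  Sheaves of vector spaces: all spaces of sections are realized as subspaces of one ambient vector
  space, which can always be achieved by replacing the sheaf with an isomorphic one.  The map
  \<open>res U V\<close> is restriction from \<open>U\<close> to \<open>V\<close>.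
\<close>

locale vector_space_sheaf = vector_space scale
  for scale :: "'k::field \<Rightarrow> 's::ab_group_add \<Rightarrow> 's" +
  fixes F :: "'x::topological_space set \<Rightarrow> 's set"
    and res :: "'x set \<Rightarrow> 'x set \<Rightarrow> 's \<Rightarrow> 's"
  assumes sections_subspace: "open U \<Longrightarrow> subspace (F U)"
    and res_in: "\<lbrakk>open U; open V; V \<subseteq> U; s \<in> F U\<rbrakk> \<Longrightarrow> res U V s \<in> F V"
    and res_add: "\<lbrakk>open U; open V; V \<subseteq> U; s \<in> F U; t \<in> F U\<rbrakk>
                    \<Longrightarrow> res U V (s + t) = res U V s + res U V t"
    and res_scale: "\<lbrakk>open U; open V; V \<subseteq> U; s \<in> F U\<rbrakk>
                      \<Longrightarrow> res U V (scale c s) = scale c (res U V s)"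
    and res_id: "\<lbrakk>open U; s \<in> F U\<rbrakk> \<Longrightarrow> res U U s = s"
    and res_res: "\<lbrakk>open U; open V; open W; W \<subseteq> V; V \<subseteq> U; s \<in> F U\<rbrakk>
                    \<Longrightarrow> res V W (res U V s) = res U W s"
    and locality: "\<lbrakk>\<forall>V\<in>\<U>. open V; s \<in> F (\<Union>\<U>); t \<in> F (\<Union>\<U>);
                     \<forall>V\<in>\<U>. res (\<Union>\<U>) V s = res (\<Union>\<U>) V t\<rbrakk> \<Longrightarrow> s = t"
    and gluing: "\<lbrakk>\<forall>V\<in>\<U>. open V; \<forall>V\<in>\<U>. \<sigma> V \<in> F V;
                   \<forall>V\<in>\<U>. \<forall>W\<in>\<U>. res V (V \<inter> W) (\<sigma> V) = res W (V \<inter> W) (\<sigma> W)\<rbrakk>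
                  \<Longrightarrow> \<exists>s\<in>F (\<Union>\<U>). \<forall>V\<in>\<U>. res (\<Union>\<U>) V s = \<sigma> V"
begin

definition section_support :: "'s \<Rightarrow> 'x set" where
  "section_support s = - \<Union>{V. open V \<and> res UNIV V s = 0}"

end

locale flabby_vector_space_sheaf = vector_space_sheaf +
  assumes flabby: "open V \<Longrightarrow> res UNIV V ` F UNIV = F V"

text \<open>
  The sheaf is unique only up to isomorphism, hence it is characterized rather than constructed: it
  is any flabby sheaf together with a linear identification \<open>\<iota>\<close> of the functionals with the global
  sections of compact support, such that for each compact \<open>K\<close> the functionals with support in \<open>K\<close>
  correspond to the sections with support in \<open>K\<close>.
\<close>

locale ultradistribution_sheaf =
  flabby_vector_space_sheaf scale B res
  for scale :: "complex \<Rightarrow> 's::ab_group_add \<Rightarrow> 's"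
    and B :: "(real^'n::finite) set \<Rightarrow> 's set"
    and res :: "(real^'n) set \<Rightarrow> (real^'n) set \<Rightarrow> 's \<Rightarrow> 's" +
  fixes r :: regularity
    and M :: "nat \<Rightarrow> real"
    and \<iota> :: "((real^'n \<Rightarrow> complex) \<Rightarrow> complex) \<Rightarrow> 's"
  assumes iota_add: "\<lbrakk>f \<in> ud_dual r M UNIV; g \<in> ud_dual r M UNIV\<rbrakk> \<Longrightarrow> \<iota> (\<lambda>\<phi>. f \<phi> + g \<phi>) = \<iota> f + \<iota> g"
    and iota_scale: "f \<in> ud_dual r M UNIV \<Longrightarrow> \<iota> (\<lambda>\<phi>. c * f \<phi>) = scale c (\<iota> f)"
    and iota_bij: "bij_betw \<iota> (ud_dual r M UNIV) {s \<in> B UNIV. compact (section_support s)}"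
    and iota_supp: "compact K \<Longrightarrow> \<iota> ` ud_dual_supp r M K = {s \<in> B UNIV. section_support s \<subseteq> K}"
begin

text \<open>
  For bounded open \<open>\<Omega>\<close>, \<open>g \<mapsto> section_class \<Omega> g\<close> maps the functionals with support in
  \<open>closure \<Omega>\<close> onto \<open>B \<Omega>\<close> (by flabbiness), and its kernel consists of those with support in
  \<open>frontier \<Omega>\<close>.  So it is the projection onto the quotient by which \<open>B \<Omega>\<close> is represented.
\<close>

definition section_class :: "(real^'n) set \<Rightarrow> ((real^'n \<Rightarrow> complex) \<Rightarrow> complex) \<Rightarrow> 's" where
  "section_class \<Omega> g = res UNIV \<Omega> (\<iota> g)"

definition representative :: "(real^'n) set \<Rightarrow> 's \<Rightarrow> (real^'n \<Rightarrow> complex) \<Rightarrow> complex" where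
  "representative \<Omega> s = (SOME g. g \<in> ud_dual_supp r M (closure \<Omega>) \<and> section_class \<Omega> g = s)"

text \<open>
  In the next two definitions \<open>\<Omega>\<close> is bounded, open and rotation invariant; then the result does
  not depend on the representative.
\<close>

definition local_rotate :: "(real^'n) set \<Rightarrow> real^'n^'n \<Rightarrow> 's \<Rightarrow> 's" where
  "local_rotate \<Omega> T s = section_class \<Omega> (dual_rotate r M T (representative \<Omega> s))"

definition local_spherical_mean :: "(real^'n) set \<Rightarrow> 's \<Rightarrow> 's" where
  "local_spherical_mean \<Omega> s = section_class \<Omega> (dual_spherical_mean r M (representative \<Omega> s))"

definition rotation_invariant :: "'s \<Rightarrow> bool" where
  "rotation_invariant f \<longleftrightarrow> (\<forall>\<Omega>. admissible \<Omega> \<longrightarrow>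
     (\<forall>T. rotation_matrix T \<longrightarrow> local_rotate \<Omega> T (res UNIV \<Omega> f) = res UNIV \<Omega> f))"

definition spherical_mean :: "'s \<Rightarrow> 's" where
  "spherical_mean f = (THE s. s \<in> B UNIV \<and>
     (\<forall>\<Omega>. admissible \<Omega> \<longrightarrow> res UNIV \<Omega> s = local_spherical_mean \<Omega> (res UNIV \<Omega> f)))"

end

end

theory Submission
  imports Defs
begin

text \<open>
  One direction is short.  A spherical mean of a functional does not change under rotations
  (\<open>dual_rotate_spherical_mean\<close>), and on rotation invariant open sets the class of a rotated functional
  depends only on the class of the functional (\<open>res_dual_op_cong\<close>); so \<open>f = f\<^sub>S\<close> is rotation
  invariant.

  Conversely, let \<open>g\<close> represent a rotation invariant \<open>f\<close> on a bounded rotation invariant open set \<open>V\<close>.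
  Then for every rotation \<open>T\<close> the functional \<open>g(Tx) - g\<close> is carried by \<open>closure V - V\<close>, and the claim is
  that \<open>g\<^sub>S - g\<close> is so, too.  Averaging over \<open>T\<close> does not give this at once: the functionals
  \<open>g(Tx) - g\<close> extend continuously to the functions near \<open>closure V - V\<close>, but nothing is known about
  how the extensions depend on \<open>T\<close>.  The proof avoids limits of functionals altogether.  The
  function \<open>\<phi>\<^sub>S - \<phi>\<close> is written as a finite sum of coboundaries \<open>(B \<phi>)(R x) - (B \<phi>)(x)\<close>, each with a
  fixed rotation \<open>R\<close> and an operator \<open>B\<close> that acts continuously on the ultradifferentiable functions over
  every rotation invariant open set, up to further operators of this kind.  By transposition,
  \<open>g\<^sub>S - g\<close> is a finite sum of images of functionals carried by \<open>closure V - V\<close> under operators that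
  preserve such carriers (\<open>carrier_of_dual_op\<close>).

  The coboundaries come from the circle.  For the angle \<open>\<beta> = 2 \<pi> sqrt 2\<close>, a periodic function \<open>F\<close> with
  mean \<open>m\<close> solves \<open>F - m = G - G(\<cdot> + \<beta>)\<close> with a function \<open>G\<close> whose Fourier coefficients are those
  of \<open>F\<close> divided by \<open>1 - exp (i k \<beta>)\<close>.  Since \<open>sqrt 2\<close> is badly approximable, these divisors decay no
  faster than \<open>1 / k\<close>, so that \<open>G\<close> is an integral of translates of the third derivative of \<open>F\<close> against a
  continuous kernel
  (\<open>circle_cohomological_equation\<close>).  On the orbits of the rotations of a coordinate plane, the
  derivative becomes the vector field that generates them.  The resulting operator uses only
  derivatives, multiplications by coordinates and averages over rotations; by \<open>cond_M1\<close> and \<open>cond_M2'\<close>, these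
  change the scale \<open>h\<close> of the estimates at most by a constant factor (\<open>tame_op\<close>), which makes them
  continuous in the Roumieu and in the Beurling case.  In this way every average over rotations of a
  coordinate plane is reached from the identity by a coboundary (\<open>mean_mod_plane\<close>), and so is every
  convolution of such averages (\<open>mean_mod_convolution\<close>).  The spherical mean is such a convolution:
  an invariant average over all rotations is composed of finitely many averages over plane rotations
  with suitably distributed angles (\<open>haar_on_exists\<close>).

  What remains is sheaf theory: a compact set carries a functional if and only if the corresponding
  section vanishes on the complement (\<open>carrier_of_iff\<close>), whence the local spherical means are
  well defined and glue.
\<close>


section \<open>The cohomological equation on the circle\<close>

text \<open>
  With an antiderivative \<open>P\<close>, the integral over the shifted period is \<open>P (pi + c) - P (- pi + c)\<close>, and
  periodicity makes the derivative of this in \<open>c\<close> vanish.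
\<close>

lemma periodic_integral_shift:
  fixes f :: "real \<Rightarrow> complex"
  assumes c: "continuous_on UNIV f" and per: "\<And>t. f (t + 2*pi) = f t"
  shows "integral {-pi..pi} (\<lambda>t. f (t + c)) = integral {-pi..pi} f"
proof -
  define R where "R = \<bar>c\<bar> + pi + 1"
  have "continuous_on {-R..R} f" using c continuous_on_subset by blast
  then obtain P where P: "\<And>x. x \<in> {-R..R} \<Longrightarrow> (P has_vector_derivative f x) (at x within {-R..R})"
    using antiderivative_continuous by blast
  have P': "(P has_vector_derivative f x) (at x)" if "\<bar>x\<bar> < R" for x
  proof -
    have "x \<in> {-R<..<R}" using that by auto
    then show ?thesis using P[of x]
      by (metis (no_types, lifting) at_within_interior greaterThanLessThan_subseteq_atLeastAtMost_iff interior_atLeastAtMost_real less_eq_real_def subsetD)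
  qed
  have FTC: "integral {-pi..pi} (\<lambda>t. f (t + d)) = P (pi + d) - P (-pi + d)" if "\<bar>d\<bar> \<le> \<bar>c\<bar>" for d
  proof (rule integral_unique, rule fundamental_theorem_of_calculus)
    fix x assume x: "x \<in> {-pi..pi}"
    have 1: "((\<lambda>x. x + d) has_vector_derivative 1) (at x within {-pi..pi})"
      by (auto intro!: derivative_eq_intros)
    have "\<bar>x + d\<bar> < R" using x that unfolding R_def by auto
    then have "(P has_vector_derivative f (x+d)) (at (x+d) within ((\<lambda>x. x + d) ` {-pi..pi}))"
      using P' has_vector_derivative_at_within by blast
    from vector_diff_chain_within[OF 1 this]
    show "((\<lambda>x. P (x + d)) has_vector_derivative f (x + d)) (at x within {-pi..pi})"
      by (simp add: o_def)
  qed auto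
  have "\<exists>k. \<forall>d\<in>{-\<bar>c\<bar>..\<bar>c\<bar>}. P (pi + d) - P (-pi + d) = k"
  proof (rule has_vector_derivative_zero_constant)
    fix d assume d: "d \<in> {-\<bar>c\<bar>..\<bar>c\<bar>}"
    let ?S = "{-\<bar>c\<bar>..\<bar>c\<bar>}"
    have A: "((\<lambda>d. P (s + d)) has_vector_derivative f (s + d)) (at d within ?S)" if "\<bar>s\<bar> \<le> pi" for s
    proof -
      have 1: "((\<lambda>d. s + d) has_vector_derivative 1) (at d within ?S)"
        by (auto intro!: derivative_eq_intros)
      have "\<bar>s + d\<bar> < R" using d that unfolding R_def by auto
      then have "(P has_vector_derivative f (s+d)) (at (s+d) within ((\<lambda>d. s + d) ` ?S))"
        using P' has_vector_derivative_at_within by blast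
      from vector_diff_chain_within[OF 1 this] show ?thesis by (simp add: o_def)
    qed
    have "f (pi + d) - f (-pi + d) = 0" using per[of "-pi+d"] by (simp add: algebra_simps)
    then show "((\<lambda>d. P (pi + d) - P (-pi + d)) has_vector_derivative 0) (at d within ?S)"
      using has_vector_derivative_diff[OF A[of pi] A[of "-pi"]] by simp
  qed auto
  then have "P (pi + c) - P (-pi + c) = P (pi + 0) - P (-pi + 0)" by (metis abs_ge_zero abs_ge_minus_self abs_ge_self abs_minus_cancel atLeastAtMost_iff minus_le_iff neg_le_0_iff_le)
  then show ?thesis using FTC[of c] FTC[of 0] by simp
qed

lemma average_tendsto:
  fixes s :: "nat \<Rightarrow> complex"
  assumes "s \<longlonglongrightarrow> L"
  shows "(\<lambda>N. (\<Sum>K<N. s K) / of_nat N) \<longlonglongrightarrow> L"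
proof (rule LIMSEQ_I)
  fix e :: real assume e: "e > 0"
  obtain n0 where n0: "\<And>n. n \<ge> n0 \<Longrightarrow> norm (s n - L) < e/2"
    using LIMSEQ_D[OF assms, of "e/2"] e by auto
  define B where "B = (\<Sum>K<n0. norm (s K - L))"
  obtain n1 :: nat where n1: "real n1 > 2 * B / e" using reals_Archimedean2 by blast
  have B0: "B \<ge> 0" unfolding B_def by (simp add: sum_nonneg)
  show "\<exists>no. \<forall>n\<ge>no. norm ((\<Sum>K<n. s K) / of_nat n - L) < e"
  proof (intro exI allI impI)
    fix n assume n: "n \<ge> Suc (n0 + n1)"
    have "(\<Sum>K<n. s K) / of_nat n - L = (\<Sum>K<n. s K - L) / of_nat n"
      using n by (simp add: sum_subtractf field_simps)
    then have "norm ((\<Sum>K<n. s K) / of_nat n - L) = norm (\<Sum>K<n. s K - L) / n"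
      by (simp add: norm_divide)
    also have "\<dots> \<le> (\<Sum>K<n. norm (s K - L)) / n" by (intro divide_right_mono norm_sum) auto
    also have "(\<Sum>K<n. norm (s K - L)) = B + (\<Sum>K=n0..<n. norm (s K - L))"
      unfolding B_def using n by (simp add: lessThan_atLeast0 sum.atLeastLessThan_concat)
    also have "(\<Sum>K=n0..<n. norm (s K - L)) \<le> (\<Sum>K=n0..<n. e/2)"
      using n0 by (intro sum_mono less_imp_le) auto
    also have "\<dots> \<le> real n * (e/2)" using e n by (simp add: of_nat_diff)
    finally have "norm ((\<Sum>K<n. s K) / of_nat n - L) \<le> (B + real n * (e/2)) / n"
      by (simp add: divide_right_mono)
    also have "\<dots> < e"
    proof -
      have "B < real n1 * e / 2" using n1 e by (simp add: field_simps)
      also have "\<dots> \<le> real n * e / 2" using n e by simp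
      finally show ?thesis using n e by (simp add: field_simps)
    qed
    finally show "norm ((\<Sum>K<n. s K) / of_nat n - L) < e" .
  qed
qed

definition fourier_coeff :: "(real \<Rightarrow> complex) \<Rightarrow> int \<Rightarrow> complex" where
  "fourier_coeff f k = integral {-pi..pi} (\<lambda>t. f t * cis (- of_int k * t))"

lemma fourier_coeff_shift:
  fixes f :: "real \<Rightarrow> complex"
  assumes "continuous_on UNIV f" "\<And>t. f (t + 2*pi) = f t"
  shows "fourier_coeff (\<lambda>t. f (t + c)) k = cis (of_int k * c) * fourier_coeff f k"
proof -
  have "cis (- (of_int k * (t + 2*pi))) = cis (- (of_int k * t))" for t
  proof -
    have "cis (- (of_int k * (t + 2*pi))) = cis (- (of_int k * t)) * cis (2 * pi * of_int (-k))"
      by (simp add: cis_mult algebra_simps)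
    then show ?thesis by (metis cis_multiple_2pi Ints_of_int mult.right_neutral)
  qed
  then have "integral {-pi..pi} (\<lambda>t. f (t + c) * cis (- of_int k * (t + c))) = fourier_coeff f k"
    unfolding fourier_coeff_def using assms
    by (intro periodic_integral_shift[of "\<lambda>t. f t * cis (- of_int k * t)" c])
       (auto intro!: continuous_intros simp: algebra_simps)
  moreover have "cis (of_int k * c) * cis (- (of_int k * (t + c))) = cis (- (of_int k * t))" for t
    by (simp add: cis_mult algebra_simps)
  then have "f (t + c) * cis (- of_int k * t) = cis (of_int k * c) * (f (t + c) * cis (- of_int k * (t + c)))" for t
    by (metis mult.left_commute mult_minus_left)
  ultimately show ?thesis unfolding fourier_coeff_def
    by (simp only: integral_mult_right)
qed

lemma cis_has_vector_derivative:
  "((\<lambda>t. cis (r * t)) has_vector_derivative \<i> * of_real r * cis (r * t)) (at t within S)"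
proof -
  have "((\<lambda>z. exp (\<i> * of_real r * z)) has_field_derivative \<i> * of_real r * exp (\<i> * of_real r * of_real t)) (at (of_real t))"
    by (auto intro!: derivative_eq_intros)
  from has_vector_derivative_real_field[OF this] show ?thesis
    by (simp add: cis_conv_exp mult.assoc)
qed

lemma fourier_coeff_deriv:
  fixes f f' :: "real \<Rightarrow> complex"
  assumes d: "\<And>t. (f has_vector_derivative f' t) (at t)" and c: "continuous_on UNIV f'"
    and per: "\<And>t. f (t + 2*pi) = f t"
  shows "fourier_coeff f' k = \<i> * of_int k * fourier_coeff f k"
proof -
  let ?e = "\<lambda>t::real. cis (- of_int k * t)"
  have cf: "continuous_on UNIV f"
    using d has_vector_derivative_continuous[of f] by (fastforce simp: continuous_on_eq_continuous_at)
  have "((\<lambda>t. f' t * ?e t - \<i> * of_int k * (f t * ?e t)) has_integral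
        f pi * ?e pi - f (-pi) * ?e (-pi)) {-pi..pi}"
  proof (rule fundamental_theorem_of_calculus)
    fix t :: real
    have "(?e has_vector_derivative (- \<i> * of_int k) * ?e t) (at t within {-pi..pi})"
      using cis_has_vector_derivative[of "- of_int k" t] by (simp add: mult.assoc)
    from has_vector_derivative_mult[OF has_vector_derivative_at_within[OF d[of t]] this]
    show "((\<lambda>t. f t * ?e t) has_vector_derivative f' t * ?e t - \<i> * of_int k * (f t * ?e t)) (at t within {-pi..pi})"
      by (simp add: algebra_simps)
  qed auto
  moreover have "f pi = f (-pi)" using per[of "-pi"] by simp
  moreover have "?e pi = ?e (-pi)"
  proof -
    have "?e (-pi) = ?e pi * cis (2 * pi * of_int k)" by (simp add: cis_mult algebra_simps)
    then show ?thesis by (metis cis_multiple_2pi Ints_of_int mult.right_neutral)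
  qed
  ultimately have "((\<lambda>t. f' t * ?e t - \<i> * of_int k * (f t * ?e t)) has_integral 0) {-pi..pi}" by simp
  then have "0 = integral {-pi..pi} (\<lambda>t. f' t * ?e t - \<i> * of_int k * (f t * ?e t))"
    by (simp add: integral_unique)
  also have "\<dots> = fourier_coeff f' k - \<i> * of_int k * fourier_coeff f k"
    unfolding fourier_coeff_def
    by (subst integral_diff) (auto intro!: integrable_continuous_interval continuous_intros
       continuous_on_subset[OF cf] continuous_on_subset[OF c])
  finally show ?thesis by simp
qed

lemma fourier_partial_sums_telescope:
  fixes c :: "int \<Rightarrow> complex"
  assumes "\<And>k. a k = c (k - 1) - c k"
  shows "(\<Sum>k=-int K..int K. a k) = c (- int K - 1) - c (int K)"
proof (induction K)
  case 0 then show ?case using assms by simp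
next
  case (Suc K)
  have I: "{-int (Suc K)..int (Suc K)} = insert (-int (Suc K)) (insert (int (Suc K)) {-int K..int K})" by auto
  have "(\<Sum>k=-int (Suc K)..int (Suc K). a k) = a (-int (Suc K)) + (a (int (Suc K)) + (\<Sum>k=-int K..int K. a k))"
    unfolding I by (subst sum.insert, simp, force)+ simp
  also have "\<dots> = a (-int (Suc K)) + (a (int (Suc K)) + (c (- int K - 1) - c (int K)))"
    by (simp only: Suc.IH)
  also have "\<dots> = c (- int (Suc K) - 1) - c (int (Suc K))" by (simp add: assms add.commute minus_diff_commute)
  finally show ?case .
qed

lemma geometric_average_tendsto_0:
  assumes z: "norm z = 1" "z \<noteq> (1::complex)"
  shows "(\<lambda>N. (\<Sum>K<N. z ^ K) / of_nat N) \<longlonglongrightarrow> 0"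
proof (rule Lim_null_comparison)
  show "\<forall>\<^sub>F N in sequentially. norm ((\<Sum>K<N. z ^ K) / of_nat N) \<le> (2 / norm (1 - z)) * inverse (real N)"
  proof (intro always_eventually allI)
    fix N
    have "norm (1 - z ^ N) \<le> 2"
      using norm_triangle_ineq4[of 1 "z^N"] z by (simp add: norm_power)
    then have "norm (\<Sum>K<N. z ^ K) \<le> 2 / norm (1 - z)"
      using z by (subst sum_gp_strict) (auto simp: norm_divide intro!: divide_right_mono)
    then have "norm (\<Sum>K<N. z ^ K) * inverse (real N) \<le> (2 / norm (1 - z)) * inverse (real N)"
      by (rule mult_right_mono) auto
    then show "norm ((\<Sum>K<N. z ^ K) / of_nat N) \<le> (2 / norm (1 - z)) * inverse (real N)"
      by (simp only: norm_divide divide_inverse[of _ "real N"] norm_of_nat)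
  qed
  show "(\<lambda>N. (2 / norm (1 - z)) * inverse (real N)) \<longlonglongrightarrow> 0"
    by (rule tendsto_mult_right_zero[OF lim_inverse_n])
qed

lemma cis_neq_1:
  assumes "t \<in> {-pi..pi}" "t \<noteq> 0"
  shows "cis t \<noteq> 1"
proof
  assume "cis t = 1"
  then have "cos \<bar>t\<bar> = 1" by (simp add: complex_eq_iff)
  then obtain x :: int where x: "\<bar>t\<bar> = of_int x * 2 * pi" using cos_one_2pi_int by blast
  have "0 < \<bar>t\<bar>" using assms(2) by simp
  then have "0 < of_int x * (2 * pi)" unfolding x by (simp add: mult.assoc)
  then have "x > 0" by (simp add: zero_less_mult_iff)
  then have "of_int x * 2 * pi \<ge> 1 * 2 * pi" by (intro mult_right_mono) auto
  moreover have "\<bar>t\<bar> \<le> pi" using assms(1) by auto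
  moreover have "pi > 0" by simp
  ultimately show False using x by linarith
qed

text \<open>
  The averages of the powers of \<open>cis (s * t)\<close> are bounded and tend to \<open>0\<close> except at \<open>t = 0\<close>, so that
  dominated convergence applies.  This form of the Riemann-Lebesgue lemma, for Cesaro means, suffices
  to identify the sum of a series known to converge.
\<close>

lemma integral_average_tendsto_0:
  fixes q :: "real \<Rightarrow> complex"
  assumes c: "continuous_on {-pi..pi} q" and s: "\<bar>s\<bar> = 1"
  shows "(\<lambda>N. (\<Sum>K<N. integral {-pi..pi} (\<lambda>t. q t * cis (s * t) ^ K)) / of_nat N) \<longlonglongrightarrow> 0"
proof -
  let ?I = "{-pi..pi}"
  have "bounded (q ` ?I)" by (intro compact_imp_bounded compact_continuous_image c) auto
  then obtain B where B: "\<And>t. t \<in> ?I \<Longrightarrow> norm (q t) \<le> B"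
    unfolding bounded_iff by blast
  define D where "D N t = (\<Sum>K<N. cis (s * t) ^ K) / of_nat N" for N t
  have Dn: "norm (D N t) \<le> 1" for N t
  proof -
    have "norm (\<Sum>K<N. cis (s * t) ^ K) \<le> (\<Sum>K<N. 1)"
      by (rule sum_norm_le) (simp add: norm_power)
    then show ?thesis unfolding D_def by (cases "N = 0") (auto simp: norm_divide)
  qed
  have int: "(\<lambda>t. q t * D N t) integrable_on ?I" for N
    unfolding D_def divide_inverse by (intro integrable_continuous_interval continuous_intros c)
  have "(\<lambda>N. integral ?I (\<lambda>t. q t * D N t)) \<longlonglongrightarrow> integral ?I (\<lambda>t. if t = 0 then q t else 0 :: complex)"
  proof (rule dominated_convergence(2)[where h = "\<lambda>_. B"])
    show "norm (q t * D N t) \<le> B" if "t \<in> ?I" for N t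
      using B[OF that] Dn[of N t] by (metis mult_left_le norm_ge_zero norm_mult order_trans)
    show "(\<lambda>N. q t * D N t) \<longlonglongrightarrow> (if t = 0 then q t else 0)" if t: "t \<in> ?I" for t
    proof (cases "t = 0")
      case True
      have "\<forall>\<^sub>F N in sequentially. D N t = 1"
        using eventually_gt_at_top[of 0] unfolding D_def True by eventually_elim auto
      then have "(\<lambda>N. D N t) \<longlonglongrightarrow> 1" by (simp add: tendsto_eventually)
      from tendsto_mult[OF tendsto_const[of "q t"] this] show ?thesis using True by simp
    next
      case False
      have "s * t \<in> {-pi..pi}" "s * t \<noteq> 0" using t s False by (auto simp: abs_if split: if_splits)
      then have "cis (s * t) \<noteq> 1" by (rule cis_neq_1)
      then have "(\<lambda>N. D N t) \<longlonglongrightarrow> 0"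
        unfolding D_def by (intro geometric_average_tendsto_0) auto
      from tendsto_mult[OF tendsto_const[of "q t"] this] show ?thesis using False by simp
    qed
  qed (auto intro: int)
  moreover have "integral ?I (\<lambda>t. if t = 0 then q t else 0 :: complex) = integral ?I (\<lambda>t. 0)"
    by (rule integral_spike[of "{0}"]) auto
  moreover have "integral ?I (\<lambda>t. q t * D N t) = (\<Sum>K<N. integral ?I (\<lambda>t. q t * cis (s * t) ^ K)) / of_nat N" for N
  proof -
    have "integral ?I (\<lambda>t. q t * D N t) = integral ?I (\<lambda>t. (\<Sum>K<N. q t * cis (s * t) ^ K) / of_nat N)"
      unfolding D_def by (simp add: sum_distrib_left)
    also have "\<dots> = (\<Sum>K<N. integral ?I (\<lambda>t. q t * cis (s * t) ^ K)) / of_nat N"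
      unfolding integral_divide
      by (subst integral_sum) (auto intro!: integrable_continuous_interval continuous_intros c)
    finally show ?thesis .
  qed
  ultimately show ?thesis by simp
qed

text \<open>
  Only the value of a convergent Fourier series has to be found.  After subtraction of the constant
  \<open>f 0\<close> the function is \<open>(cis - 1) * q\<close> with a continuous \<open>q\<close>, because \<open>f\<close> is differentiable at \<open>0\<close>.
  So its Fourier coefficients are differences of consecutive coefficients of \<open>q\<close>, the partial sums
  telescope, and the averages of what is left tend to \<open>0\<close>.
\<close>

lemma fourier_inversion_at_0:
  fixes f f' :: "real \<Rightarrow> complex"
  assumes d: "\<And>t. (f has_vector_derivative f' t) (at t)"
    and conv: "(\<lambda>K. \<Sum>k=-int K..int K. fourier_coeff f k) \<longlonglongrightarrow> L"
  shows "L = 2 * pi * f 0"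
proof -
  let ?I = "{-pi..pi}"
  have cf: "continuous_on S f" for S
    using d has_vector_derivative_continuous continuous_at_imp_continuous_on by blast
  define g where "g t = f t - f 0" for t
  define q where "q t = (if t = 0 then f' 0 / \<i> else g t / (cis t - 1))" for t
  note cis1 = cis_neq_1
  have lim0: "(q \<longlongrightarrow> q 0) (at 0)"
  proof -
    have quot: "((\<lambda>t. (h t - h 0) /\<^sub>R t) \<longlongrightarrow> h') (at 0)"
      if "(h has_vector_derivative h') (at 0)" for h :: "real \<Rightarrow> complex" and h'
    proof -
      have "((\<lambda>t. norm (h t - h 0 - t *\<^sub>R h') / norm t) \<longlongrightarrow> 0) (at 0)"
        using that by (simp add: has_vector_derivative_def has_derivative_iff_norm)
      then have "((\<lambda>t. norm ((h t - h 0) /\<^sub>R t - h')) \<longlongrightarrow> 0) (at 0)"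
      proof (rule Lim_transform_eventually)
        have "norm (h t - h 0 - t *\<^sub>R h') / norm t = norm ((h t - h 0) /\<^sub>R t - h')" if "t \<noteq> 0" for t
        proof -
          have "(h t - h 0) /\<^sub>R t - h' = (h t - h 0 - t *\<^sub>R h') /\<^sub>R t"
            using that by (simp add: scaleR_diff_right)
          then show ?thesis by (simp add: divide_inverse mult.commute)
        qed
        then show "\<forall>\<^sub>F t in at 0. norm (h t - h 0 - t *\<^sub>R h') / norm t = norm ((h t - h 0) /\<^sub>R t - h')"
          by (simp add: eventually_at_filter)
      qed
      then show ?thesis by (simp add: tendsto_norm_zero_iff LIM_zero_iff)
    qed
    have A: "((\<lambda>t. (f t - f 0) /\<^sub>R t) \<longlongrightarrow> f' 0) (at 0)"
      by (rule quot) (rule d)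
    have "(cis has_vector_derivative \<i>) (at 0)"
      using cis_has_vector_derivative[of 1 0 UNIV] by simp
    then have B: "((\<lambda>t. (cis t - 1) /\<^sub>R t) \<longlongrightarrow> \<i>) (at 0)"
      using quot[of cis \<i>] by simp
    have "((\<lambda>t. ((f t - f 0) /\<^sub>R t) / ((cis t - 1) /\<^sub>R t)) \<longlongrightarrow> f' 0 / \<i>) (at 0)"
      by (intro tendsto_divide A B) auto
    moreover have "(x /\<^sub>R t) / (y /\<^sub>R t) = x / y" if "t \<noteq> 0" for t and x y :: complex
      using that by (simp add: scaleR_conv_of_real)
    then have "\<forall>\<^sub>F t in at 0. ((f t - f 0) /\<^sub>R t) / ((cis t - 1) /\<^sub>R t) = q t"
      unfolding q_def g_def eventually_at_filter by (intro always_eventually) auto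
    ultimately have "(q \<longlongrightarrow> f' 0 / \<i>) (at 0)"
      by (rule Lim_transform_eventually)
    then show ?thesis unfolding q_def by simp
  qed
  have cq: "continuous_on ?I q"
    unfolding continuous_on_eq_continuous_within
  proof
    fix t assume t: "t \<in> ?I"
    show "continuous (at t within ?I) q"
    proof (cases "t = 0")
      case True
      then show ?thesis unfolding continuous_within using lim0 by (metis Lim_at_imp_Lim_at_within)
    next
      case False
      have "continuous (at t within ?I) (\<lambda>t. g t / (cis t - 1))"
      proof (rule continuous_at_within_divide)
        have "continuous_on ?I g" "continuous_on ?I (\<lambda>t. cis t - 1)"
          unfolding g_def by (intro continuous_intros cf)+
        then show "continuous (at t within ?I) g" "continuous (at t within ?I) (\<lambda>t. cis t - 1)"
          using t by (auto simp: continuous_on_eq_continuous_within)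
      qed (use cis1[OF t False] in simp)
      then have "((\<lambda>t. g t / (cis t - 1)) \<longlongrightarrow> q t) (at t within ?I)"
        using False by (simp add: continuous_within q_def)
      moreover have "\<forall>\<^sub>F x in at t within ?I. g x / (cis x - 1) = q x"
        unfolding q_def eventually_at using False by (intro exI[of _ "\<bar>t\<bar>"]) (auto simp: dist_real_def)
      ultimately show ?thesis
        unfolding continuous_within by (rule Lim_transform_eventually)
    qed
  qed
  define c where "c k = fourier_coeff q k" for k
  define G where "G k = fourier_coeff g k" for k
  have G: "G k = c (k - 1) - c k" for k
  proof -
    have "g t * cis (- of_int k * t) = q t * cis (- of_int (k - 1) * t) - q t * cis (- of_int k * t)" if "t \<in> ?I" for t
    proof -
      have gt: "g t = q t * (cis t - 1)" using cis1[OF that] by (auto simp: q_def g_def)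
      have "cis (- of_int (k - 1) * t) = cis t * cis (- of_int k * t)"
        by (simp add: cis_mult algebra_simps)
      then show ?thesis unfolding gt by (simp only:) (simp add: ring_distribs)
    qed
    then have "G k = integral ?I (\<lambda>t. q t * cis (- of_int (k - 1) * t) - q t * cis (- of_int k * t))"
      unfolding G_def fourier_coeff_def by (intro integral_cong) auto
    also have "\<dots> = c (k - 1) - c k" unfolding c_def fourier_coeff_def
      by (subst integral_diff) (auto intro!: integrable_continuous_interval continuous_intros cq)
    finally show ?thesis .
  qed
  have sumG: "(\<Sum>k=-int K..int K. G k) = c (- int K - 1) - c (int K)" for K
    by (rule fourier_partial_sums_telescope) (rule G)
  have avg: "(\<lambda>N. (\<Sum>K<N. \<Sum>k=-int K..int K. G k) / of_nat N) \<longlonglongrightarrow> 0"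
  proof -
    have 1: "c (- int K - 1) = integral ?I (\<lambda>t. (q t * cis t) * cis (1 * t) ^ K)" for K
    proof -
      have "cis (- of_int (- int K - 1) * t) = cis t * cis (1 * t) ^ K" for t
        by (simp add: cis_mult Complex.DeMoivre algebra_simps)
      then show ?thesis unfolding c_def fourier_coeff_def by (simp only: mult.assoc)
    qed
    have 2: "c (int K) = integral ?I (\<lambda>t. q t * cis ((-1) * t) ^ K)" for K
    proof -
      have "cis (- of_int (int K) * t) = cis ((-1) * t) ^ K" for t
        by (simp only: Complex.DeMoivre) (simp add: algebra_simps)
      then show ?thesis unfolding c_def fourier_coeff_def by (simp only:)
    qed
    have "(\<lambda>N. (\<Sum>K<N. c (- int K - 1)) / of_nat N - (\<Sum>K<N. c (int K)) / of_nat N) \<longlonglongrightarrow> 0 - 0"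
      unfolding 1 2
      by (intro tendsto_diff integral_average_tendsto_0 continuous_intros cq) auto
    then show ?thesis unfolding sumG by (simp add: sum_subtractf diff_divide_distrib)
  qed
  have const: "fourier_coeff (\<lambda>t. f 0) k = (if k = 0 then 2 * pi * f 0 else 0)" for k
  proof (cases "k = 0")
    case True then show ?thesis by (simp add: fourier_coeff_def scaleR_conv_of_real)
  next
    case False
    have "fourier_coeff (\<lambda>t. 0) k = \<i> * of_int k * fourier_coeff (\<lambda>t. f 0) k"
      by (rule fourier_coeff_deriv) auto
    then show ?thesis using False by (simp add: fourier_coeff_def)
  qed
  have Gk: "G k = fourier_coeff f k - (if k = 0 then 2 * pi * f 0 else 0)" for k
    unfolding const[symmetric] unfolding G_def g_def fourier_coeff_def left_diff_distrib
    by (subst integral_diff) (auto intro!: integrable_continuous_interval continuous_intros cf)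
  have "(\<Sum>k=-int K..int K. G k) = (\<Sum>k=-int K..int K. fourier_coeff f k) - 2 * pi * f 0" for K
    unfolding Gk sum_subtractf by (subst sum.delta) auto
  with conv have "(\<lambda>K. \<Sum>k=-int K..int K. G k) \<longlonglongrightarrow> L - 2 * pi * f 0"
    by (auto intro!: tendsto_intros)
  from LIMSEQ_unique[OF average_tendsto[OF this] avg] show ?thesis by simp
qed

text \<open>
  Infinite descent: \<open>m\<close> is even, and \<open>m / 2\<close> takes the place of \<open>k\<close>.
\<close>

lemma double_square_eq_square:
  fixes k m :: nat
  assumes "2 * k\<^sup>2 = m\<^sup>2"
  shows "k = 0"
  using assms
proof (induction k arbitrary: m rule: less_induct)
  case (less k)
  have "even (m\<^sup>2)" using less.prems by (metis dvd_triv_left)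
  then obtain j where j: "m = 2 * j" by (metis dvdE even_power)
  then have kj: "k\<^sup>2 = 2 * j\<^sup>2" using less.prems by (simp add: power2_eq_square)
  show ?case
  proof (rule ccontr)
    assume "k \<noteq> 0"
    then have "j\<^sup>2 < k\<^sup>2" using kj by (cases "j = 0") auto
    then have "j < k" by (rule power2_less_imp_less) simp
    then have "j = 0" using less.IH[of j k] kj by simp
    then show False using kj \<open>k \<noteq> 0\<close> by simp
  qed
qed

text \<open>
  The nonzero integer \<open>2 * k\<^sup>2 - m\<^sup>2\<close> has modulus at least \<open>1\<close>, and it is the product of
  \<open>k * sqrt 2 - m\<close> with a factor of size at most \<open>4 * \<bar>k\<bar>\<close>.
\<close>

lemma sqrt2_badly_approximable:
  fixes k m :: int
  assumes "k \<noteq> 0"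
  shows "\<bar>of_int k * sqrt 2 - of_int m\<bar> \<ge> 1 / (4 * \<bar>of_int k\<bar>)"
proof (cases "\<bar>of_int k * sqrt 2 - of_int m\<bar> \<le> 1")
  case True
  let ?k = "of_int k :: real" and ?m = "of_int m :: real"
  have k1: "\<bar>?k\<bar> \<ge> 1" using assms by linarith
  have "2 * k\<^sup>2 \<noteq> m\<^sup>2"
  proof
    assume "2 * k\<^sup>2 = m\<^sup>2"
    then have "2 * \<bar>k\<bar>\<^sup>2 = \<bar>m\<bar>\<^sup>2" by simp
    then have "2 * (nat \<bar>k\<bar>)\<^sup>2 = (nat \<bar>m\<bar>)\<^sup>2"
      by (metis abs_ge_zero nat_power_eq nat_mult_distrib nat_numeral zero_le_numeral)
    then show False using double_square_eq_square assms by fastforce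
  qed
  then have "1 \<le> \<bar>2 * k\<^sup>2 - m\<^sup>2\<bar>" by linarith
  then have "1 \<le> \<bar>2 * ?k\<^sup>2 - ?m\<^sup>2\<bar>"
  proof -
    assume "1 \<le> \<bar>2 * k\<^sup>2 - m\<^sup>2\<bar>"
    then have "(1::real) \<le> of_int \<bar>2 * k\<^sup>2 - m\<^sup>2\<bar>" by linarith
    then show ?thesis by simp
  qed
  also have "\<dots> = \<bar>?k * sqrt 2 - ?m\<bar> * \<bar>?k * sqrt 2 + ?m\<bar>"
    unfolding abs_mult[symmetric] by (simp add: algebra_simps power2_eq_square)
  also have "\<dots> \<le> \<bar>?k * sqrt 2 - ?m\<bar> * (4 * \<bar>?k\<bar>)"
  proof (rule mult_left_mono)
    have "sqrt 2 \<le> 3/2" by (rule real_le_lsqrt) (auto simp: power2_eq_square)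
    then have "\<bar>?k * sqrt 2\<bar> \<le> \<bar>?k\<bar> * (3/2)" unfolding abs_mult by (intro mult_left_mono) auto
    then show "\<bar>?k * sqrt 2 + ?m\<bar> \<le> 4 * \<bar>?k\<bar>" using True k1 by linarith
  qed simp
  finally show ?thesis using k1 by (simp add: field_simps)
next
  case False
  have "\<bar>of_int k :: real\<bar> \<ge> 1" using assms by linarith
  then have "1 / (4 * \<bar>of_int k :: real\<bar>) \<le> 1" by (simp add: field_simps)
  then show ?thesis using False by linarith
qed

definition diophantine_angle :: real where
  "diophantine_angle = 2 * pi * sqrt 2"

text \<open>
  The modulus is \<open>2 * \<bar>sin (pi * x)\<bar>\<close>, for which the crude bound \<open>sin u \<ge> u / 3\<close> on \<open>{0..2}\<close>
  is good enough.
\<close>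

lemma norm_one_minus_cis_ge:
  assumes "\<bar>x\<bar> \<le> 1/2"
  shows "norm (1 - cis (2 * pi * x)) \<ge> \<bar>x\<bar>"
proof -
  have n: "(norm (1 - cis (2 * pi * x)))\<^sup>2 = (2 * sin (pi * x))\<^sup>2"
  proof -
    have "(norm (1 - cis (2 * pi * x)))\<^sup>2 = (1 - cos (2*pi*x))\<^sup>2 + (sin (2*pi*x))\<^sup>2"
      by (simp add: cmod_power2)
    also have "\<dots> = 2 - 2 * cos (2 * pi * x)"
      using sin_cos_squared_add[of "2*pi*x"] by (simp add: power2_diff)
    finally have "(norm (1 - cis (2 * pi * x)))\<^sup>2 = 2 - 2 * cos (2 * (pi * x))"
      by (simp add: mult.assoc)
    also have "\<dots> = 4 * (sin (pi * x))\<^sup>2" unfolding cos_double_sin by simp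
    finally show ?thesis by (simp add: power_mult_distrib)
  qed
  then have n2: "norm (1 - cis (2 * pi * x)) = 2 * \<bar>sin (pi * x)\<bar>"
  proof -
    have "(norm (1 - cis (2 * pi * x)))\<^sup>2 = (2 * \<bar>sin (pi * x)\<bar>)\<^sup>2" unfolding n by (simp add: power_mult_distrib)
    then show ?thesis by (rule power2_eq_imp_eq) auto
  qed
  have "\<bar>sin (pi * x)\<bar> = sin (pi * \<bar>x\<bar>)"
  proof -
    have "sin (pi * \<bar>x\<bar>) \<ge> 0" using assms by (intro sin_ge_zero) (auto simp: mult_le_cancel_left1)
    then show ?thesis by (cases "x \<ge> 0") (auto simp: abs_if split: if_splits)
  qed
  moreover have "sin (pi * \<bar>x\<bar>) \<ge> \<bar>x\<bar> / 2"
  proof -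
    define u where "u = pi * \<bar>x\<bar>"
    have u: "u \<ge> 0" "u \<le> 2"
    proof -
      have "u \<le> pi * (1/2)" unfolding u_def by (rule mult_left_mono[OF assms]) auto
      then show "u \<le> 2" using pi_less_4 by simp
    qed (simp add: u_def)
    have "\<bar>sin u - (\<Sum>m<3. sin_coeff m * u ^ m)\<bar> \<le> inverse (fact 3) * \<bar>u\<bar> ^ 3"
      by (rule Maclaurin_sin_bound)
    then have "\<bar>sin u - u\<bar> \<le> u ^ 3 / 6"
      using u by (simp add: numeral_eq_Suc sin_coeff_def fact_Suc)
    moreover have "u ^ 3 \<le> 4 * u"
    proof -
      have "u\<^sup>2 \<le> 2\<^sup>2" using u by (intro power_mono) auto
      then have "u\<^sup>2 * u \<le> 4 * u" using u by (intro mult_right_mono) auto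
      then show ?thesis by (simp add: power3_eq_cube power2_eq_square)
    qed
    ultimately have "sin u \<ge> u / 3" by (simp add: abs_if split: if_splits)
    moreover have "u \<ge> 2 * \<bar>x\<bar>" unfolding u_def by (intro mult_right_mono pi_ge_two) auto
    ultimately show ?thesis unfolding u_def by simp
  qed
  ultimately show ?thesis using n2 by simp
qed

lemma norm_one_minus_cis_diophantine:
  fixes k :: int
  assumes "k \<noteq> 0"
  shows "norm (1 - cis (of_int k * diophantine_angle)) \<ge> 1 / (4 * \<bar>of_int k\<bar>)"
proof -
  define m where "m = round (of_int k * sqrt 2 :: real)"
  define x where "x = of_int k * sqrt 2 - of_int m"
  have "cis (of_int k * diophantine_angle) = cis (2 * pi * x) * cis (2 * pi * of_int m)"
    unfolding cis_mult x_def diophantine_angle_def by (simp add: algebra_simps)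
  also have "\<dots> = cis (2 * pi * x)" by (simp add: cis_multiple_2pi)
  finally have "norm (1 - cis (of_int k * diophantine_angle)) = norm (1 - cis (2 * pi * x))" by simp
  also have "\<dots> \<ge> \<bar>x\<bar>"
    using of_int_round_abs_le[of "of_int k * sqrt 2 :: real"]
    by (intro norm_one_minus_cis_ge) (simp add: x_def m_def abs_minus_commute)
  finally show ?thesis using sqrt2_badly_approximable[OF assms, of m] by (simp add: x_def)
qed

text \<open>
  Three derivatives multiply the coefficient of index \<open>k\<close> by \<open>(\<i> * k) ^ 3\<close>, and \<open>F \<mapsto> F - F(\<cdot> + \<beta>)\<close>
  multiplies it by \<open>1 - cis (k * \<beta>)\<close>; these are undone here.  One of the three powers of \<open>k\<close> pays
  for the small divisor, the other two make the series of the kernel absolutely convergent.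
\<close>

definition coboundary_coeff :: "int \<Rightarrow> complex" where
  "coboundary_coeff k = 1 / ((\<i> * of_int k) ^ 3 * (1 - cis (of_int k * diophantine_angle)))"

text \<open>
  The exponents have the sign opposite to the index because the kernel is going to be integrated against
  \<open>t \<mapsto> F (t + \<tau>)\<close>, not against \<open>t \<mapsto> F (\<tau> - t)\<close>.  The index \<open>0\<close>, where the divisor vanishes, is left out;
  this is why the mean value of \<open>F\<close> is lost.
\<close>

definition coboundary_term :: "nat \<Rightarrow> real \<Rightarrow> complex" where
  "coboundary_term n t = (coboundary_coeff (int (Suc n)) * cis (- of_int (int (Suc n)) * t)
      + coboundary_coeff (- int (Suc n)) * cis (- of_int (- int (Suc n)) * t)) / (2 * pi)"

definition coboundary_kernel :: "real \<Rightarrow> complex" where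
  "coboundary_kernel t = (\<Sum>n. coboundary_term n t)"

lemma norm_coboundary_coeff:
  "k \<noteq> 0 \<Longrightarrow> norm (coboundary_coeff k) \<le> 4 / (of_int k)\<^sup>2"
proof -
  assume k: "k \<noteq> 0"
  let ?k = "\<bar>of_int k :: real\<bar>"
  have k0: "?k > 0" using k by simp
  have "?k ^ 3 * norm (1 - cis (of_int k * diophantine_angle)) \<ge> ?k ^ 3 * (1 / (4 * ?k))"
    by (intro mult_left_mono norm_one_minus_cis_diophantine k) simp
  then have "?k ^ 3 * norm (1 - cis (of_int k * diophantine_angle)) \<ge> ?k\<^sup>2 / 4"
    using k0 by (simp add: power3_eq_cube power2_eq_square)
  then have "1 / (?k ^ 3 * norm (1 - cis (of_int k * diophantine_angle))) \<le> 1 / (?k\<^sup>2 / 4)"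
    using k0 by (intro divide_left_mono mult_pos_pos) (auto intro: less_le_trans[of 0 "?k\<^sup>2/4"])
  then show ?thesis
    by (simp add: coboundary_coeff_def norm_divide norm_mult norm_power)
qed

lemma norm_coboundary_term: "norm (coboundary_term n t) \<le> 8 * inverse (real (Suc n) ^ 2)"
proof -
  have "norm (coboundary_term n t) \<le> (norm (coboundary_coeff (int (Suc n))) + norm (coboundary_coeff (- int (Suc n)))) / (2 * pi)"
    unfolding coboundary_term_def norm_divide
    by (auto intro!: divide_right_mono order_trans[OF norm_triangle_ineq] simp: norm_mult)
  also have "\<dots> \<le> (4 / (real (Suc n))\<^sup>2 + 4 / (real (Suc n))\<^sup>2) / (2 * pi)"
    using norm_coboundary_coeff[of "int (Suc n)"] norm_coboundary_coeff[of "- int (Suc n)"]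
    by (intro divide_right_mono add_mono) (auto simp: power2_eq_square algebra_simps)
  also have "\<dots> \<le> (4 / (real (Suc n))\<^sup>2 + 4 / (real (Suc n))\<^sup>2) / 1"
    using pi_ge_two by (intro divide_left_mono) auto
  finally show ?thesis by (simp add: field_simps)
qed

lemma summable_coboundary_bound: "summable (\<lambda>n. 8 * inverse (real (Suc n) ^ 2))"
proof -
  have "summable (\<lambda>n. inverse (real n ^ 2))" by (rule inverse_power_summable) simp
  then have "summable (\<lambda>n. inverse (real (Suc n) ^ 2))" by (subst summable_Suc_iff)
  then show ?thesis by (rule summable_mult)
qed

lemma uniform_limit_coboundary_kernel:
  "uniform_limit UNIV (\<lambda>N t. \<Sum>n<N. coboundary_term n t) coboundary_kernel sequentially"
  unfolding coboundary_kernel_def[abs_def]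
  by (rule Weierstrass_m_test[OF norm_coboundary_term summable_coboundary_bound])

lemma continuous_coboundary_kernel: "continuous_on S coboundary_kernel"
proof -
  have "continuous_on UNIV coboundary_kernel"
    by (rule uniform_limit_theorem[OF _ uniform_limit_coboundary_kernel])
       (auto simp: coboundary_term_def intro!: continuous_intros always_eventually)
  then show ?thesis using continuous_on_subset by blast
qed

lemma periodic_derivative:
  fixes f f' :: "real \<Rightarrow> complex"
  assumes "\<And>t. (f has_vector_derivative f' t) (at t)" and per: "\<And>t. f (t + p) = f t"
  shows "f' (t + p) = f' t"
proof -
  have "((\<lambda>t. t + p) has_vector_derivative 1) (at t)"
    by (auto intro!: derivative_eq_intros)
  from vector_diff_chain_at[OF this assms(1)]
  have "((\<lambda>t. f (t + p)) has_vector_derivative f' (t + p)) (at t)" by (simp add: o_def)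
  then show ?thesis using assms(1)[of t] per by (auto dest: vector_derivative_unique_at)
qed

text \<open>
  The right-hand side is \<open>G \<tau> - G (\<tau> + \<beta>)\<close> for the function \<open>G\<close> obtained by integrating the translates
  of \<open>F3\<close> against the kernel.  Termwise integration of the kernel turns it into the Fourier series of
  \<open>F(\<cdot> + \<tau>)\<close> at \<open>0\<close> without the constant term.  The series thus converges, and Fourier inversion
  identifies the limit.
\<close>

theorem circle_cohomological_equation:
  fixes F F1 F2 F3 :: "real \<Rightarrow> complex"
  assumes d1: "\<And>t. (F has_vector_derivative F1 t) (at t)"
    and d2: "\<And>t. (F1 has_vector_derivative F2 t) (at t)"
    and d3: "\<And>t. (F2 has_vector_derivative F3 t) (at t)"
    and c3: "continuous_on UNIV F3"
    and per: "\<And>t. F (t + 2*pi) = F t"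
  shows "F \<tau> - fourier_coeff F 0 / (2*pi) =
    integral {-pi..pi} (\<lambda>t. coboundary_kernel t * (F3 (t + \<tau>) - F3 (t + \<tau> + diophantine_angle)))"
proof -
  let ?I = "{-pi..pi}"
  have per1: "\<And>t. F1 (t + 2*pi) = F1 t" by (rule periodic_derivative[OF d1 per])
  have per2: "\<And>t. F2 (t + 2*pi) = F2 t" by (rule periodic_derivative[OF d2 per1])
  have per3: "\<And>t. F3 (t + 2*pi) = F3 t" by (rule periodic_derivative[OF d3 per2])
  have c: "continuous_on UNIV g" if "\<And>t. (g has_vector_derivative g' t) (at t)" for g g' :: "real \<Rightarrow> complex"
    using that has_vector_derivative_continuous[of g] by (fastforce simp: continuous_on_eq_continuous_at)
  have F3: "fourier_coeff F3 k = (\<i> * of_int k) ^ 3 * fourier_coeff F k" for k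
    using fourier_coeff_deriv[OF d3 c3 per2, of k] fourier_coeff_deriv[OF d2 c[OF d3] per1, of k]
      fourier_coeff_deriv[OF d1 c[OF d2] per, of k] by (simp add: power3_eq_cube mult.assoc)
  define f where "f t = F (t + \<tau>)" for t
  have fk: "fourier_coeff f k = cis (of_int k * \<tau>) * fourier_coeff F k" for k
    unfolding f_def by (rule fourier_coeff_shift[OF c[OF d1] per])
  define G where "G t = F3 (t + \<tau>) - F3 (t + \<tau> + diophantine_angle)" for t
  have cG: "continuous_on S G" for S
  proof -
    have *: "continuous_on S (\<lambda>t. F3 (h t))" if "continuous_on S h" for h
      using continuous_on_compose2[OF c3 that] by simp
    have "continuous_on S (\<lambda>t. F3 (t + \<tau>))" "continuous_on S (\<lambda>t. F3 (t + \<tau> + diophantine_angle))"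
      by (rule *, intro continuous_intros)+
    then show ?thesis unfolding G_def by (rule continuous_on_diff)
  qed
  have Gk: "coboundary_coeff k * fourier_coeff G k = fourier_coeff f k" if "k \<noteq> 0" for k
  proof -
    have "fourier_coeff G k = fourier_coeff (\<lambda>t. F3 (t + \<tau>)) k - fourier_coeff (\<lambda>t. F3 (t + (\<tau> + diophantine_angle))) k"
    proof -
      have "continuous_on S (\<lambda>t. F3 (t + s))" for S s
        by (rule continuous_on_compose2[OF c3]) (auto intro!: continuous_intros)
      then show ?thesis
        unfolding fourier_coeff_def G_def left_diff_distrib add.assoc
        by (intro integral_diff integrable_continuous_interval continuous_intros)
    qed
    also have "\<dots> = (cis (of_int k * \<tau>) - cis (of_int k * (\<tau> + diophantine_angle))) * fourier_coeff F3 k"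
      unfolding fourier_coeff_shift[OF c3 per3] by (simp only: left_diff_distrib)
    also have "cis (of_int k * (\<tau> + diophantine_angle)) = cis (of_int k * \<tau>) * cis (of_int k * diophantine_angle)"
      by (simp add: cis_mult algebra_simps)
    finally have "fourier_coeff G k = (1 - cis (of_int k * diophantine_angle)) * (\<i> * of_int k) ^ 3 * fourier_coeff f k"
      unfolding F3 fk by (simp add: algebra_simps)
    moreover have "1 - cis (of_int k * diophantine_angle) \<noteq> 0"
    proof
      assume "1 - cis (of_int k * diophantine_angle) = 0"
      then have "1 / (4 * \<bar>of_int k :: real\<bar>) \<le> 0"
        using norm_one_minus_cis_diophantine[OF that] by simp
      then show False using that by (simp add: divide_le_0_iff)
    qed
    ultimately show ?thesis using that by (simp add: coboundary_coeff_def)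
  qed
  define I where "I = integral ?I (\<lambda>t. coboundary_kernel t * G t)"
  have lim: "(\<lambda>N. integral ?I (\<lambda>t. (\<Sum>n<N. coboundary_term n t) * G t)) \<longlonglongrightarrow> I"
  proof -
    have "bounded (G ` ?I)" by (intro compact_imp_bounded compact_continuous_image cG) auto
    then have "uniform_limit ?I (\<lambda>N t. (\<Sum>n<N. coboundary_term n t) * G t) (\<lambda>t. coboundary_kernel t * G t) sequentially"
      by (intro uniform_lim_mult uniform_limit_on_subset[OF uniform_limit_coboundary_kernel] uniform_limit_const
            compact_imp_bounded compact_continuous_image continuous_coboundary_kernel cG) auto
    then obtain J K where J: "\<And>N. ((\<lambda>t. (\<Sum>n<N. coboundary_term n t) * G t) has_integral J N) ?I"
        "((\<lambda>t. coboundary_kernel t * G t) has_integral K) ?I" "J \<longlonglongrightarrow> K"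
      by (rule uniform_limit_integral)
         (auto simp: coboundary_term_def intro!: continuous_intros cG)
    moreover have "J = (\<lambda>N. integral ?I (\<lambda>t. (\<Sum>n<N. coboundary_term n t) * G t))"
      using integral_unique[OF J(1)] by simp
    moreover have "K = I"
      unfolding I_def using integral_unique[OF J(2)] by simp
    ultimately show ?thesis using J(3) by simp
  qed
  have term_int: "integral ?I (\<lambda>t. coboundary_term n t * G t) =
      (fourier_coeff f (int (Suc n)) + fourier_coeff f (- int (Suc n))) / (2 * pi)" for n
  proof -
    let ?k = "int (Suc n)"
    have "integral ?I (\<lambda>t. coboundary_term n t * G t) =
      integral ?I (\<lambda>t. (coboundary_coeff ?k * (G t * cis (- of_int ?k * t))
         + coboundary_coeff (-?k) * (G t * cis (- of_int (-?k) * t))) / (2 * pi))"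
      unfolding coboundary_term_def by (simp add: algebra_simps)
    also have "\<dots> = (coboundary_coeff ?k * fourier_coeff G ?k + coboundary_coeff (-?k) * fourier_coeff G (-?k)) / (2*pi)"
      unfolding integral_divide fourier_coeff_def
      by (subst integral_add) (auto intro!: integrable_continuous_interval continuous_intros cG)
    finally show ?thesis using Gk[of ?k] Gk[of "-?k"] by simp
  qed
  have "integral ?I (\<lambda>t. (\<Sum>n<N. coboundary_term n t) * G t) =
      ((\<Sum>k=-int N..int N. fourier_coeff f k) - fourier_coeff f 0) / (2 * pi)" for N
  proof -
    have "integral ?I (\<lambda>t. (\<Sum>n<N. coboundary_term n t) * G t) =
        (\<Sum>n<N. (fourier_coeff f (int (Suc n)) + fourier_coeff f (- int (Suc n))) / (2 * pi))"
      unfolding sum_distrib_right term_int[symmetric]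
      by (intro integral_sum) (auto intro!: integrable_continuous_interval continuous_intros cG simp: coboundary_term_def)
    also have "\<dots> = (\<Sum>n<N. fourier_coeff f (int (Suc n)) + fourier_coeff f (- int (Suc n))) / (2 * pi)"
      by (simp add: sum_divide_distrib)
    also have "(\<Sum>n<N. fourier_coeff f (int (Suc n)) + fourier_coeff f (- int (Suc n)))
        = (\<Sum>k=-int N..int N. fourier_coeff f k) - fourier_coeff f 0"
    proof (induction N)
      case (Suc K)
      have I: "{-int (Suc K)..int (Suc K)} = insert (-int (Suc K)) (insert (int (Suc K)) {-int K..int K})" by auto
      have "(\<Sum>k=-int (Suc K)..int (Suc K). fourier_coeff f k)
          = fourier_coeff f (-int (Suc K)) + (fourier_coeff f (int (Suc K)) + (\<Sum>k=-int K..int K. fourier_coeff f k))"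
        unfolding I by (subst sum.insert, simp, force)+ simp
      then show ?case using Suc by simp
    qed simp
    finally show ?thesis .
  qed
  with lim have "(\<lambda>N. ((\<Sum>k=-int N..int N. fourier_coeff f k) - fourier_coeff f 0) / (2 * pi)) \<longlonglongrightarrow> I" by simp
  then have "(\<lambda>N. ((\<Sum>k=-int N..int N. fourier_coeff f k) - fourier_coeff f 0) / (2 * pi) * (2 * pi) + fourier_coeff f 0) \<longlonglongrightarrow> I * (2*pi) + fourier_coeff f 0"
    by (intro tendsto_intros)
  then have "(\<lambda>N. \<Sum>k=-int N..int N. fourier_coeff f k) \<longlonglongrightarrow> I * (2*pi) + fourier_coeff f 0"
    by simp
  moreover have "(f has_vector_derivative F1 (t + \<tau>)) (at t)" for t
  proof -
    have "((\<lambda>t. t + \<tau>) has_vector_derivative 1) (at t)" by (auto intro!: derivative_eq_intros)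
    from vector_diff_chain_at[OF this d1] show ?thesis by (simp add: o_def f_def[abs_def])
  qed
  ultimately have "I * (2*pi) + fourier_coeff f 0 = 2 * pi * f 0" by (intro fourier_inversion_at_0)
  then have "f 0 - fourier_coeff f 0 / (2 * pi) = I" by (simp add: field_simps)
  moreover have "fourier_coeff f 0 = fourier_coeff F 0" using fk[of 0] by simp
  ultimately show ?thesis by (simp add: f_def I_def G_def)
qed

section \<open>Smooth functions and their partial derivatives\<close>

definition smooth_on :: "(real^'n::finite) set \<Rightarrow> (real^'n \<Rightarrow> complex) \<Rightarrow> bool" where
  "smooth_on \<Omega> \<phi> \<longleftrightarrow> (\<forall>is. \<forall>x\<in>\<Omega>. pderivs is \<phi> differentiable (at x))"

lemma pderivs_append: "pderivs (xs @ ys) \<phi> = pderivs xs (pderivs ys \<phi>)"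
  by (induction xs) auto

lemma pderiv_dir_eqI: "(f has_derivative f') (at x) \<Longrightarrow> pderiv_dir i f x = f' (axis i 1)"
  unfolding pderiv_dir_def using frechet_derivative_at by metis

lemma has_derivative_pderiv_dir:
  assumes "f differentiable (at x)"
  shows "(f has_derivative (\<lambda>h. \<Sum>i\<in>UNIV. of_real (h $ i) * pderiv_dir i f x)) (at x)"
proof -
  let ?D = "frechet_derivative f (at x)"
  have D: "(f has_derivative ?D) (at x)" using assms frechet_derivative_works by blast
  then have lin: "linear ?D" by (simp add: has_derivative_linear)
  have "?D h = (\<Sum>i\<in>UNIV. of_real (h $ i) * pderiv_dir i f x)" for h
  proof -
    have "?D h = ?D (\<Sum>i\<in>UNIV. (h $ i) *\<^sub>R axis i 1)"
      using basis_expansion[of h] by (simp add: scalar_mult_eq_scaleR)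
    also have "\<dots> = (\<Sum>i\<in>UNIV. (h $ i) *\<^sub>R ?D (axis i 1))"
      by (simp add: linear_sum[OF lin] linear_cmul[OF lin])
    finally show ?thesis by (simp add: pderiv_dir_def scaleR_conv_of_real)
  qed
  then show ?thesis using D by (metis (no_types, lifting) ext)
qed

lemma pderivs_cong:
  assumes "open \<Omega>" "\<And>x. x \<in> \<Omega> \<Longrightarrow> f x = g x" "x \<in> \<Omega>"
  shows "pderivs is f x = pderivs is g x"
  using assms(3)
proof (induction "is" arbitrary: x)
  case (Cons i "is")
  have "frechet_derivative (pderivs is f) (at x) = frechet_derivative (pderivs is g) (at x)"
  proof -
    have "((pderivs is f) has_derivative D) (at x) \<longleftrightarrow> ((pderivs is g) has_derivative D) (at x)" for D
      using Cons has_derivative_transform_within_open[OF _ \<open>open \<Omega>\<close>] by metis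
    then show ?thesis unfolding frechet_derivative_def by simp
  qed
  then show ?case by (simp add: pderiv_dir_def)
qed (use assms in simp)

lemma differentiable_cong_open:
  assumes "open \<Omega>" "\<And>x. x \<in> \<Omega> \<Longrightarrow> f x = g x" "x \<in> \<Omega>" "f differentiable (at x)"
  shows "g differentiable (at x)"
  using assms has_derivative_transform_within_open[OF _ assms(1,3)] unfolding differentiable_def by metis

lemma smooth_on_cong:
  assumes "open \<Omega>" "\<And>x. x \<in> \<Omega> \<Longrightarrow> f x = g x" "smooth_on \<Omega> f"
  shows "smooth_on \<Omega> g"
  unfolding smooth_on_def
proof (intro allI ballI)
  fix "is" x assume "x \<in> \<Omega>"
  then show "pderivs is g differentiable (at x)"
    using assms(3) unfolding smooth_on_def
    by (intro differentiable_cong_open[OF assms(1) pderivs_cong[OF assms(1,2)]]) blast+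
qed

lemma smooth_on_pderiv_dir: "smooth_on \<Omega> \<phi> \<Longrightarrow> smooth_on \<Omega> (pderiv_dir i \<phi>)"
  unfolding smooth_on_def using pderivs_append[of _ "[i]" \<phi>] by (metis pderivs.simps)

lemma smooth_on_pderivs: "smooth_on \<Omega> \<phi> \<Longrightarrow> smooth_on \<Omega> (pderivs is \<phi>)"
  by (induction "is") (auto intro: smooth_on_pderiv_dir)

lemma smooth_on_differentiable: "smooth_on \<Omega> \<phi> \<Longrightarrow> x \<in> \<Omega> \<Longrightarrow> \<phi> differentiable (at x)"
  unfolding smooth_on_def by (metis pderivs.simps(1))

lemma smooth_on_continuous_on: "smooth_on \<Omega> \<phi> \<Longrightarrow> continuous_on \<Omega> \<phi>"
  by (meson continuous_at_imp_continuous_on differentiable_imp_continuous_within smooth_on_differentiable)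

lemma smooth_on_subset: "smooth_on \<Omega> \<phi> \<Longrightarrow> \<Omega>' \<subseteq> \<Omega> \<Longrightarrow> smooth_on \<Omega>' \<phi>"
  unfolding smooth_on_def by blast

text \<open>
  Smoothness and formulas for iterated derivatives are obtained together: if each \<open>d is\<close> is differentiable
  with partial derivatives \<open>d (i # is)\<close>, then \<open>d\<close> consists of the iterated derivatives of \<open>f = d []\<close>.
\<close>

lemma pderivs_eqI:
  assumes "open \<Omega>"
    and d0: "\<And>x. x \<in> \<Omega> \<Longrightarrow> f x = d [] x"
    and d: "\<And>is x. x \<in> \<Omega> \<Longrightarrow> d is differentiable (at x)"
    and ds: "\<And>i is x. x \<in> \<Omega> \<Longrightarrow> pderiv_dir i (d is) x = d (i # is) x"
  shows "smooth_on \<Omega> f" and "x \<in> \<Omega> \<Longrightarrow> pderivs is f x = d is x"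
proof -
  have eq: "\<And>is x. x \<in> \<Omega> \<Longrightarrow> pderivs is f x = d is x" subgoal for "is" x
  proof (induction "is" arbitrary: x)
    case (Cons i "is")
    have "pderivs [i] (pderivs is f) x = pderivs [i] (d is) x"
      using Cons by (intro pderivs_cong[OF assms(1)]) auto
    then show ?case using ds Cons.prems by simp
  qed (use d0 in simp)
  done
  show "x \<in> \<Omega> \<Longrightarrow> pderivs is f x = d is x" by (rule eq)
  show "smooth_on \<Omega> f"
    unfolding smooth_on_def
    using differentiable_cong_open[OF assms(1) _ _ d] eq by metis
qed

lemma
  assumes "open \<Omega>" "smooth_on \<Omega> f" "smooth_on \<Omega> g"
  shows smooth_on_add: "smooth_on \<Omega> (\<lambda>x. f x + g x)"
    and pderivs_add: "x \<in> \<Omega> \<Longrightarrow> pderivs is (\<lambda>x. f x + g x) x = pderivs is f x + pderivs is g x"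
proof -
  let ?d = "\<lambda>is x. pderivs is f x + pderivs is g x"
  have D: "(?d is has_derivative (\<lambda>h. (\<Sum>i\<in>UNIV. of_real (h $ i) * pderiv_dir i (pderivs is f) x) +
         (\<Sum>i\<in>UNIV. of_real (h $ i) * pderiv_dir i (pderivs is g) x))) (at x)" if "x \<in> \<Omega>" for "is" x
    using assms that unfolding smooth_on_def by (intro has_derivative_add has_derivative_pderiv_dir) auto
  have E: "pderiv_dir i (?d is) x = ?d (i # is) x" if "x \<in> \<Omega>" for i "is" x
    unfolding pderiv_dir_eqI[OF D[OF that]] by (simp add: axis_def if_distrib if_distribR cong: if_cong)
  show "smooth_on \<Omega> (\<lambda>x. f x + g x)"
    using D E by (intro pderivs_eqI(1)[OF assms(1), where d = ?d]) (auto simp: differentiable_def)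
  show "x \<in> \<Omega> \<Longrightarrow> pderivs is (\<lambda>x. f x + g x) x = pderivs is f x + pderivs is g x"
    using D E by (intro pderivs_eqI(2)[OF assms(1), where d = ?d]) (auto simp: differentiable_def)
qed

lemma
  assumes "open \<Omega>" "smooth_on \<Omega> f"
  shows smooth_on_cmult: "smooth_on \<Omega> (\<lambda>x. c * f x)"
    and pderivs_cmult: "x \<in> \<Omega> \<Longrightarrow> pderivs is (\<lambda>x. c * f x) x = c * pderivs is f x"
proof -
  let ?d = "\<lambda>is x. c * pderivs is f x"
  have D: "(?d is has_derivative (\<lambda>h. c * (\<Sum>i\<in>UNIV. of_real (h $ i) * pderiv_dir i (pderivs is f) x))) (at x)" if "x \<in> \<Omega>" for "is" x
    using assms that unfolding smooth_on_def by (intro has_derivative_mult_right has_derivative_pderiv_dir) auto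
  have E: "pderiv_dir i (?d is) x = ?d (i # is) x" if "x \<in> \<Omega>" for i "is" x
    unfolding pderiv_dir_eqI[OF D[OF that]] by (simp add: axis_def if_distrib if_distribR cong: if_cong)
  show "smooth_on \<Omega> (\<lambda>x. c * f x)"
    using D E by (intro pderivs_eqI(1)[OF assms(1), where d = ?d]) (auto simp: differentiable_def)
  show "x \<in> \<Omega> \<Longrightarrow> pderivs is (\<lambda>x. c * f x) x = c * pderivs is f x"
    using D E by (intro pderivs_eqI(2)[OF assms(1), where d = ?d]) (auto simp: differentiable_def)
qed

lemma
  assumes "open \<Omega>" "smooth_on \<Omega> f" "smooth_on \<Omega> g"
  shows smooth_on_diff: "smooth_on \<Omega> (\<lambda>x. f x - g x)"
    and pderivs_diff: "x \<in> \<Omega> \<Longrightarrow> pderivs is (\<lambda>x. f x - g x) x = pderivs is f x - pderivs is g x"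
proof -
  have eq: "(\<lambda>x. f x - g x) = (\<lambda>x. f x + (-1) * g x)" by simp
  note g = smooth_on_cmult[OF assms(1,3), of "-1"]
  show "smooth_on \<Omega> (\<lambda>x. f x - g x)"
    unfolding eq by (rule smooth_on_add[OF assms(1,2) g])
  show "pderivs is (\<lambda>x. f x - g x) x = pderivs is f x - pderivs is g x" if "x \<in> \<Omega>"
    unfolding eq pderivs_add[OF assms(1,2) g that] pderivs_cmult[OF assms(1,3) that] by simp
qed

text \<open>
  The lists that arise from a list by striking out one occurrence of \<open>i\<close>; they index the lower order
  terms of Leibniz' rule for a product with the \<open>i\<close>-th coordinate.
\<close>

primrec strike :: "'n \<Rightarrow> 'n list \<Rightarrow> 'n list list" where
  "strike i [] = []"
| "strike i (k # is) = map (Cons k) (strike i is) @ (if k = i then [is] else [])"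

lemma length_strike: "length (strike i is) \<le> length is"
  by (induction "is") auto

lemma length_in_strike: "js \<in> set (strike i is) \<Longrightarrow> Suc (length js) = length is"
  by (induction "is" arbitrary: js) (auto split: if_splits)

lemma has_derivative_sum_list:
  assumes "\<And>g. g \<in> set gs \<Longrightarrow> (f g has_derivative f' g) F"
  shows "((\<lambda>x. \<Sum>g\<leftarrow>gs. f g x) has_derivative (\<lambda>h. \<Sum>g\<leftarrow>gs. f' g h)) F"
  using assms by (induction gs) (auto intro!: has_derivative_add)

lemma
  assumes "open \<Omega>" "smooth_on \<Omega> f"
  shows smooth_on_coord_mult: "smooth_on \<Omega> (\<lambda>x. of_real (x $ k) * f x)"
    and pderivs_coord_mult: "x \<in> \<Omega> \<Longrightarrow> pderivs is (\<lambda>x. of_real (x $ k) * f x) x =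
       of_real (x $ k) * pderivs is f x + (\<Sum>js\<leftarrow>strike k is. pderivs js f x)"
proof -
  let ?d = "\<lambda>is x. of_real (x $ k) * pderivs is f x + (\<Sum>js\<leftarrow>strike k is. pderivs js f x)"
  let ?D = "\<lambda>is x h. \<Sum>i\<in>UNIV. of_real (h $ i) * pderiv_dir i (pderivs is f) x"
  have D1: "(pderivs is f has_derivative ?D is x) (at x)" if "x \<in> \<Omega>" for "is" x
    using assms that unfolding smooth_on_def by (intro has_derivative_pderiv_dir) auto
  have D: "(?d is has_derivative (\<lambda>h. (of_real (x $ k) * ?D is x h + of_real (h $ k) * pderivs is f x) +
       (\<Sum>js\<leftarrow>strike k is. ?D js x h))) (at x)" if "x \<in> \<Omega>" for "is" x
    using that by (intro has_derivative_add has_derivative_sum_list has_derivative_mult D1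
        bounded_linear_imp_has_derivative bounded_linear_compose[OF bounded_linear_of_real] bounded_linear_vec_nth)
  have ax: "(\<Sum>i\<in>UNIV. of_real (axis j 1 $ i) * c i) = (c j :: complex)" for j and c :: "'a \<Rightarrow> complex"
    by (simp add: axis_def if_distrib if_distribR cong: if_cong)
  have E: "pderiv_dir i (?d is) x = ?d (i # is) x" if "x \<in> \<Omega>" for i "is" x
    unfolding pderiv_dir_eqI[OF D[OF that]] ax by (auto simp: o_def axis_def)
  show "smooth_on \<Omega> (\<lambda>x. of_real (x $ k) * f x)"
    using D E by (intro pderivs_eqI(1)[OF assms(1), where d = ?d]) (auto simp: differentiable_def)
  show "x \<in> \<Omega> \<Longrightarrow> pderivs is (\<lambda>x. of_real (x $ k) * f x) x = ?d is x"
    using D E by (intro pderivs_eqI(2)[OF assms(1), where d = ?d]) (auto simp: differentiable_def)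
qed

section \<open>Weighted averages over rotations\<close>

lemma rotation_matrix_norm: "rotation_matrix (U :: real^'n^'n) \<Longrightarrow> norm (U *v x) = norm x"
  using orthogonal_transformation_matrix[of "(*v) U"] orthogonal_transformation_norm[of "(*v) U"]
  by (simp add: rotation_matrix_def)

lemma rotation_matrix_mult:
  "rotation_matrix (U :: real^'n^'n) \<Longrightarrow> rotation_matrix V \<Longrightarrow> rotation_matrix (U ** V)"
  by (simp add: rotation_matrix_def orthogonal_matrix_mul det_mul)

lemma rotation_matrix_transpose: "rotation_matrix (U :: real^'n^'n) \<Longrightarrow> rotation_matrix (transpose U)"
  by (simp add: rotation_matrix_def orthogonal_matrix_transpose det_transpose)

lemma rotation_matrix_entry_le: 
  assumes "rotation_matrix (U :: real^'n^'n)"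
  shows "\<bar>U $ i $ j\<bar> \<le> 1"
proof -
  have "\<bar>(U *v axis j 1) $ i\<bar> \<le> norm (U *v axis j 1)" by (rule component_le_norm_cart)
  then show ?thesis unfolding rotation_matrix_norm[OF assms] by (simp add: matrix_vector_mult_basis column_def)
qed

lemma rotation_invariant_set_mem:
  "rotation_invariant_set \<Omega> \<Longrightarrow> rotation_matrix U \<Longrightarrow> x \<in> \<Omega> \<Longrightarrow> U *v x \<in> \<Omega>"
  unfolding rotation_invariant_set_def by blast

lemma continuous_on_matrix_vector_mult [continuous_intros]:
  fixes f :: "'b::topological_space \<Rightarrow> real^'n^'m" and g :: "'b \<Rightarrow> real^'n"
  assumes "continuous_on S f" "continuous_on S g"
  shows "continuous_on S (\<lambda>x. f x *v g x)"
  unfolding matrix_vector_mult_def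
  by (intro continuous_intros continuous_on_vec_lambda assms continuous_on_component)

lemma compact_rotations: "compact {U :: real^'n^'n. rotation_matrix U}"
proof (rule compact_eq_bounded_closed[THEN iffD2], intro conjI)
  have "norm U \<le> (\<Sum>i\<in>(UNIV::'n set). \<Sum>j\<in>(UNIV::'n set). 1)" if "rotation_matrix U" for U :: "real^'n^'n"
  proof -
    have "norm U \<le> (\<Sum>i\<in>UNIV. norm (U $ i))" unfolding norm_vec_def by (rule L2_set_le_sum) simp
    also have "\<dots> \<le> (\<Sum>i\<in>UNIV. \<Sum>j\<in>UNIV. \<bar>U $ i $ j\<bar>)"
      by (intro sum_mono norm_le_l1_cart)
    also have "\<dots> \<le> (\<Sum>i\<in>(UNIV::'n set). \<Sum>j\<in>(UNIV::'n set). 1)"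
      by (intro sum_mono rotation_matrix_entry_le that)
    finally show ?thesis .
  qed
  then show "bounded {U :: real^'n^'n. rotation_matrix U}" unfolding bounded_iff by blast
  have "{U :: real^'n^'n. rotation_matrix U} = {U. (\<forall>x y. (U *v x) \<bullet> (U *v y) = x \<bullet> y) \<and> det U = 1}"
    unfolding rotation_matrix_def
    using orthogonal_transformation_matrix[of "(*v) _"] by (auto simp: orthogonal_transformation_def)
  also have "\<dots> = (\<Inter>x. \<Inter>y. {U. (U *v x) \<bullet> (U *v y) = x \<bullet> y}) \<inter> {U. det U = 1}" by auto
  also have "closed \<dots>"
    by (intro closed_Int closed_INT ballI closed_Collect_eq continuous_intros)
       (auto simp: det_def intro!: continuous_intros continuous_on_component)
  finally show "closed {U :: real^'n^'n. rotation_matrix U}" .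
qed

text \<open>
  Operators that move points along orbits can only be controlled on rotation invariant sets; the hull
  replaces a given compact set by a compact invariant one.
\<close>

definition rotation_hull :: "(real^'n::finite) set \<Rightarrow> (real^'n) set" where
  "rotation_hull K = (\<lambda>(U, x). U *v x) ` ({U. rotation_matrix U} \<times> K)"

lemma rotation_hull_memI: "rotation_matrix U \<Longrightarrow> x \<in> K \<Longrightarrow> U *v x \<in> rotation_hull K"
  unfolding rotation_hull_def by force

lemma rotation_hull_subset: "K \<subseteq> rotation_hull K"
proof
  fix x assume "x \<in> K"
  then have "mat 1 *v x \<in> rotation_hull K"
    by (intro rotation_hull_memI) (auto simp: rotation_matrix_def orthogonal_matrix_id)
  then show "x \<in> rotation_hull K" by simp
qed

lemma rotation_hull_least:
  "rotation_invariant_set \<Omega> \<Longrightarrow> K \<subseteq> \<Omega> \<Longrightarrow> rotation_hull K \<subseteq> \<Omega>"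
  by (auto simp: rotation_hull_def intro: rotation_invariant_set_mem)

lemma rotation_invariant_setI:
  assumes "\<And>U x. rotation_matrix U \<Longrightarrow> x \<in> \<Omega> \<Longrightarrow> U *v x \<in> \<Omega>"
  shows "rotation_invariant_set \<Omega>"
  unfolding rotation_invariant_set_def
proof (intro allI impI equalityI subsetI)
  fix U :: "real^'a^'a" and x assume U: "rotation_matrix U" and x: "x \<in> \<Omega>"
  have "U *v (transpose U *v x) = x"
    using U by (simp add: matrix_vector_mul_assoc rotation_matrix_def orthogonal_matrix_def del: transpose_matrix_vector)
  moreover have "transpose U *v x \<in> \<Omega>" by (intro assms rotation_matrix_transpose U x)
  ultimately show "x \<in> (*v) U ` \<Omega>" by (metis image_eqI)
qed (use assms in auto)

lemma rotation_invariant_hull: "rotation_invariant_set (rotation_hull K)"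
  by (rule rotation_invariant_setI)
     (auto simp: rotation_hull_def matrix_vector_mul_assoc intro!: image_eqI rotation_matrix_mult
       split: prod.splits)

lemma compact_rotation_hull: "compact K \<Longrightarrow> compact (rotation_hull K)"
  unfolding rotation_hull_def split_beta
  by (intro compact_continuous_image compact_Times compact_rotations continuous_intros)

text \<open>
  The difference quotients are bounded by \<open>2 * L\<close>, so that dominated convergence applies.  Measurability
  and the Lipschitz bound are demanded near \<open>x\<close> only, since the functions to be differentiated are
  known on an open set and arbitrary elsewhere.
\<close>

lemma has_derivative_integral:
  fixes F :: "'a::real_normed_vector \<Rightarrow> 'y \<Rightarrow> complex"
  assumes fin: "finite_measure \<mu>" and e: "e > 0"
    and meas: "\<And>z. z \<in> ball x e \<Longrightarrow> F z \<in> borel_measurable \<mu>"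
    and int: "integrable \<mu> (F x)"
    and deriv: "\<And>y. y \<in> space \<mu> \<Longrightarrow> ((\<lambda>z. F z y) has_derivative F' y) (at x)"
    and lip: "\<And>z y. z \<in> ball x e \<Longrightarrow> y \<in> space \<mu> \<Longrightarrow> norm (F z y - F x y) \<le> L * norm (z - x)"
    and meas': "\<And>h. (\<lambda>y. F' y h) \<in> borel_measurable \<mu>"
    and bound': "\<And>y h. y \<in> space \<mu> \<Longrightarrow> norm (F' y h) \<le> L * norm h"
  shows "((\<lambda>z. LINT y|\<mu>. F z y) has_derivative (\<lambda>h. LINT y|\<mu>. F' y h)) (at x)"
proof -
  interpret finite_measure \<mu> by fact
  have lin: "bounded_linear (F' y)" if "y \<in> space \<mu>" for y
    using deriv[OF that] by (rule has_derivative_bounded_linear)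
  have int': "integrable \<mu> (\<lambda>y. F' y h)" for h
    using bound' by (intro integrable_const_bound[of _ "L * norm h"] meas') auto
  have intz: "integrable \<mu> (F z)" if "z \<in> ball x e" for z
  proof -
    have "integrable \<mu> (\<lambda>y. F z y - F x y)"
      using lip[OF that] int meas[OF that]
      by (intro integrable_const_bound[of _ "L * norm (z - x)"]) auto
    from Bochner_Integration.integrable_add[OF this int] show ?thesis by simp
  qed
  have bl: "bounded_linear (\<lambda>h. LINT y|\<mu>. F' y h)"
  proof (rule bounded_linear_intro[where K = "L * measure \<mu> (space \<mu>)"])
    show "(LINT y|\<mu>. F' y (h + k)) = (LINT y|\<mu>. F' y h) + (LINT y|\<mu>. F' y k)" for h k
    proof -
      have "(LINT y|\<mu>. F' y (h + k)) = (LINT y|\<mu>. F' y h + F' y k)"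
        using lin by (intro Bochner_Integration.integral_cong) (auto simp: linear_add[OF bounded_linear.linear])
      then show ?thesis using int' by simp
    qed
    show "(LINT y|\<mu>. F' y (r *\<^sub>R h)) = r *\<^sub>R (LINT y|\<mu>. F' y h)" for r h
    proof -
      have "(LINT y|\<mu>. F' y (r *\<^sub>R h)) = (LINT y|\<mu>. r *\<^sub>R F' y h)"
        using lin by (intro Bochner_Integration.integral_cong) (auto simp: linear_cmul[OF bounded_linear.linear])
      then show ?thesis by simp
    qed
    show "norm (LINT y|\<mu>. F' y h) \<le> norm h * (L * measure \<mu> (space \<mu>))" for h
    proof -
      have "norm (LINT y|\<mu>. F' y h) \<le> (LINT y|\<mu>. norm (F' y h))" by simp
      also have "\<dots> \<le> (LINT y|\<mu>. L * norm h)"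
        using bound' int' by (intro integral_mono) auto
      finally show ?thesis by (simp add: mult_ac)
    qed
  qed
  let ?q = "\<lambda>z y. (F z y - F x y - F' y (z - x)) /\<^sub>R norm (z - x)"
  have "((\<lambda>z. LINT y|\<mu>. ?q z y) \<longlongrightarrow> 0) (at x)"
    unfolding tendsto_at_iff_sequentially o_def
  proof (intro allI impI)
    fix X :: "nat \<Rightarrow> 'a" assume X: "\<forall>i. X i \<in> UNIV - {x}" and lim: "X \<longlonglongrightarrow> x"
    obtain N where N: "\<And>n. n \<ge> N \<Longrightarrow> X n \<in> ball x e"
      using LIMSEQ_D[OF lim e] by (auto simp: dist_norm norm_minus_commute)
    define Y where "Y n = X (n + N)" for n
    have Y: "Y n \<in> ball x e" "Y n \<noteq> x" for n using N X unfolding Y_def by auto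
    have Ylim: "Y \<longlonglongrightarrow> x" unfolding Y_def by (rule LIMSEQ_ignore_initial_segment[OF lim])
    have "(\<lambda>n. LINT y|\<mu>. ?q (Y n) y) \<longlonglongrightarrow> (LINT y|\<mu>. 0)"
    proof (rule integral_dominated_convergence[where w = "\<lambda>_. 2 * L"])
      show "(\<lambda>y. ?q (Y n) y) \<in> borel_measurable \<mu>" for n
        using meas[OF Y(1), of n] meas[of x] meas'[of "Y n - x"] e by simp
      show "AE y in \<mu>. (\<lambda>n. ?q (Y n) y) \<longlonglongrightarrow> 0"
      proof (rule AE_I2)
        fix y assume y: "y \<in> space \<mu>"
        have "((\<lambda>z. ?q z y) \<longlongrightarrow> 0) (at x)"
          using deriv[OF y] by (simp only: has_derivative_at_within)
        then show "(\<lambda>n. ?q (Y n) y) \<longlonglongrightarrow> 0"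
          unfolding tendsto_at_iff_sequentially o_def using Y Ylim by auto
      qed
      show "AE y in \<mu>. norm (?q (Y n) y) \<le> 2 * L" for n
      proof (rule AE_I2)
        fix y assume y: "y \<in> space \<mu>"
        have "norm (F (Y n) y - F x y - F' y (Y n - x)) \<le> 2 * L * norm (Y n - x)"
          using lip[OF Y(1) y, of n] bound'[OF y, of "Y n - x"]
            norm_triangle_ineq4[of "F (Y n) y - F x y" "F' y (Y n - x)"] by linarith
        then show "norm (?q (Y n) y) \<le> 2 * L"
          using Y(2)[of n] by (simp add: divide_simps)
      qed
    qed auto
    then have "(\<lambda>n. LINT y|\<mu>. ?q (Y n) y) \<longlonglongrightarrow> 0" by simp
    then show "(\<lambda>n. LINT y|\<mu>. ?q (X n) y) \<longlonglongrightarrow> 0"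
      unfolding Y_def by (rule LIMSEQ_offset)
  qed
  moreover have "\<forall>\<^sub>F z in at x. (LINT y|\<mu>. ?q z y) =
      ((LINT y|\<mu>. F z y) - (LINT y|\<mu>. F x y) - (LINT y|\<mu>. F' y (z - x))) /\<^sub>R norm (z - x)"
  proof -
    have "\<forall>\<^sub>F z in at x. z \<in> ball x e" using e by (intro eventually_at_in_open') auto
    then show ?thesis
    proof eventually_elim
      case (elim z)
      then show ?case using intz[OF elim] int int' by simp
    qed
  qed
  ultimately have "((\<lambda>z. ((LINT y|\<mu>. F z y) - (LINT y|\<mu>. F x y) - (LINT y|\<mu>. F' y (z - x))) /\<^sub>R norm (z - x)) \<longlongrightarrow> 0) (at x)"
    by (rule Lim_transform_eventually)
  then show ?thesis using bl by (simp only: has_derivative_at_within simp_thms)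
qed

text \<open>
  The weight and the parametrization are arbitrary for two reasons: means over distributions of rotations
  and integrals along a circle against the kernel of the cohomological equation become instances, and
  derivatives of averages are sums of averages, with the entries of the rotations absorbed by the weight.
\<close>

definition rot_avg :: "'y measure \<Rightarrow> ('y \<Rightarrow> complex) \<Rightarrow> ('y \<Rightarrow> real^'n^'n) \<Rightarrow> (real^'n::finite \<Rightarrow> complex)
    \<Rightarrow> real^'n \<Rightarrow> complex" where
  "rot_avg \<mu> a T \<phi> x = (LINT y|\<mu>. a y * \<phi> (T y *v x))"

definition rotation_family :: "'y measure \<Rightarrow> ('y \<Rightarrow> real^'n^'n::finite) \<Rightarrow> bool" where
  "rotation_family \<mu> T \<longleftrightarrow> finite_measure \<mu> \<and> T \<in> borel_measurable \<mu> \<and> (\<forall>y\<in>space \<mu>. rotation_matrix (T y))"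

definition bounded_weight :: "'y measure \<Rightarrow> ('y \<Rightarrow> complex) \<Rightarrow> real \<Rightarrow> bool" where
  "bounded_weight \<mu> a c \<longleftrightarrow> a \<in> borel_measurable \<mu> \<and> (\<forall>y\<in>space \<mu>. norm (a y) \<le> c)"

lemma measurable_rotate:
  fixes \<phi> :: "real^'n::finite \<Rightarrow> complex"
  assumes T: "rotation_family \<mu> T" and \<phi>: "continuous_on \<Omega> \<phi>"
    and \<Omega>: "open \<Omega>" "rotation_invariant_set \<Omega>" "x \<in> \<Omega>"
  shows "(\<lambda>y. \<phi> (T y *v x)) \<in> borel_measurable \<mu>"
proof -
  have "(\<lambda>w. indicator \<Omega> w *\<^sub>R \<phi> w) \<in> borel_measurable borel"
    using \<Omega>(1) \<phi> by (intro borel_measurable_continuous_on_indicator) auto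
  moreover have "(\<lambda>y. T y *v x) \<in> borel_measurable \<mu>"
  proof -
    have "(\<lambda>A::real^'n^'n. A *v x) \<in> borel_measurable borel"
      by (intro borel_measurable_continuous_onI continuous_intros)
    then show ?thesis using T by (auto simp: rotation_family_def)
  qed
  ultimately have "(\<lambda>y. indicator \<Omega> (T y *v x) *\<^sub>R \<phi> (T y *v x)) \<in> borel_measurable \<mu>"
    by (rule measurable_compose_rev)
  then show ?thesis
  proof (rule measurable_cong[THEN iffD1, rotated])
    fix y assume "y \<in> space \<mu>"
    then have "T y *v x \<in> \<Omega>"
      using T rotation_invariant_set_mem[OF \<Omega>(2) _ \<Omega>(3)] by (simp add: rotation_family_def)
    then show "indicator \<Omega> (T y *v x) *\<^sub>R \<phi> (T y *v x) = \<phi> (T y *v x)" by simp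
  qed
qed

lemma rotate_bounded:
  fixes \<phi> :: "real^'n::finite \<Rightarrow> complex"
  assumes \<phi>: "continuous_on \<Omega> \<phi>" and \<Omega>: "rotation_invariant_set \<Omega>" and K: "compact K" "K \<subseteq> \<Omega>"
  obtains B where "B \<ge> 0" "\<And>U x. rotation_matrix U \<Longrightarrow> x \<in> K \<Longrightarrow> norm (\<phi> (U *v x)) \<le> B"
proof -
  have "bounded (\<phi> ` rotation_hull K)"
    using compact_rotation_hull[OF K(1)] rotation_hull_least[OF \<Omega> K(2)] \<phi>
    by (intro compact_imp_bounded compact_continuous_image) (auto intro: continuous_on_subset)
  then obtain B where "\<And>z. z \<in> rotation_hull K \<Longrightarrow> norm (\<phi> z) \<le> B"
    unfolding bounded_iff by blast
  then show ?thesis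
    using that[of "max B 0"] rotation_hull_memI by (metis max.cobounded2 max.coboundedI1)
qed

lemma integrable_rotate:
  fixes \<phi> :: "real^'n::finite \<Rightarrow> complex"
  assumes T: "rotation_family \<mu> T" and a: "bounded_weight \<mu> a c" and \<phi>: "continuous_on \<Omega> \<phi>"
    and \<Omega>: "open \<Omega>" "rotation_invariant_set \<Omega>" "x \<in> \<Omega>"
  shows "integrable \<mu> (\<lambda>y. a y * \<phi> (T y *v x))"
proof -
  interpret finite_measure \<mu> using T by (simp add: rotation_family_def)
  have "compact {x}" "{x} \<subseteq> \<Omega>" using \<Omega>(3) by auto
  then obtain B where B: "B \<ge> 0" "\<And>U z. rotation_matrix U \<Longrightarrow> z \<in> {x} \<Longrightarrow> norm (\<phi> (U *v z)) \<le> B"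
    by (rule rotate_bounded[OF \<phi> \<Omega>(2)]) blast
  have "norm (a y * \<phi> (T y *v x)) \<le> c * B" if "y \<in> space \<mu>" for y
  proof -
    have "norm (a y) \<le> c" "norm (\<phi> (T y *v x)) \<le> B"
      using a T B that by (auto simp: bounded_weight_def rotation_family_def)
    then show ?thesis
      unfolding norm_mult by (intro mult_mono) (auto intro: order_trans[OF norm_ge_zero])
  qed
  then show ?thesis
    using a measurable_rotate[OF T \<phi> \<Omega>]
    by (intro integrable_const_bound[of _ "c * B"]) (auto simp: bounded_weight_def)
qed

lemma norm_rot_avg_le:
  fixes \<phi> :: "real^'n::finite \<Rightarrow> complex"
  assumes T: "rotation_family \<mu> T" and a: "bounded_weight \<mu> a c" and \<phi>: "continuous_on \<Omega> \<phi>"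
    and \<Omega>: "open \<Omega>" "rotation_invariant_set \<Omega>" "x \<in> \<Omega>" and c: "c \<ge> 0"
    and b: "\<And>U. rotation_matrix U \<Longrightarrow> norm (\<phi> (U *v x)) \<le> b"
  shows "norm (rot_avg \<mu> a T \<phi> x) \<le> c * measure \<mu> (space \<mu>) * b"
proof -
  interpret finite_measure \<mu> using T by (simp add: rotation_family_def)
  have "norm (rot_avg \<mu> a T \<phi> x) \<le> (LINT y|\<mu>. norm (a y * \<phi> (T y *v x)))"
    unfolding rot_avg_def by simp
  also have "\<dots> \<le> (LINT y|\<mu>. c * b)"
  proof (rule integral_mono)
    fix y assume "y \<in> space \<mu>"
    then have "norm (a y) \<le> c" "norm (\<phi> (T y *v x)) \<le> b"
      using a T b by (auto simp: bounded_weight_def rotation_family_def)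
    then show "norm (a y * \<phi> (T y *v x)) \<le> c * b"
      unfolding norm_mult using c by (intro mult_mono) auto
  qed (use integrable_rotate[OF T a \<phi> \<Omega>] in auto)
  finally show ?thesis by (simp add: mult_ac)
qed

lemma bounded_weight_mult_entry:
  fixes T :: "'y \<Rightarrow> real^'n^'n"
  assumes "rotation_family \<mu> T" "bounded_weight \<mu> a c" "c \<ge> 0"
  shows "bounded_weight \<mu> (\<lambda>y. a y * of_real (T y $ j $ i)) c"
proof -
  have "(\<lambda>A::real^'n^'n. A $ j $ i) \<in> borel_measurable borel"
    by (intro borel_measurable_continuous_onI continuous_intros continuous_on_component)
  then have "(\<lambda>y. T y $ j $ i) \<in> borel_measurable \<mu>"
    using assms by (auto simp: rotation_family_def)
  moreover have "norm (a y * of_real (T y $ j $ i)) \<le> c" if "y \<in> space \<mu>" for y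
  proof -
    have "norm (a y) * \<bar>T y $ j $ i\<bar> \<le> c * 1"
      using assms that by (intro mult_mono rotation_matrix_entry_le) (auto simp: bounded_weight_def rotation_family_def)
    then show ?thesis by (simp add: norm_mult)
  qed
  ultimately show ?thesis using assms by (auto simp: bounded_weight_def)
qed

text \<open>
  By the chain rule the partial derivative of \<open>\<phi> (U *v x)\<close> in direction \<open>i\<close> is the sum over \<open>j\<close> of
  \<open>U $ j $ i\<close> times the derivative of \<open>\<phi>\<close> in direction \<open>j\<close>.  The bounds needed to
  differentiate under the integral hold because the rotations of a small closed ball form a compact
  subset of \<open>\<Omega>\<close>.
\<close>

lemma rot_avg_has_derivative:
  fixes \<phi> :: "real^'n::finite \<Rightarrow> complex"
  assumes T: "rotation_family \<mu> T" and a: "bounded_weight \<mu> a c" and c: "c \<ge> 0"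
    and \<phi>: "smooth_on \<Omega> \<phi>" and \<Omega>: "open \<Omega>" "rotation_invariant_set \<Omega>" "x \<in> \<Omega>"
  shows "(rot_avg \<mu> a T \<phi> has_derivative (\<lambda>h. \<Sum>i\<in>UNIV. of_real (h $ i) *
     (\<Sum>j\<in>UNIV. rot_avg \<mu> (\<lambda>y. a y * of_real (T y $ j $ i)) T (pderiv_dir j \<phi>) x))) (at x)"
proof -
  have fin: "finite_measure \<mu>" using T by (simp add: rotation_family_def)
  let ?D = "\<lambda>w h. \<Sum>j\<in>UNIV. of_real (h $ j) * pderiv_dir j \<phi> w"
  have D: "(\<phi> has_derivative ?D w) (at w)" if "w \<in> \<Omega>" for w
    using smooth_on_differentiable[OF \<phi> that] by (rule has_derivative_pderiv_dir)
  have cd: "continuous_on \<Omega> (pderiv_dir j \<phi>)" for j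
    by (intro smooth_on_continuous_on smooth_on_pderiv_dir \<phi>)
  obtain e where e: "e > 0" "cball x e \<subseteq> \<Omega>" using \<Omega> open_contains_cball by blast
  have "\<exists>B. B \<ge> 0 \<and> (\<forall>U z. rotation_matrix U \<longrightarrow> z \<in> cball x e \<longrightarrow> norm (pderiv_dir j \<phi> (U *v z)) \<le> B)" for j
    by (rule rotate_bounded[OF cd[of j] \<Omega>(2) compact_cball e(2)]) blast
  then have "\<exists>B. \<forall>j. B j \<ge> 0 \<and> (\<forall>U z. rotation_matrix U \<longrightarrow> z \<in> cball x e \<longrightarrow> norm (pderiv_dir j \<phi> (U *v z)) \<le> B j)"
    by (intro choice allI)
  then obtain B where B: "\<And>j. B j \<ge> 0"
      "\<And>j U z. rotation_matrix U \<Longrightarrow> z \<in> cball x e \<Longrightarrow> norm (pderiv_dir j \<phi> (U *v z)) \<le> B j" by blast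
  define L where "L = (\<Sum>j\<in>UNIV. B j)"
  have L0: "L \<ge> 0" unfolding L_def using B(1) by (intro sum_nonneg) auto
  have DL: "norm (?D (U *v z) h) \<le> L * norm h" if "rotation_matrix U" "z \<in> cball x e" for U z h
  proof -
    have "norm (?D (U *v z) h) \<le> (\<Sum>j\<in>UNIV. norm h * B j)"
      by (intro sum_norm_le)
         (auto simp: norm_mult intro!: mult_mono B(2) that component_le_norm_cart)
    then show ?thesis by (simp add: L_def sum_distrib_left mult.commute)
  qed
  have lip: "norm (\<phi> (U *v z) - \<phi> (U *v x)) \<le> L * norm (z - x)" if "rotation_matrix U" "z \<in> ball x e" for U z
  proof -
    have "norm (\<phi> (U *v z) - \<phi> (U *v x)) \<le> L * norm (U *v z - U *v x)"
    proof (rule differentiable_bound[where S = "(\<lambda>z. U *v z) ` cball x e" and f' = ?D])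
      show "convex ((*v) U ` cball x e)"
        by (intro convex_linear_image matrix_vector_mul_linear convex_cball)
      fix w assume w: "w \<in> (*v) U ` cball x e"
      then show "(\<phi> has_derivative ?D w) (at w within (*v) U ` cball x e)"
        using D e(2) rotation_invariant_set_mem[OF \<Omega>(2) that(1)] has_derivative_at_withinI by blast
      show "onorm (?D w) \<le> L"
        using w DL[OF that(1)] L0 by (auto intro!: onorm_bound)
    qed (use that e in auto)
    then show ?thesis
      using rotation_matrix_norm[OF that(1), of "z - x"] by (simp add: matrix_vector_mult_diff_distrib)
  qed
  let ?F' = "\<lambda>y h. a y * ?D (T y *v x) (T y *v h)"
  have *: "((\<lambda>z. LINT y|\<mu>. a y * \<phi> (T y *v z)) has_derivative (\<lambda>h. LINT y|\<mu>. ?F' y h)) (at x)"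
  proof (rule has_derivative_integral[OF fin e(1), where L = "c * L"])
    show "(\<lambda>y. a y * \<phi> (T y *v z)) \<in> borel_measurable \<mu>" if "z \<in> ball x e" for z
    proof -
      have "z \<in> \<Omega>" using that e by auto
      then have "(\<lambda>y. \<phi> (T y *v z)) \<in> borel_measurable \<mu>"
        by (rule measurable_rotate[OF T smooth_on_continuous_on[OF \<phi>] \<Omega>(1,2)])
      then show ?thesis using a by (auto simp: bounded_weight_def)
    qed
    show "integrable \<mu> (\<lambda>y. a y * \<phi> (T y *v x))"
      by (rule integrable_rotate[OF T a smooth_on_continuous_on[OF \<phi>] \<Omega>])
    show "((\<lambda>z. a y * \<phi> (T y *v z)) has_derivative ?F' y) (at x)" if "y \<in> space \<mu>" for y
    proof -
      have "T y *v x \<in> \<Omega>" using T that \<Omega> by (auto simp: rotation_family_def intro: rotation_invariant_set_mem)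
      from has_derivative_compose[OF bounded_linear_imp_has_derivative[OF matrix_vector_mul_bounded_linear] D[OF this]]
      show ?thesis by (rule has_derivative_mult_right)
    qed
    show "norm (a y * \<phi> (T y *v z) - a y * \<phi> (T y *v x)) \<le> c * L * norm (z - x)"
      if "z \<in> ball x e" "y \<in> space \<mu>" for z y
    proof -
      have "norm (a y) * norm (\<phi> (T y *v z) - \<phi> (T y *v x)) \<le> c * (L * norm (z - x))"
        using a T that c by (intro mult_mono lip) (auto simp: bounded_weight_def rotation_family_def)
      then show ?thesis by (simp add: norm_mult mult.assoc flip: right_diff_distrib)
    qed
    show "(\<lambda>y. ?F' y h) \<in> borel_measurable \<mu>" for h
    proof -
      have "(\<lambda>A::real^'n^'n. (A *v h) $ j) \<in> borel_measurable borel" for j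
        by (intro borel_measurable_continuous_onI continuous_intros continuous_on_component)
      then have "(\<lambda>y. (T y *v h) $ j) \<in> borel_measurable \<mu>" for j
        using T by (auto simp: rotation_family_def)
      then show ?thesis
        using measurable_rotate[OF T cd \<Omega>] a by (auto simp: bounded_weight_def)
    qed
    show "norm (?F' y h) \<le> c * L * norm h" if "y \<in> space \<mu>" for y h
    proof -
      have "norm (a y) * norm (?D (T y *v x) (T y *v h)) \<le> c * (L * norm (T y *v h))"
        using a T that c e by (intro mult_mono DL) (auto simp: bounded_weight_def rotation_family_def)
      then show ?thesis using T that rotation_matrix_norm[of "T y" h]
        by (simp add: norm_mult mult.assoc rotation_family_def)
    qed
  qed
  have eq: "(LINT y|\<mu>. ?F' y h) = (\<Sum>i\<in>UNIV. of_real (h $ i) *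
     (\<Sum>j\<in>UNIV. rot_avg \<mu> (\<lambda>y. a y * of_real (T y $ j $ i)) T (pderiv_dir j \<phi>) x))" for h
  proof -
    have "?F' y h = (\<Sum>i\<in>UNIV. \<Sum>j\<in>UNIV. of_real (h $ i) * (a y * of_real (T y $ j $ i) * pderiv_dir j \<phi> (T y *v x)))" for y
      unfolding matrix_vector_mult_def
      by (subst sum.swap) (simp add: sum_distrib_left sum_distrib_right mult_ac)
    moreover have "integrable \<mu> (\<lambda>y. a y * of_real (T y $ j $ i) * pderiv_dir j \<phi> (T y *v x))" for i j
      by (rule integrable_rotate[OF T bounded_weight_mult_entry[OF T a c] cd \<Omega>])
    ultimately show ?thesis unfolding rot_avg_def by (simp add: sum_distrib_left)
  qed
  show ?thesis using * unfolding eq rot_avg_def[abs_def] by simp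
qed

primrec entry_prod :: "real^'n^'n \<Rightarrow> 'n list \<Rightarrow> 'n list \<Rightarrow> real" where
  "entry_prod U [] js = 1"
| "entry_prod U (i # is) js = U $ hd js $ i * entry_prod U is (tl js)"

lemma sum_lists_Suc:
  "(\<Sum>js\<in>{js :: 'n::finite list. length js = Suc n}. f js) = (\<Sum>js\<in>{js. length js = n}. \<Sum>j\<in>UNIV. f (j # js))"
proof -
  have fin: "finite {js :: 'n list. length js = n}" using finite_lists_length_eq[of "UNIV :: 'n set" n] by simp
  have "(\<Sum>js\<in>{js. length js = n}. \<Sum>j\<in>UNIV. f (j # js)) = (\<Sum>(js, j)\<in>{js. length js = n} \<times> UNIV. f (j # js))"
    by (simp add: sum.cartesian_product)
  also have "\<dots> = (\<Sum>js\<in>{js :: 'n list. length js = Suc n}. f js)"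
    by (rule sum.reindex_bij_witness[of _ "\<lambda>js. (tl js, hd js)" "\<lambda>(js, j). j # js"])
       (auto simp: length_Suc_conv)
  finally show ?thesis by simp
qed

lemma bounded_weight_entry_prod:
  assumes "rotation_family \<mu> T" "bounded_weight \<mu> a c" "c \<ge> 0"
  shows "bounded_weight \<mu> (\<lambda>y. a y * of_real (entry_prod (T y) is js)) c"
proof (induction "is" arbitrary: js)
  case (Cons i "is")
  from bounded_weight_mult_entry[OF assms(1) Cons assms(3), of "tl js" "hd js" i]
  show ?case by (simp add: mult_ac)
qed (use assms in simp)

lemma
  fixes \<phi> :: "real^'n::finite \<Rightarrow> complex"
  assumes T: "rotation_family \<mu> T" and a: "bounded_weight \<mu> a c" and c: "c \<ge> 0"
    and \<phi>: "smooth_on \<Omega> \<phi>" and \<Omega>: "open \<Omega>" "rotation_invariant_set \<Omega>"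
  shows smooth_on_rot_avg: "smooth_on \<Omega> (rot_avg \<mu> a T \<phi>)"
    and pderivs_rot_avg: "x \<in> \<Omega> \<Longrightarrow> pderivs is (rot_avg \<mu> a T \<phi>) x = (\<Sum>js\<in>{js. length js = length is}.
       rot_avg \<mu> (\<lambda>y. a y * of_real (entry_prod (T y) is js)) T (pderivs js \<phi>) x)"
proof -
  let ?a = "\<lambda>is js y. a y * of_real (entry_prod (T y) is js)"
  let ?d = "\<lambda>is x. \<Sum>js\<in>{js. length js = length is}. rot_avg \<mu> (?a is js) T (pderivs js \<phi>) x"
  let ?D = "\<lambda>is x h. \<Sum>js\<in>{js. length js = length is}. (\<Sum>i\<in>UNIV. of_real (h $ i) *
     (\<Sum>j\<in>UNIV. rot_avg \<mu> (\<lambda>y. ?a is js y * of_real (T y $ j $ i)) T (pderiv_dir j (pderivs js \<phi>)) x))"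
  have D: "(?d is has_derivative ?D is x) (at x)" if "x \<in> \<Omega>" for "is" x
    by (intro has_derivative_sum rot_avg_has_derivative[OF T bounded_weight_entry_prod[OF T a c] c
         smooth_on_pderivs[OF \<phi>] \<Omega> that])
  have E: "pderiv_dir i (?d is) x = ?d (i # is) x" if "x \<in> \<Omega>" for i "is" x
  proof -
    have ax: "(\<Sum>k\<in>UNIV. of_real (axis i 1 $ k) * c k) = (c i :: complex)" for c :: "'n \<Rightarrow> complex"
      by (simp add: axis_def if_distrib if_distribR cong: if_cong)
    have "?d (i # is) x = (\<Sum>js\<in>{js. length js = length is}. \<Sum>j\<in>UNIV.
          rot_avg \<mu> (?a (i # is) (j # js)) T (pderivs (j # js) \<phi>) x)"
      by (simp only: list.size add_Suc_right add_0_right sum_lists_Suc)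
    also have "\<dots> = pderiv_dir i (?d is) x"
      unfolding pderiv_dir_eqI[OF D[OF that]] ax by (simp add: mult_ac)
    finally show ?thesis by simp
  qed
  have d0: "rot_avg \<mu> a T \<phi> x = ?d [] x" for x by simp
  show "smooth_on \<Omega> (rot_avg \<mu> a T \<phi>)"
    using D E d0 by (intro pderivs_eqI(1)[OF \<Omega>(1), where d = ?d]) (auto simp: differentiable_def)
  show "x \<in> \<Omega> \<Longrightarrow> pderivs is (rot_avg \<mu> a T \<phi>) x = ?d is x"
    using D E d0 by (intro pderivs_eqI(2)[OF \<Omega>(1), where d = ?d]) (auto simp: differentiable_def)
qed

text \<open>
  The sum that expresses the derivative has \<open>CARD('n) ^ length is\<close> terms, and the entries of rotations
  do not exceed \<open>1\<close>.  Growth that is exponential in the order is harmless: it changes the scale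
  \<open>h\<close> by a constant factor.
\<close>

lemma norm_pderivs_rot_avg_le:
  fixes \<phi> :: "real^'n::finite \<Rightarrow> complex"
  assumes T: "rotation_family \<mu> T" and a: "bounded_weight \<mu> a c" and c: "c \<ge> 0"
    and \<phi>: "smooth_on \<Omega> \<phi>" and \<Omega>: "open \<Omega>" "rotation_invariant_set \<Omega>" "x \<in> \<Omega>"
    and b: "\<And>js U. length js = length is \<Longrightarrow> rotation_matrix U \<Longrightarrow> norm (pderivs js \<phi> (U *v x)) \<le> b"
  shows "norm (pderivs is (rot_avg \<mu> a T \<phi>) x) \<le> c * measure \<mu> (space \<mu>) * real CARD('n) ^ length is * b"
proof -
  have "norm (pderivs is (rot_avg \<mu> a T \<phi>) x) \<le> (\<Sum>js\<in>{js :: 'n list. length js = length is}. c * measure \<mu> (space \<mu>) * b)"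
    unfolding pderivs_rot_avg[OF T a c \<phi> \<Omega>]
    by (intro sum_norm_le norm_rot_avg_le[OF T bounded_weight_entry_prod[OF T a c] 
          smooth_on_continuous_on[OF smooth_on_pderivs[OF \<phi>]] \<Omega> c] b) auto
  also have "card {js :: 'n list. length js = length is} = CARD('n) ^ length is"
    using card_lists_length_eq[of "UNIV :: 'n set" "length is"] by simp
  then have "(\<Sum>js\<in>{js :: 'n list. length js = length is}. c * measure \<mu> (space \<mu>) * b)
      = c * measure \<mu> (space \<mu>) * real CARD('n) ^ length is * b" by simp
  finally show ?thesis .
qed

section \<open>Operators that are tame for the derivative estimates\<close>

definition ud_bound :: "(nat \<Rightarrow> real) \<Rightarrow> real \<Rightarrow> (real^'n::finite) set \<Rightarrow> real \<Rightarrow> (real^'n \<Rightarrow> complex) \<Rightarrow> bool" where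
  "ud_bound M h K B \<phi> \<longleftrightarrow> 0 \<le> B \<and> (\<forall>is. \<forall>x\<in>K. norm (pderivs is \<phi> x) \<le> B * (h ^ length is * M (length is)))"

text \<open>
  The operators are defined on all functions on the whole space, so a last clause says that on \<open>\<Omega>\<close> the
  result depends on the restriction to \<open>\<Omega>\<close> only.  For operators that average over orbits this holds if
  \<open>\<Omega>\<close> is rotation invariant.
\<close>

definition linear_local :: "(real^'n::finite) set \<Rightarrow> ((real^'n \<Rightarrow> complex) \<Rightarrow> real^'n \<Rightarrow> complex) \<Rightarrow> bool" where
  "linear_local \<Omega> A \<longleftrightarrow>
     (\<forall>\<phi>. smooth_on \<Omega> \<phi> \<longrightarrow> smooth_on \<Omega> (A \<phi>)) \<and>
     (\<forall>\<phi> \<psi>. smooth_on \<Omega> \<phi> \<longrightarrow> smooth_on \<Omega> \<psi> \<longrightarrow> (\<forall>x\<in>\<Omega>. A (\<lambda>x. \<phi> x + \<psi> x) x = A \<phi> x + A \<psi> x)) \<and>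
     (\<forall>c \<phi>. smooth_on \<Omega> \<phi> \<longrightarrow> (\<forall>x\<in>\<Omega>. A (\<lambda>x. c * \<phi> x) x = c * A \<phi> x)) \<and>
     (\<forall>\<phi> \<psi>. (\<forall>x\<in>\<Omega>. \<phi> x = \<psi> x) \<longrightarrow> (\<forall>x\<in>\<Omega>. A \<phi> x = A \<psi> x))"

abbreviation op_bounded :: "(nat \<Rightarrow> real) \<Rightarrow> ((real^'n::finite \<Rightarrow> complex) \<Rightarrow> real^'n \<Rightarrow> complex)
    \<Rightarrow> real \<Rightarrow> real \<Rightarrow> (real^'n) set \<Rightarrow> bool" where
  "op_bounded M A h h' K \<equiv> \<exists>C\<ge>0. \<forall>\<Omega> \<phi> B. open \<Omega> \<longrightarrow> rotation_invariant_set \<Omega> \<longrightarrow> K \<subseteq> \<Omega> \<longrightarrow>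
     smooth_on \<Omega> \<phi> \<longrightarrow> ud_bound M h K B \<phi> \<longrightarrow> ud_bound M h' K (C * B) (A \<phi>)"

text \<open>
  The loss of a constant factor in \<open>h\<close> is stable under composition, and admissible both for the
  Roumieu spaces, where \<open>h\<close> may be enlarged, and for the Beurling spaces, where every small \<open>h\<close>
  is available.  The constant \<open>C\<close> may depend on \<open>K\<close> and \<open>h\<close>, but not on \<open>\<Omega>\<close>.
\<close>

definition tame_op :: "(nat \<Rightarrow> real) \<Rightarrow> ((real^'n::finite \<Rightarrow> complex) \<Rightarrow> real^'n \<Rightarrow> complex) \<Rightarrow> bool" where
  "tame_op M A \<longleftrightarrow>
     (\<forall>\<Omega>. open \<Omega> \<longrightarrow> rotation_invariant_set \<Omega> \<longrightarrow> linear_local \<Omega> A) \<and>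
     (\<exists>\<beta>>0. \<forall>K h. compact K \<longrightarrow> rotation_invariant_set K \<longrightarrow> h > 0 \<longrightarrow> op_bounded M A h (\<beta> * h) K)"

lemma tame_op_linear_local: "tame_op M A \<Longrightarrow> open \<Omega> \<Longrightarrow> rotation_invariant_set \<Omega> \<Longrightarrow> linear_local \<Omega> A"
  unfolding tame_op_def by blast

lemma linear_localI:
  assumes "\<And>\<phi>. smooth_on \<Omega> \<phi> \<Longrightarrow> smooth_on \<Omega> (A \<phi>)"
    and "\<And>\<phi> \<psi> x. smooth_on \<Omega> \<phi> \<Longrightarrow> smooth_on \<Omega> \<psi> \<Longrightarrow> x \<in> \<Omega> \<Longrightarrow> A (\<lambda>x. \<phi> x + \<psi> x) x = A \<phi> x + A \<psi> x"
    and "\<And>c \<phi> x. smooth_on \<Omega> \<phi> \<Longrightarrow> x \<in> \<Omega> \<Longrightarrow> A (\<lambda>x. c * \<phi> x) x = c * A \<phi> x"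
    and "\<And>\<phi> \<psi> x. (\<And>x. x \<in> \<Omega> \<Longrightarrow> \<phi> x = \<psi> x) \<Longrightarrow> x \<in> \<Omega> \<Longrightarrow> A \<phi> x = A \<psi> x"
  shows "linear_local \<Omega> A"
  unfolding linear_local_def by (intro conjI allI impI ballI) (rule assms; blast)+

lemma linear_localD:
  assumes "linear_local \<Omega> A"
  shows "smooth_on \<Omega> \<phi> \<Longrightarrow> smooth_on \<Omega> (A \<phi>)"
    and "smooth_on \<Omega> \<phi> \<Longrightarrow> smooth_on \<Omega> \<psi> \<Longrightarrow> x \<in> \<Omega> \<Longrightarrow> A (\<lambda>x. \<phi> x + \<psi> x) x = A \<phi> x + A \<psi> x"
    and "smooth_on \<Omega> \<phi> \<Longrightarrow> x \<in> \<Omega> \<Longrightarrow> A (\<lambda>x. c * \<phi> x) x = c * A \<phi> x"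
    and "(\<And>x. x \<in> \<Omega> \<Longrightarrow> \<phi> x = \<psi> x) \<Longrightarrow> x \<in> \<Omega> \<Longrightarrow> A \<phi> x = A \<psi> x"
  using assms unfolding linear_local_def by blast+

lemma rotation_invariant_UNIV: "rotation_invariant_set UNIV"
  by (rule rotation_invariant_setI) auto

lemma tame_op_smooth: "tame_op M A \<Longrightarrow> smooth_on UNIV \<phi> \<Longrightarrow> smooth_on UNIV (A \<phi>)"
  using tame_op_linear_local[OF _ open_UNIV rotation_invariant_UNIV] unfolding linear_local_def by blast

lemma ud_bound_mono:
  assumes "ud_bound M h K B \<phi>" "0 \<le> h" "h \<le> h'" "B \<le> B'" "\<And>p. M p > 0"
  shows "ud_bound M h' K B' \<phi>"
  unfolding ud_bound_def
proof (intro conjI allI ballI)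
  show "0 \<le> B'" using assms unfolding ud_bound_def by linarith
  fix "is" x assume "x \<in> K"
  then have "norm (pderivs is \<phi> x) \<le> B * (h ^ length is * M (length is))"
    using assms unfolding ud_bound_def by blast
  also have "\<dots> \<le> B' * (h' ^ length is * M (length is))"
    using assms by (intro mult_mono power_mono) (auto simp: ud_bound_def less_imp_le)
  finally show "norm (pderivs is \<phi> x) \<le> B' * (h' ^ length is * M (length is))" .
qed

lemma tame_op_rot_avg:
  fixes T :: "'y \<Rightarrow> real^'n^'n"
  assumes T: "rotation_family \<mu> T" and a: "bounded_weight \<mu> a c" and c: "c \<ge> 0" and M: "\<And>p. M p > 0"
  shows "tame_op M (rot_avg \<mu> a T)"
  unfolding tame_op_def
proof (intro conjI allI impI)
  fix \<Omega> :: "(real^'n) set" assume \<Omega>: "open \<Omega>" "rotation_invariant_set \<Omega>"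
  show "linear_local \<Omega> (rot_avg \<mu> a T)"
    unfolding linear_local_def
  proof (intro conjI allI impI ballI)
    fix \<phi> :: "real^'n \<Rightarrow> complex" assume "smooth_on \<Omega> \<phi>"
    then show "smooth_on \<Omega> (rot_avg \<mu> a T \<phi>)" by (rule smooth_on_rot_avg[OF T a c _ \<Omega>])
  next
    fix \<phi> \<psi> :: "real^'n \<Rightarrow> complex" and x assume "smooth_on \<Omega> \<phi>" "smooth_on \<Omega> \<psi>" "x \<in> \<Omega>"
    then show "rot_avg \<mu> a T (\<lambda>x. \<phi> x + \<psi> x) x = rot_avg \<mu> a T \<phi> x + rot_avg \<mu> a T \<psi> x"
      unfolding rot_avg_def distrib_left
      by (intro Bochner_Integration.integral_add integrable_rotate[OF T a _ \<Omega>] smooth_on_continuous_on)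
  next
    fix k :: complex and \<phi> :: "real^'n \<Rightarrow> complex" and x :: "real^'n"
    show "rot_avg \<mu> a T (\<lambda>x. k * \<phi> x) x = k * rot_avg \<mu> a T \<phi> x"
      unfolding rot_avg_def by (subst integral_mult_right_zero[symmetric]) (simp add: mult.left_commute)
  next
    fix \<phi> \<psi> :: "real^'n \<Rightarrow> complex" and x assume "\<forall>x\<in>\<Omega>. \<phi> x = \<psi> x" "x \<in> \<Omega>"
    then show "rot_avg \<mu> a T \<phi> x = rot_avg \<mu> a T \<psi> x"
      unfolding rot_avg_def using T rotation_invariant_set_mem[OF \<Omega>(2)]
      by (intro Bochner_Integration.integral_cong) (auto simp: rotation_family_def)
  qed
next
  let ?n = "real CARD('n)"
  show "\<exists>\<beta>>0. \<forall>K h. compact K \<longrightarrow> rotation_invariant_set K \<longrightarrow> h > 0 \<longrightarrow> op_bounded M (rot_avg \<mu> a T) h (\<beta> * h) K"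
  proof (rule exI[of _ ?n], intro conjI allI impI)
    fix K :: "(real^'n) set" and h :: real assume K: "compact K" "rotation_invariant_set K" and h: "h > 0"
    show "op_bounded M (rot_avg \<mu> a T) h (?n * h) K"
    proof (rule exI[of _ "c * measure \<mu> (space \<mu>)"], intro conjI allI impI)
      fix \<Omega> :: "(real^'n) set" and \<phi> B
      assume \<Omega>: "open \<Omega>" "rotation_invariant_set \<Omega>" and K\<Omega>: "K \<subseteq> \<Omega>" and \<phi>: "smooth_on \<Omega> \<phi>"
        and B: "ud_bound M h K B \<phi>"
      show "ud_bound M (?n * h) K (c * measure \<mu> (space \<mu>) * B) (rot_avg \<mu> a T \<phi>)"
        unfolding ud_bound_def
      proof (intro conjI allI ballI)
        fix "is" x assume x: "x \<in> K"
        have "norm (pderivs is (rot_avg \<mu> a T \<phi>) x) \<le>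
           c * measure \<mu> (space \<mu>) * ?n ^ length is * (B * (h ^ length is * M (length is)))"
        proof (rule norm_pderivs_rot_avg_le[OF T a c \<phi> \<Omega>])
          fix js :: "'n list" and U :: "real^'n^'n" assume js: "length js = length is" and "rotation_matrix U"
          then have "U *v x \<in> K" using rotation_invariant_set_mem[OF K(2)] x by blast
          then show "norm (pderivs js \<phi> (U *v x)) \<le> B * (h ^ length is * M (length is))"
            using B unfolding ud_bound_def js[symmetric] by blast
        qed (use x K\<Omega> in auto)
        then show "norm (pderivs is (rot_avg \<mu> a T \<phi>) x) \<le>
            c * measure \<mu> (space \<mu>) * B * ((?n * h) ^ length is * M (length is))"
          by (simp add: power_mult_distrib mult_ac)
      qed (use c B in \<open>auto simp: ud_bound_def\<close>)
    qed (use c in auto)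
  qed auto
qed

lemma tame_op_compose:
  fixes A B :: "(real^'n::finite \<Rightarrow> complex) \<Rightarrow> real^'n \<Rightarrow> complex"
  assumes A: "tame_op M A" and B: "tame_op M B"
  shows "tame_op M (\<lambda>\<phi>. A (B \<phi>))"
  unfolding tame_op_def
proof (intro conjI allI impI)
  fix \<Omega> :: "(real^'n) set" assume \<Omega>: "open \<Omega>" "rotation_invariant_set \<Omega>"
  have LA: "linear_local \<Omega> A" and LB: "linear_local \<Omega> B"
    using A B \<Omega> tame_op_linear_local by blast+
  show "linear_local \<Omega> (\<lambda>\<phi>. A (B \<phi>))"
  proof (rule linear_localI)
    fix \<phi> \<psi> :: "real^'n \<Rightarrow> complex" and x assume s: "smooth_on \<Omega> \<phi>" "smooth_on \<Omega> \<psi>" and x: "x \<in> \<Omega>"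
    have "A (B (\<lambda>x. \<phi> x + \<psi> x)) x = A (\<lambda>x. B \<phi> x + B \<psi> x) x"
      by (rule linear_localD(4)[OF LA _ x]) (rule linear_localD(2)[OF LB s])
    also have "\<dots> = A (B \<phi>) x + A (B \<psi>) x"
      by (rule linear_localD(2)[OF LA _ _ x]) (intro linear_localD(1)[OF LB] s)+
    finally show "A (B (\<lambda>x. \<phi> x + \<psi> x)) x = A (B \<phi>) x + A (B \<psi>) x" .
  next
    fix c :: complex and \<phi> :: "real^'n \<Rightarrow> complex" and x assume s: "smooth_on \<Omega> \<phi>" and x: "x \<in> \<Omega>"
    have "A (B (\<lambda>x. c * \<phi> x)) x = A (\<lambda>x. c * B \<phi> x) x"
      by (rule linear_localD(4)[OF LA _ x]) (rule linear_localD(3)[OF LB s])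
    also have "\<dots> = c * A (B \<phi>) x"
      by (rule linear_localD(3)[OF LA _ x]) (rule linear_localD(1)[OF LB s])
    finally show "A (B (\<lambda>x. c * \<phi> x)) x = c * A (B \<phi>) x" .
  next
    fix \<phi> \<psi> :: "real^'n \<Rightarrow> complex" and x assume "\<And>x. x \<in> \<Omega> \<Longrightarrow> \<phi> x = \<psi> x" "x \<in> \<Omega>"
    then show "A (B \<phi>) x = A (B \<psi>) x"
      by (intro linear_localD(4)[OF LA] linear_localD(4)[OF LB])
  qed (intro linear_localD(1)[OF LA] linear_localD(1)[OF LB])
next
  from A obtain \<alpha> where \<alpha>: "\<alpha> > 0" "\<And>K h. compact K \<Longrightarrow> rotation_invariant_set K \<Longrightarrow> h > 0 \<Longrightarrow> op_bounded M A h (\<alpha> * h) K"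
    unfolding tame_op_def by blast
  from B obtain \<beta> where \<beta>: "\<beta> > 0" "\<And>K h. compact K \<Longrightarrow> rotation_invariant_set K \<Longrightarrow> h > 0 \<Longrightarrow> op_bounded M B h (\<beta> * h) K"
    unfolding tame_op_def by blast
  show "\<exists>\<gamma>>0. \<forall>K h. compact K \<longrightarrow> rotation_invariant_set K \<longrightarrow> h > 0 \<longrightarrow> op_bounded M (\<lambda>\<phi>. A (B \<phi>)) h (\<gamma> * h) K"
  proof (rule exI[of _ "\<alpha> * \<beta>"], intro conjI allI impI)
    fix K :: "(real^'n) set" and h :: real assume K: "compact K" "rotation_invariant_set K" and h: "h > 0"
    obtain C where C: "C \<ge> 0" "\<And>\<Omega> \<phi> Ba. open \<Omega> \<Longrightarrow> rotation_invariant_set \<Omega> \<Longrightarrow> K \<subseteq> \<Omega> \<Longrightarrow> smooth_on \<Omega> \<phi> \<Longrightarrow>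
        ud_bound M h K Ba \<phi> \<Longrightarrow> ud_bound M (\<beta> * h) K (C * Ba) (B \<phi>)" using \<beta>(2)[OF K h] by blast
    have "\<beta> * h > 0" using \<beta>(1) h by simp
    then obtain D where D: "D \<ge> 0" "\<And>\<Omega> \<phi> Ba. open \<Omega> \<Longrightarrow> rotation_invariant_set \<Omega> \<Longrightarrow> K \<subseteq> \<Omega> \<Longrightarrow> smooth_on \<Omega> \<phi> \<Longrightarrow>
        ud_bound M (\<beta> * h) K Ba \<phi> \<Longrightarrow> ud_bound M (\<alpha> * (\<beta> * h)) K (D * Ba) (A \<phi>)" using \<alpha>(2)[OF K] by blast
    show "op_bounded M (\<lambda>\<phi>. A (B \<phi>)) h (\<alpha> * \<beta> * h) K"
    proof (rule exI[of _ "D * C"], intro conjI allI impI)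
      fix \<Omega> :: "(real^'n) set" and \<phi> Ba
      assume \<Omega>: "open \<Omega>" "rotation_invariant_set \<Omega>" "K \<subseteq> \<Omega>" and s: "smooth_on \<Omega> \<phi>" and b: "ud_bound M h K Ba \<phi>"
      have "smooth_on \<Omega> (B \<phi>)" using tame_op_linear_local[OF B \<Omega>(1,2)] s unfolding linear_local_def by blast
      from D(2)[OF \<Omega> this C(2)[OF \<Omega> s b]]
      show "ud_bound M (\<alpha> * \<beta> * h) K (D * C * Ba) (A (B \<phi>))" by (simp add: mult.assoc)
    qed (use C(1) D(1) in auto)
  qed (use \<alpha>(1) \<beta>(1) in auto)
qed

lemma tame_op_diff:
  fixes A B :: "(real^'n::finite \<Rightarrow> complex) \<Rightarrow> real^'n \<Rightarrow> complex"
  assumes A: "tame_op M A" and B: "tame_op M B" and M: "\<And>p. M p > 0"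
  shows "tame_op M (\<lambda>\<phi> x. A \<phi> x - B \<phi> x)"
  unfolding tame_op_def
proof (intro conjI allI impI)
  fix \<Omega> :: "(real^'n) set" assume \<Omega>: "open \<Omega>" "rotation_invariant_set \<Omega>"
  have LA: "linear_local \<Omega> A" and LB: "linear_local \<Omega> B"
    using A B \<Omega> tame_op_linear_local by blast+
  show "linear_local \<Omega> (\<lambda>\<phi> x. A \<phi> x - B \<phi> x)"
  proof (rule linear_localI)
    show "A \<phi> x - B \<phi> x = A \<psi> x - B \<psi> x" if "\<And>x. x \<in> \<Omega> \<Longrightarrow> \<phi> x = \<psi> x" "x \<in> \<Omega>" for \<phi> \<psi> :: "real^'n \<Rightarrow> complex" and x
      using linear_localD(4)[OF LA that] linear_localD(4)[OF LB that] by simp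
  qed (auto intro!: smooth_on_diff[OF \<Omega>(1)] linear_localD(1)[OF LA] linear_localD(1)[OF LB]
        simp: linear_localD(2,3)[OF LA] linear_localD(2,3)[OF LB] algebra_simps)
next
  from A obtain \<alpha> where \<alpha>: "\<alpha> > 0" "\<And>K h. compact K \<Longrightarrow> rotation_invariant_set K \<Longrightarrow> h > 0 \<Longrightarrow> op_bounded M A h (\<alpha> * h) K"
    unfolding tame_op_def by blast
  from B obtain \<beta> where \<beta>: "\<beta> > 0" "\<And>K h. compact K \<Longrightarrow> rotation_invariant_set K \<Longrightarrow> h > 0 \<Longrightarrow> op_bounded M B h (\<beta> * h) K"
    unfolding tame_op_def by blast
  define \<gamma> where "\<gamma> = max \<alpha> \<beta>"
  show "\<exists>\<gamma>>0. \<forall>K h. compact K \<longrightarrow> rotation_invariant_set K \<longrightarrow> h > 0 \<longrightarrow> op_bounded M (\<lambda>\<phi> x. A \<phi> x - B \<phi> x) h (\<gamma> * h) K"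
  proof (rule exI[of _ \<gamma>], intro conjI allI impI)
    fix K :: "(real^'n) set" and h :: real assume K: "compact K" "rotation_invariant_set K" and h: "h > 0"
    obtain C where C: "C \<ge> 0" "\<And>\<Omega> \<phi> Ba. open \<Omega> \<Longrightarrow> rotation_invariant_set \<Omega> \<Longrightarrow> K \<subseteq> \<Omega> \<Longrightarrow> smooth_on \<Omega> \<phi> \<Longrightarrow>
        ud_bound M h K Ba \<phi> \<Longrightarrow> ud_bound M (\<beta> * h) K (C * Ba) (B \<phi>)" using \<beta>(2)[OF K h] by blast
    obtain D where D: "D \<ge> 0" "\<And>\<Omega> \<phi> Ba. open \<Omega> \<Longrightarrow> rotation_invariant_set \<Omega> \<Longrightarrow> K \<subseteq> \<Omega> \<Longrightarrow> smooth_on \<Omega> \<phi> \<Longrightarrow>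
        ud_bound M h K Ba \<phi> \<Longrightarrow> ud_bound M (\<alpha> * h) K (D * Ba) (A \<phi>)" using \<alpha>(2)[OF K h] by blast
    show "op_bounded M (\<lambda>\<phi> x. A \<phi> x - B \<phi> x) h (\<gamma> * h) K"
    proof (rule exI[of _ "D + C"], intro conjI allI impI)
      fix \<Omega> :: "(real^'n) set" and \<phi> Ba
      assume \<Omega>: "open \<Omega>" "rotation_invariant_set \<Omega>" "K \<subseteq> \<Omega>" and s: "smooth_on \<Omega> \<phi>" and b: "ud_bound M h K Ba \<phi>"
      have sA: "smooth_on \<Omega> (A \<phi>)" using tame_op_linear_local[OF A \<Omega>(1,2)] s unfolding linear_local_def by blast
      have sB: "smooth_on \<Omega> (B \<phi>)" using tame_op_linear_local[OF B \<Omega>(1,2)] s unfolding linear_local_def by blast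
      have bA: "ud_bound M (\<gamma> * h) K (D * Ba) (A \<phi>)"
        by (rule ud_bound_mono[OF D(2)[OF \<Omega> s b]]) (use \<alpha>(1) \<beta>(1) h M in \<open>auto simp: \<gamma>_def\<close>)
      have bB: "ud_bound M (\<gamma> * h) K (C * Ba) (B \<phi>)"
        by (rule ud_bound_mono[OF C(2)[OF \<Omega> s b]]) (use \<alpha>(1) \<beta>(1) h M in \<open>auto simp: \<gamma>_def\<close>)
      show "ud_bound M (\<gamma> * h) K ((D + C) * Ba) (\<lambda>x. A \<phi> x - B \<phi> x)"
        unfolding ud_bound_def
      proof (intro conjI allI ballI)
        fix "is" x assume x: "x \<in> K"
        have "norm (pderivs is (\<lambda>x. A \<phi> x - B \<phi> x) x) \<le> norm (pderivs is (A \<phi>) x) + norm (pderivs is (B \<phi>) x)"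
          using x \<Omega>(3) by (subst pderivs_diff[OF \<Omega>(1) sA sB]) (auto intro: norm_triangle_ineq4)
        also have "\<dots> \<le> D * Ba * ((\<gamma> * h) ^ length is * M (length is)) + C * Ba * ((\<gamma> * h) ^ length is * M (length is))"
          using bA bB x unfolding ud_bound_def by (intro add_mono) auto
        finally show "norm (pderivs is (\<lambda>x. A \<phi> x - B \<phi> x) x) \<le> (D + C) * Ba * ((\<gamma> * h) ^ length is * M (length is))"
          by (simp add: algebra_simps)
      qed (use C(1) D(1) b in \<open>auto simp: ud_bound_def\<close>)
    qed (use C(1) D(1) in auto)
  qed (use \<alpha>(1) \<beta>(1) in \<open>auto simp: \<gamma>_def\<close>)
qed

text \<open>
  Differentiation shifts the index of \<open>M\<close> by one, which \<open>cond_M2'\<close> permits; the power \<open>H ^ p\<close>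
  there goes into the scale.
\<close>

lemma tame_op_pderiv_dir:
  assumes M: "\<And>p. M p > 0" and M2: "cond_M2' M"
  shows "tame_op M (pderiv_dir (j :: 'n::finite))"
  unfolding tame_op_def
proof (intro conjI allI impI)
  fix \<Omega> :: "(real^'n) set" assume \<Omega>: "open \<Omega>" "rotation_invariant_set \<Omega>"
  show "linear_local \<Omega> (pderiv_dir j)"
  proof (rule linear_localI)
    fix \<phi> \<psi> :: "real^'n \<Rightarrow> complex" and x c
    show "smooth_on \<Omega> \<phi> \<Longrightarrow> smooth_on \<Omega> (pderiv_dir j \<phi>)" by (rule smooth_on_pderiv_dir)
    show "smooth_on \<Omega> \<phi> \<Longrightarrow> smooth_on \<Omega> \<psi> \<Longrightarrow> x \<in> \<Omega> \<Longrightarrow>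
        pderiv_dir j (\<lambda>x. \<phi> x + \<psi> x) x = pderiv_dir j \<phi> x + pderiv_dir j \<psi> x"
      using pderivs_add[OF \<Omega>(1), of \<phi> \<psi> x "[j]"] by simp
    show "smooth_on \<Omega> \<phi> \<Longrightarrow> x \<in> \<Omega> \<Longrightarrow> pderiv_dir j (\<lambda>x. c * \<phi> x) x = c * pderiv_dir j \<phi> x"
      using pderivs_cmult[OF \<Omega>(1), of \<phi> x "[j]"] by simp
    show "(\<And>x. x \<in> \<Omega> \<Longrightarrow> \<phi> x = \<psi> x) \<Longrightarrow> x \<in> \<Omega> \<Longrightarrow> pderiv_dir j \<phi> x = pderiv_dir j \<psi> x"
      using pderivs_cong[OF \<Omega>(1), of \<phi> \<psi> x "[j]"] by simp
  qed
next
  obtain A H where AH: "A > 0" "H > 0" "\<And>p. M (p + 1) \<le> A * H ^ p * M p"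
    using M2 unfolding cond_M2'_def by blast
  show "\<exists>\<gamma>>0. \<forall>K h. compact K \<longrightarrow> rotation_invariant_set K \<longrightarrow> h > 0 \<longrightarrow> op_bounded M (pderiv_dir j) h (\<gamma> * h) K"
  proof (rule exI[of _ H], intro conjI allI impI)
    fix K :: "(real^'n) set" and h :: real assume h: "h > 0"
    show "op_bounded M (pderiv_dir j) h (H * h) K"
    proof (rule exI[of _ "h * A"], intro conjI allI impI)
      fix \<Omega> :: "(real^'n) set" and \<phi> B assume B: "ud_bound M h K B \<phi>"
      show "ud_bound M (H * h) K (h * A * B) (pderiv_dir j \<phi>)"
        unfolding ud_bound_def
      proof (intro conjI allI ballI)
        fix "is" :: "'n list" and x assume x: "x \<in> K"
        let ?p = "length is"
        have "norm (pderivs (is @ [j]) \<phi> x) \<le> B * (h ^ (?p + 1) * M (?p + 1))"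
          using B x unfolding ud_bound_def by (metis length_append_singleton Suc_eq_plus1)
        also have "\<dots> \<le> B * (h ^ (?p + 1) * (A * H ^ ?p * M ?p))"
          using AH(3)[of ?p] B h by (intro mult_left_mono) (auto simp: ud_bound_def)
        finally show "norm (pderivs is (pderiv_dir j \<phi>) x) \<le> h * A * B * ((H * h) ^ ?p * M ?p)"
          by (simp add: pderivs_append power_mult_distrib mult_ac)
      qed (use B h AH in \<open>auto simp: ud_bound_def\<close>)
    qed (use h AH in auto)
  qed (use AH in auto)
qed

text \<open>
  By logarithmic convexity the quotients \<open>M p / M (Suc p)\<close> decrease, and so the first is the largest.
\<close>

lemma weight_le_next:
  assumes M: "\<And>p. M p > 0" and M1: "cond_M1 M"
  shows "M p \<le> M 0 / M 1 * M (Suc p)"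
proof (induction p)
  case (Suc p)
  have "(M (Suc p))\<^sup>2 \<le> M p * M (Suc (Suc p))"
    using M1 unfolding cond_M1_def by (metis Suc_eq_plus1 diff_Suc_1 le_add2)
  also have "\<dots> \<le> M 0 / M 1 * M (Suc p) * M (Suc (Suc p))"
    using Suc M[of "Suc (Suc p)"] by (intro mult_right_mono) auto
  finally have "M (Suc p) * M (Suc p) \<le> M (Suc p) * (M 0 / M 1 * M (Suc (Suc p)))"
    by (simp add: power2_eq_square mult_ac)
  then show ?case using M[of "Suc p"] by (rule mult_left_le_imp_le)
qed (use M[of 1] M[of 0] in simp)

lemma norm_sum_list_le:
  fixes f :: "'b \<Rightarrow> complex"
  assumes "\<And>x. x \<in> set xs \<Longrightarrow> norm (f x) \<le> g x"
  shows "norm (\<Sum>x\<leftarrow>xs. f x) \<le> (\<Sum>x\<leftarrow>xs. g x)"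
  using assms by (induction xs) (auto intro!: order_trans[OF norm_triangle_ineq] add_mono)

lemma tame_op_coord_mult:
  assumes M: "\<And>p. M p > 0" and M1: "cond_M1 M"
  shows "tame_op M (\<lambda>\<phi> x. of_real (x $ (k :: 'n::finite)) * \<phi> x)"
  unfolding tame_op_def
proof (intro conjI allI impI)
  fix \<Omega> :: "(real^'n) set" assume \<Omega>: "open \<Omega>" "rotation_invariant_set \<Omega>"
  show "linear_local \<Omega> (\<lambda>\<phi> x. of_real (x $ k) * \<phi> x)"
    unfolding linear_local_def by (auto intro!: smooth_on_coord_mult[OF \<Omega>(1)] simp: distrib_left)
next
  define Q where "Q = M 0 / M 1"
  have Q: "Q \<ge> 0" "\<And>p. M p \<le> Q * M (Suc p)"
    using M[of 0] M[of 1] weight_le_next[OF M M1] by (auto simp: Q_def)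
  show "\<exists>\<gamma>>0. \<forall>K h. compact K \<longrightarrow> rotation_invariant_set K \<longrightarrow> h > 0 \<longrightarrow> op_bounded M (\<lambda>\<phi> x. of_real (x $ k) * \<phi> x) h (\<gamma> * h) K"
  proof (rule exI[of _ 2], intro conjI allI impI)
    fix K :: "(real^'n) set" and h :: real assume K: "compact K" and h: "h > 0"
    obtain R where R: "R > 0" "\<And>x. x \<in> K \<Longrightarrow> norm x \<le> R"
      using compact_imp_bounded[OF K] unfolding bounded_pos by blast
    show "op_bounded M (\<lambda>\<phi> x. of_real (x $ k) * \<phi> x) h (2 * h) K"
    proof (rule exI[of _ "R + Q / h"], intro conjI allI impI)
      fix \<Omega> :: "(real^'n) set" and \<phi> B
      assume \<Omega>: "open \<Omega>" and K\<Omega>: "K \<subseteq> \<Omega>" and s: "smooth_on \<Omega> \<phi>" and B: "ud_bound M h K B \<phi>"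
      have B0: "B \<ge> 0" using B by (simp add: ud_bound_def)
      show "ud_bound M (2 * h) K ((R + Q / h) * B) (\<lambda>x. of_real (x $ k) * \<phi> x)"
        unfolding ud_bound_def
      proof (intro conjI allI ballI)
        fix "is" :: "'n list" and x assume x: "x \<in> K"
        let ?p = "length is"
        have Mp: "M ?p > 0" by (rule M)
        \<comment> \<open>The scale is doubled because Leibniz' rule has up to \<open>?p\<close> lower order terms, and \<open>?p \<le> 2 ^ ?p\<close>.\<close>
        have two: "h ^ ?p * M ?p \<le> (2 * h) ^ ?p * M ?p"
          using h Mp by (intro mult_right_mono power_mono) auto
        have "norm (of_real (x $ k) * pderivs is \<phi> x) \<le> R * (B * (h ^ ?p * M ?p))"
          unfolding norm_mult using R x B h Mp component_le_norm_cart[of x k]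
          by (intro mult_mono) (auto simp: ud_bound_def intro: order_trans)
        also have "\<dots> \<le> R * (B * ((2 * h) ^ ?p * M ?p))"
          using R B0 by (intro mult_left_mono two) auto
        finally have 1: "norm (of_real (x $ k) * pderivs is \<phi> x) \<le> R * B * ((2 * h) ^ ?p * M ?p)"
          by (simp add: mult_ac)
        have 2: "norm (\<Sum>js\<leftarrow>strike k is. pderivs js \<phi> x) \<le> Q / h * B * ((2 * h) ^ ?p * M ?p)"
        proof (cases ?p)
          case (Suc q)
          have "norm (pderivs js \<phi> x) \<le> B * (h ^ q * (Q * M ?p))" if "js \<in> set (strike k is)" for js
          proof -
            have "length js = q" using length_in_strike[OF that] Suc by simp
            then have "norm (pderivs js \<phi> x) \<le> B * (h ^ q * M q)"
              using B x unfolding ud_bound_def by blast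
            also have "\<dots> \<le> B * (h ^ q * (Q * M ?p))"
              using Q(2)[of q] B0 h Suc by (intro mult_left_mono) auto
            finally show ?thesis .
          qed
          then have "norm (\<Sum>js\<leftarrow>strike k is. pderivs js \<phi> x) \<le> (\<Sum>js\<leftarrow>strike k is. B * (h ^ q * (Q * M ?p)))"
            by (rule norm_sum_list_le)
          also have "\<dots> = real (length (strike k is)) * (B * (h ^ q * (Q * M ?p)))"
            by (simp add: sum_list_triv)
          also have "\<dots> \<le> 2 ^ ?p * (B * (h ^ q * (Q * M ?p)))"
          proof (rule mult_right_mono)
            have "real (length (strike k is)) \<le> real ?p" using length_strike[of k "is"] by simp
            also have "\<dots> \<le> 2 ^ ?p" by (rule of_nat_less_two_power[THEN less_imp_le])
            finally show "real (length (strike k is)) \<le> 2 ^ ?p" .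
          qed (use B0 h Q Mp in auto)
          also have "\<dots> = Q / h * B * ((2 * h) ^ ?p * M ?p)"
            using h by (simp add: Suc power_mult_distrib field_simps)
          finally show ?thesis .
        qed (use Q B0 h Mp in auto)
        have "norm (pderivs is (\<lambda>x. of_real (x $ k) * \<phi> x) x) \<le>
            norm (of_real (x $ k) * pderivs is \<phi> x) + norm (\<Sum>js\<leftarrow>strike k is. pderivs js \<phi> x)"
          using x K\<Omega> by (subst pderivs_coord_mult[OF \<Omega> s]) (auto intro: norm_triangle_ineq)
        then show "norm (pderivs is (\<lambda>x. of_real (x $ k) * \<phi> x) x) \<le> (R + Q / h) * B * ((2 * h) ^ ?p * M ?p)"
          using 1 2 by (simp add: ring_distribs)
      qed (use B0 R Q h in auto)
    qed (use R Q h in auto)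
  qed auto
qed

section \<open>Transposed operators and carriers\<close>

lemma smooth_funs_iff: "\<phi> \<in> smooth_funs \<Omega> \<longleftrightarrow> smooth_on \<Omega> \<phi> \<and> (\<forall>x. x \<notin> \<Omega> \<longrightarrow> \<phi> x = 0)"
  unfolding smooth_funs_def smooth_on_def by simp

lemma compact_in_nonempty: "compact_in K \<Omega> \<Longrightarrow> K \<noteq> {}"
  unfolding compact_in_def using interior_empty by blast

lemma deriv_ratio_le_iff:
  assumes "h > 0" "\<And>p. M p > (0::real)"
  shows "norm z / (h ^ p * M p) \<le> B \<longleftrightarrow> norm z \<le> B * (h ^ p * M p)"
proof -
  have "h ^ p * M p > 0" using assms by simp
  then show ?thesis by (rule pos_divide_le_eq)
qed

lemma ud_step_iff:
  assumes h: "h > 0" and M: "\<And>p. M p > 0"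
  shows "\<phi> \<in> ud_step M \<Omega> h K \<longleftrightarrow> \<phi> \<in> smooth_funs \<Omega> \<and> (\<exists>B. ud_bound M h K B \<phi>)"
proof -
  have "bdd_above (deriv_ratios M h K \<phi>) \<longleftrightarrow> (\<exists>B. ud_bound M h K B \<phi>)"
  proof
    assume "bdd_above (deriv_ratios M h K \<phi>)"
    then obtain B where B: "\<And>r. r \<in> deriv_ratios M h K \<phi> \<Longrightarrow> r \<le> B" unfolding bdd_above_def by blast
    have "ud_bound M h K (max B 0) \<phi>"
      unfolding ud_bound_def
    proof (intro conjI allI ballI)
      fix "is" x assume "x \<in> K"
      then have "norm (pderivs is \<phi> x) / (h ^ length is * M (length is)) \<le> B"
        by (intro B) (auto simp: deriv_ratios_def)
      then have "norm (pderivs is \<phi> x) / (h ^ length is * M (length is)) \<le> max B 0" by simp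
      then show "norm (pderivs is \<phi> x) \<le> max B 0 * (h ^ length is * M (length is))"
        by (subst (asm) deriv_ratio_le_iff[where M = M, OF h M])
    qed simp
    then show "\<exists>B. ud_bound M h K B \<phi>" ..
  next
    assume "\<exists>B. ud_bound M h K B \<phi>"
    then obtain B where B: "ud_bound M h K B \<phi>" ..
    show "bdd_above (deriv_ratios M h K \<phi>)"
      using B unfolding deriv_ratios_def ud_bound_def
      by (intro bdd_aboveI[of _ B]) (auto simp: deriv_ratio_le_iff[where M = M, OF h M])
  qed
  then show ?thesis unfolding ud_step_def by simp
qed

lemma ud_seminorm_le:
  assumes h: "h > 0" and M: "\<And>p. M p > 0" and K: "K \<noteq> {}" and B: "ud_bound M h K B \<phi>"
  shows "ud_seminorm M h K \<phi> \<le> B"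
  unfolding ud_seminorm_def
proof (rule cSup_least)
  show "deriv_ratios M h K \<phi> \<noteq> {}" using K unfolding deriv_ratios_def by blast
  show "r \<le> B" if "r \<in> deriv_ratios M h K \<phi>" for r
    using that B unfolding deriv_ratios_def ud_bound_def by (auto simp: deriv_ratio_le_iff[where M = M, OF h M])
qed

lemma ud_bound_ud_seminorm:
  assumes h: "h > 0" and M: "\<And>p. M p > 0" and K: "K \<noteq> {}" and \<phi>: "\<phi> \<in> ud_step M \<Omega> h K"
  shows "ud_bound M h K (ud_seminorm M h K \<phi>) \<phi>"
  unfolding ud_bound_def
proof (intro conjI allI ballI)
  have le: "norm (pderivs is \<phi> x) / (h ^ length is * M (length is)) \<le> ud_seminorm M h K \<phi>" if "x \<in> K" for "is" x
    unfolding ud_seminorm_def using \<phi> that by (intro cSup_upper) (auto simp: deriv_ratios_def ud_step_def)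
  then show "norm (pderivs is \<phi> x) \<le> ud_seminorm M h K \<phi> * (h ^ length is * M (length is))" if "x \<in> K" for "is" x
    using that deriv_ratio_le_iff[where M = M, OF h M] by metis
  obtain x where "x \<in> K" using K by blast
  from le[OF this, of "[]"] show "0 \<le> ud_seminorm M h K \<phi>"
    using M[of 0] by (auto intro: order_trans[rotated])
qed

lemma ud_bound_add:
  assumes "open \<Omega>" "K \<subseteq> \<Omega>" "smooth_on \<Omega> \<phi>" "smooth_on \<Omega> \<psi>"
    and "ud_bound M h K B \<phi>" "ud_bound M h K C \<psi>"
  shows "ud_bound M h K (B + C) (\<lambda>x. \<phi> x + \<psi> x)"
  unfolding ud_bound_def
proof (intro conjI allI ballI)
  fix "is" x assume x: "x \<in> K"
  then have "norm (pderivs is (\<lambda>x. \<phi> x + \<psi> x) x) \<le> norm (pderivs is \<phi> x) + norm (pderivs is \<psi> x)"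
    using assms(2) by (subst pderivs_add[OF assms(1,3,4)]) (auto intro: norm_triangle_ineq)
  also have "\<dots> \<le> (B + C) * (h ^ length is * M (length is))"
    using assms(5,6) x unfolding ud_bound_def distrib_right by (intro add_mono) auto
  finally show "norm (pderivs is (\<lambda>x. \<phi> x + \<psi> x) x) \<le> (B + C) * (h ^ length is * M (length is))" .
qed (use assms(5,6) in \<open>auto simp: ud_bound_def\<close>)

lemma ud_bound_cmult:
  assumes "open \<Omega>" "K \<subseteq> \<Omega>" "smooth_on \<Omega> \<phi>" "ud_bound M h K B \<phi>"
  shows "ud_bound M h K (norm c * B) (\<lambda>x. c * \<phi> x)"
  unfolding ud_bound_def
proof (intro conjI allI ballI)
  fix "is" x assume x: "x \<in> K"
  then have "norm (pderivs is (\<lambda>x. c * \<phi> x) x) = norm c * norm (pderivs is \<phi> x)"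
    using assms(2) by (subst pderivs_cmult[OF assms(1,3)]) (auto simp: norm_mult)
  also have "\<dots> \<le> norm c * (B * (h ^ length is * M (length is)))"
    using assms(4) x unfolding ud_bound_def by (intro mult_left_mono) auto
  finally show "norm (pderivs is (\<lambda>x. c * \<phi> x) x) \<le> norm c * B * (h ^ length is * M (length is))"
    by (simp add: mult.assoc)
qed (use assms(4) in \<open>auto simp: ud_bound_def\<close>)

lemma smooth_funs_add:
  "open \<Omega> \<Longrightarrow> \<phi> \<in> smooth_funs \<Omega> \<Longrightarrow> \<psi> \<in> smooth_funs \<Omega> \<Longrightarrow> (\<lambda>x. \<phi> x + \<psi> x) \<in> smooth_funs \<Omega>"
  by (auto simp: smooth_funs_iff intro: smooth_on_add)

lemma smooth_funs_cmult:
  "open \<Omega> \<Longrightarrow> \<phi> \<in> smooth_funs \<Omega> \<Longrightarrow> (\<lambda>x. c * \<phi> x) \<in> smooth_funs \<Omega>"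
  by (auto simp: smooth_funs_iff intro: smooth_on_cmult)

lemma ud_funs_smooth_funs: "\<phi> \<in> ud_funs r M \<Omega> \<Longrightarrow> \<phi> \<in> smooth_funs \<Omega>"
  unfolding ud_funs_def by blast

lemma ud_funs_smooth_on: "\<phi> \<in> ud_funs r M \<Omega> \<Longrightarrow> smooth_on \<Omega> \<phi>"
  using ud_funs_smooth_funs smooth_funs_iff by blast

lemma ud_funs_iff:
  assumes M: "\<And>p. M p > 0"
  shows "\<phi> \<in> ud_funs r M \<Omega> \<longleftrightarrow> \<phi> \<in> smooth_funs \<Omega> \<and> (\<forall>K. compact_in K \<Omega> \<longrightarrow> (case r of
      Roumieu \<Rightarrow> \<exists>h>0. \<exists>B. ud_bound M h K B \<phi>
    | Beurling \<Rightarrow> \<forall>h>0. \<exists>B. ud_bound M h K B \<phi>))"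
proof -
  have "h > 0 \<Longrightarrow> \<phi> \<in> ud_step M \<Omega> h K \<longleftrightarrow> \<phi> \<in> smooth_funs \<Omega> \<and> (\<exists>B. ud_bound M h K B \<phi>)" for h K
    by (rule ud_step_iff[OF _ M])
  then show ?thesis unfolding ud_funs_def by (cases r) (simp_all cong: conj_cong)
qed

lemma ud_funs_add:
  assumes M: "\<And>p. M p > 0" and \<Omega>: "open \<Omega>" and \<phi>: "\<phi> \<in> ud_funs r M \<Omega>" and \<psi>: "\<psi> \<in> ud_funs r M \<Omega>"
  shows "(\<lambda>x. \<phi> x + \<psi> x) \<in> ud_funs r M \<Omega>"
proof -
  note s = ud_funs_smooth_on[OF \<phi>] ud_funs_smooth_on[OF \<psi>]
  show ?thesis
    unfolding ud_funs_iff[where M = M, OF M]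
  proof (intro conjI allI impI)
    show "(\<lambda>x. \<phi> x + \<psi> x) \<in> smooth_funs \<Omega>"
      using \<phi> \<psi> by (intro smooth_funs_add \<Omega> ud_funs_smooth_funs)
    fix K assume K: "compact_in K \<Omega>"
    then have K': "K \<subseteq> \<Omega>" by (simp add: compact_in_def)
    show "case r of Roumieu \<Rightarrow> \<exists>h>0. \<exists>B. ud_bound M h K B (\<lambda>x. \<phi> x + \<psi> x)
       | Beurling \<Rightarrow> \<forall>h>0. \<exists>B. ud_bound M h K B (\<lambda>x. \<phi> x + \<psi> x)"
    proof (cases r)
      case Roumieu
      obtain h B where h: "h > 0" "ud_bound M h K B \<phi>"
        using \<phi> K Roumieu unfolding ud_funs_iff[where M = M, OF M] by auto
      obtain k C where k: "k > 0" "ud_bound M k K C \<psi>"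
        using \<psi> K Roumieu unfolding ud_funs_iff[where M = M, OF M] by auto
      have "ud_bound M (max h k) K (B + C) (\<lambda>x. \<phi> x + \<psi> x)"
        using h k M by (intro ud_bound_add[OF \<Omega> K' s] ud_bound_mono[OF h(2)] ud_bound_mono[OF k(2)]) auto
      moreover have "max h k > 0" using h by simp
      ultimately show ?thesis using Roumieu by (simp only: regularity.case) blast
    next
      case Beurling
      have "\<exists>B. ud_bound M h K B (\<lambda>x. \<phi> x + \<psi> x)" if "h > 0" for h
        using \<phi> \<psi> K Beurling that ud_bound_add[OF \<Omega> K' s] unfolding ud_funs_iff[where M = M, OF M] by simp blast
      then show ?thesis using Beurling by simp
    qed
  qed
qed

lemma ud_funs_cmult:
  assumes M: "\<And>p. M p > 0" and \<Omega>: "open \<Omega>" and \<phi>: "\<phi> \<in> ud_funs r M \<Omega>"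
  shows "(\<lambda>x. c * \<phi> x) \<in> ud_funs r M \<Omega>"
proof -
  note s = ud_funs_smooth_on[OF \<phi>]
  show ?thesis
    unfolding ud_funs_iff[where M = M, OF M]
  proof (intro conjI allI impI)
    show "(\<lambda>x. c * \<phi> x) \<in> smooth_funs \<Omega>"
      using \<phi> by (intro smooth_funs_cmult \<Omega> ud_funs_smooth_funs)
    fix K assume K: "compact_in K \<Omega>"
    then have K': "K \<subseteq> \<Omega>" by (simp add: compact_in_def)
    show "case r of Roumieu \<Rightarrow> \<exists>h>0. \<exists>B. ud_bound M h K B (\<lambda>x. c * \<phi> x)
       | Beurling \<Rightarrow> \<forall>h>0. \<exists>B. ud_bound M h K B (\<lambda>x. c * \<phi> x)"
      using \<phi> K ud_bound_cmult[OF \<Omega> K' s] unfolding ud_funs_iff[where M = M, OF M]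
      by (cases r) (simp; blast)+
  qed
qed

lemma ud_seminorms_nonneg:
  assumes M: "\<And>p. M p > 0" and p: "p \<in> ud_seminorms r M \<Omega>" and \<phi>: "\<phi> \<in> ud_funs r M \<Omega>"
  shows "0 \<le> p \<phi>"
proof (cases r)
  case Roumieu
  then obtain K where K: "compact_in K \<Omega>" "seminorm_on (\<Union>h\<in>{0<..}. ud_step M \<Omega> h K) p"
    using p unfolding ud_seminorms_def by auto
  then have "\<phi> \<in> (\<Union>h\<in>{0<..}. ud_step M \<Omega> h K)"
    using \<phi> Roumieu unfolding ud_funs_def by auto
  then show ?thesis using K(2) unfolding seminorm_on_def by blast
next
  case Beurling
  then obtain h K where hK: "p = ud_seminorm M h K" "h > 0" "compact_in K \<Omega>"
    using p unfolding ud_seminorms_def by auto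
  then have "\<phi> \<in> ud_step M \<Omega> h K" using \<phi> Beurling unfolding ud_funs_def by auto
  then show ?thesis
    using ud_bound_ud_seminorm[where M = M, OF hK(2) M compact_in_nonempty[OF hK(3)]] hK(1) unfolding ud_bound_def by blast
qed

text \<open>
  As \<open>h\<close> runs through the positive numbers, so does \<open>\<beta> * h\<close>; therefore the loss of a constant factor
  does not leave the spaces.
\<close>

lemma ud_funs_image:
  fixes \<Omega>\<^sub>1 \<Omega>\<^sub>2 :: "(real^'n::finite) set"
  assumes M: "\<And>p. M p > 0" and \<beta>: "\<beta> > 0"
    and sm: "\<psi> \<in> smooth_funs \<Omega>\<^sub>2"
    and bnd: "\<And>K. compact_in K \<Omega>\<^sub>2 \<Longrightarrow> \<exists>K'. compact_in K' \<Omega>\<^sub>1 \<and>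
                (\<forall>h>0. \<forall>B. ud_bound M h K' B \<phi> \<longrightarrow> (\<exists>C. ud_bound M (\<beta> * h) K C \<psi>))"
    and \<phi>: "\<phi> \<in> ud_funs r M \<Omega>\<^sub>1"
  shows "\<psi> \<in> ud_funs r M \<Omega>\<^sub>2"
  unfolding ud_funs_iff[where M = M, OF M]
proof (intro conjI allI impI sm)
  fix K assume "compact_in K \<Omega>\<^sub>2"
  from bnd[OF this] obtain K' where K': "compact_in K' \<Omega>\<^sub>1"
    and *: "\<And>h B. h > 0 \<Longrightarrow> ud_bound M h K' B \<phi> \<Longrightarrow> \<exists>C. ud_bound M (\<beta> * h) K C \<psi>" by blast
  show "case r of Roumieu \<Rightarrow> \<exists>h>0. \<exists>B. ud_bound M h K B \<psi> | Beurling \<Rightarrow> \<forall>h>0. \<exists>B. ud_bound M h K B \<psi>"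
  proof (cases r)
    case Roumieu
    then obtain h B where h: "h > 0" "ud_bound M h K' B \<phi>" using \<phi> K' unfolding ud_funs_iff[where M = M, OF M] by auto
    moreover have "\<beta> * h > 0" using \<beta> h by simp
    ultimately show ?thesis using *[OF h] Roumieu by (simp only: regularity.case) blast
  next
    case Beurling
    have "\<exists>B. ud_bound M h K B \<psi>" if "h > 0" for h
    proof -
      have h': "h / \<beta> > 0" using that \<beta> by simp
      then obtain B where "ud_bound M (h / \<beta>) K' B \<phi>"
        using \<phi> K' Beurling unfolding ud_funs_iff[where M = M, OF M] by auto
      from *[OF h' this] show ?thesis using \<beta> by simp
    qed
    then show ?thesis using Beurling by simp
  qed
qed

text \<open>
  Continuity of the transpose of \<open>\<Lambda>\<close>.  In the Roumieu case \<open>p \<circ> \<Lambda>\<close> is itself one of the generating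
  seminorms whenever \<open>p\<close> is; in the Beurling case it is dominated by the norm with \<open>h / \<beta>\<close> in place of \<open>h\<close>.
\<close>

lemma ud_dual_pullback:
  fixes \<Omega>\<^sub>1 \<Omega>\<^sub>2 :: "(real^'n::finite) set"
  assumes M: "\<And>p. M p > 0" and \<Omega>1: "open \<Omega>\<^sub>1"
    and sm: "\<And>\<phi>. \<phi> \<in> smooth_funs \<Omega>\<^sub>1 \<Longrightarrow> \<Lambda> \<phi> \<in> smooth_funs \<Omega>\<^sub>2"
    and add: "\<And>\<phi> \<psi>. \<phi> \<in> smooth_funs \<Omega>\<^sub>1 \<Longrightarrow> \<psi> \<in> smooth_funs \<Omega>\<^sub>1 \<Longrightarrow> \<Lambda> (\<lambda>x. \<phi> x + \<psi> x) = (\<lambda>x. \<Lambda> \<phi> x + \<Lambda> \<psi> x)"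
    and cmult: "\<And>c \<phi>. \<phi> \<in> smooth_funs \<Omega>\<^sub>1 \<Longrightarrow> \<Lambda> (\<lambda>x. c * \<phi> x) = (\<lambda>x. c * \<Lambda> \<phi> x)"
    and \<beta>: "\<beta> > 0"
    and bnd: "\<And>K. compact_in K \<Omega>\<^sub>2 \<Longrightarrow> \<exists>K'. compact_in K' \<Omega>\<^sub>1 \<and> (\<forall>h>0. \<exists>C\<ge>0. \<forall>\<phi>\<in>smooth_funs \<Omega>\<^sub>1. \<forall>B.
                ud_bound M h K' B \<phi> \<longrightarrow> ud_bound M (\<beta> * h) K (C * B) (\<Lambda> \<phi>))"
    and u: "u \<in> ud_dual r M \<Omega>\<^sub>2"
  shows "(\<lambda>\<phi>. if \<phi> \<in> ud_funs r M \<Omega>\<^sub>1 then u (\<Lambda> \<phi>) else 0) \<in> ud_dual r M \<Omega>\<^sub>1"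
proof -
  have funs: "\<Lambda> \<phi> \<in> ud_funs r M \<Omega>\<^sub>2" if \<phi>: "\<phi> \<in> ud_funs r M \<Omega>\<^sub>1" for \<phi>
  proof (rule ud_funs_image[where M = M, OF M \<beta> sm[OF ud_funs_smooth_funs[OF \<phi>]] _ \<phi>])
    fix K assume "compact_in K \<Omega>\<^sub>2"
    from bnd[OF this] ud_funs_smooth_funs[OF \<phi>] show "\<exists>K'. compact_in K' \<Omega>\<^sub>1 \<and>
        (\<forall>h>0. \<forall>B. ud_bound M h K' B \<phi> \<longrightarrow> (\<exists>C. ud_bound M (\<beta> * h) K C (\<Lambda> \<phi>)))" by meson
  qed
  have semi: "\<exists>q C. q \<in> ud_seminorms r M \<Omega>\<^sub>1 \<and> C \<ge> 0 \<and> (\<forall>\<phi>\<in>ud_funs r M \<Omega>\<^sub>1. p (\<Lambda> \<phi>) \<le> C * q \<phi>)"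
    if p: "p \<in> ud_seminorms r M \<Omega>\<^sub>2" for p
  proof (cases r)
    case Roumieu
    then obtain K where K: "compact_in K \<Omega>\<^sub>2" "seminorm_on (\<Union>h\<in>{0<..}. ud_step M \<Omega>\<^sub>2 h K) p"
      "\<And>h. h > 0 \<Longrightarrow> \<exists>C. \<forall>\<phi>\<in>ud_step M \<Omega>\<^sub>2 h K. p \<phi> \<le> C * ud_seminorm M h K \<phi>"
      using p unfolding ud_seminorms_def by auto
    from bnd[OF K(1)] obtain K' where K': "compact_in K' \<Omega>\<^sub>1"
      "\<And>h. h > 0 \<Longrightarrow> \<exists>C\<ge>0. \<forall>\<phi>\<in>smooth_funs \<Omega>\<^sub>1. \<forall>B. ud_bound M h K' B \<phi> \<longrightarrow> ud_bound M (\<beta> * h) K (C * B) (\<Lambda> \<phi>)" by blast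
    have step: "\<Lambda> \<phi> \<in> ud_step M \<Omega>\<^sub>2 (\<beta> * h) K" if "\<phi> \<in> ud_step M \<Omega>\<^sub>1 h K'" "h > 0" for \<phi> h
    proof -
      have "\<beta> * h > 0" using \<beta> that by simp
      then show ?thesis using that K'(2)[OF that(2)] sm
        unfolding ud_step_iff[where M = M, OF that(2) M] ud_step_iff[where M = M, OF \<open>\<beta> * h > 0\<close> M] by blast
    qed
    let ?V = "\<lambda>\<Omega> K. (\<Union>h\<in>{0<..}. ud_step M \<Omega> h K)"
    have V: "\<Lambda> \<phi> \<in> ?V \<Omega>\<^sub>2 K" if "\<phi> \<in> ?V \<Omega>\<^sub>1 K'" for \<phi>
    proof -
      from that obtain h where "h > 0" "\<phi> \<in> ud_step M \<Omega>\<^sub>1 h K'" by auto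
      with step[of \<phi> h] \<beta> show ?thesis by (auto intro!: bexI[of _ "\<beta> * h"])
    qed
    have V': "\<phi> \<in> smooth_funs \<Omega>\<^sub>1" if "\<phi> \<in> ?V \<Omega>\<^sub>1 K'" for \<phi>
      using that unfolding ud_step_def by auto
    have "seminorm_on (?V \<Omega>\<^sub>1 K') (\<lambda>\<phi>. p (\<Lambda> \<phi>))"
      unfolding seminorm_on_def
    proof (intro conjI ballI allI)
      fix \<phi> assume \<phi>: "\<phi> \<in> ?V \<Omega>\<^sub>1 K'"
      show "0 \<le> p (\<Lambda> \<phi>)" using K(2) V[OF \<phi>] unfolding seminorm_on_def by blast
      show "p (\<Lambda> (\<lambda>x. c * \<phi> x)) = cmod c * p (\<Lambda> \<phi>)" for c
        unfolding cmult[OF V'[OF \<phi>]] using K(2) V[OF \<phi>] unfolding seminorm_on_def by blast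
      fix \<psi> assume \<psi>: "\<psi> \<in> ?V \<Omega>\<^sub>1 K'"
      show "p (\<Lambda> (\<lambda>x. \<phi> x + \<psi> x)) \<le> p (\<Lambda> \<phi>) + p (\<Lambda> \<psi>)"
        unfolding add[OF V'[OF \<phi>] V'[OF \<psi>]] using K(2) V[OF \<phi>] V[OF \<psi>] unfolding seminorm_on_def by blast
    qed
    moreover have "\<exists>C. \<forall>\<phi>\<in>ud_step M \<Omega>\<^sub>1 h K'. p (\<Lambda> \<phi>) \<le> C * ud_seminorm M h K' \<phi>" if h: "h > 0" for h
    proof -
      have \<beta>h: "\<beta> * h > 0" using \<beta> h by simp
      obtain C where C: "\<And>\<phi>. \<phi> \<in> ud_step M \<Omega>\<^sub>2 (\<beta> * h) K \<Longrightarrow> p \<phi> \<le> C * ud_seminorm M (\<beta> * h) K \<phi>"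
        using K(3)[OF \<beta>h] by blast
      obtain D where D: "D \<ge> 0" "\<And>\<phi> B. \<phi> \<in> smooth_funs \<Omega>\<^sub>1 \<Longrightarrow> ud_bound M h K' B \<phi> \<Longrightarrow> ud_bound M (\<beta> * h) K (D * B) (\<Lambda> \<phi>)"
        using K'(2)[OF h] by blast
      have "p (\<Lambda> \<phi>) \<le> max C 0 * D * ud_seminorm M h K' \<phi>" if \<phi>: "\<phi> \<in> ud_step M \<Omega>\<^sub>1 h K'" for \<phi>
      proof -
        have \<phi>': "\<phi> \<in> smooth_funs \<Omega>\<^sub>1" using \<phi> by (simp add: ud_step_def)
        have nn: "0 \<le> ud_seminorm M (\<beta> * h) K (\<Lambda> \<phi>)"
          using ud_bound_ud_seminorm[where M = M, OF \<beta>h M compact_in_nonempty[OF K(1)] step[OF \<phi> h]] by (simp add: ud_bound_def)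
        have "p (\<Lambda> \<phi>) \<le> C * ud_seminorm M (\<beta> * h) K (\<Lambda> \<phi>)" by (rule C[OF step[OF \<phi> h]])
        also have "\<dots> \<le> max C 0 * ud_seminorm M (\<beta> * h) K (\<Lambda> \<phi>)" using nn by (intro mult_right_mono) auto
        also have "\<dots> \<le> max C 0 * (D * ud_seminorm M h K' \<phi>)"
          by (intro mult_left_mono ud_seminorm_le[where M = M, OF \<beta>h M compact_in_nonempty[OF K(1)]] D(2)[OF \<phi>']
              ud_bound_ud_seminorm[where M = M, OF h M compact_in_nonempty[OF K'(1)] \<phi>]) auto
        finally show ?thesis by (simp add: mult.assoc)
      qed
      then show ?thesis by blast
    qed
    ultimately have "(\<lambda>\<phi>. p (\<Lambda> \<phi>)) \<in> ud_seminorms r M \<Omega>\<^sub>1"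
      using Roumieu K'(1) unfolding ud_seminorms_def by auto
    then show ?thesis by (intro exI[of _ "\<lambda>\<phi>. p (\<Lambda> \<phi>)"] exI[of _ 1]) auto
  next
    case Beurling
    then obtain h K where p: "p = ud_seminorm M h K" and h: "h > 0" and K: "compact_in K \<Omega>\<^sub>2"
      using p unfolding ud_seminorms_def by auto
    from bnd[OF K(1)] obtain K' where K': "compact_in K' \<Omega>\<^sub>1"
      "\<And>h. h > 0 \<Longrightarrow> \<exists>C\<ge>0. \<forall>\<phi>\<in>smooth_funs \<Omega>\<^sub>1. \<forall>B. ud_bound M h K' B \<phi> \<longrightarrow> ud_bound M (\<beta> * h) K (C * B) (\<Lambda> \<phi>)" by blast
    have h': "h / \<beta> > 0" using h \<beta> by simp
    from K'(2)[OF h'] obtain C where C: "C \<ge> 0"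
      "\<And>\<phi> B. \<phi> \<in> smooth_funs \<Omega>\<^sub>1 \<Longrightarrow> ud_bound M (h / \<beta>) K' B \<phi> \<Longrightarrow> ud_bound M h K (C * B) (\<Lambda> \<phi>)"
      using \<beta> by auto
    have "p (\<Lambda> \<phi>) \<le> C * ud_seminorm M (h / \<beta>) K' \<phi>" if \<phi>: "\<phi> \<in> ud_funs r M \<Omega>\<^sub>1" for \<phi>
    proof -
      have "\<phi> \<in> ud_step M \<Omega>\<^sub>1 (h / \<beta>) K'" using \<phi> Beurling K'(1) h' unfolding ud_funs_def by auto
      then show ?thesis unfolding p
        by (intro ud_seminorm_le[where M = M, OF h M compact_in_nonempty[OF K]] C(2) ud_funs_smooth_funs[OF \<phi>]
              ud_bound_ud_seminorm[where M = M, OF h' M compact_in_nonempty[OF K'(1)]])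
    qed
    moreover have "ud_seminorm M (h / \<beta>) K' \<in> ud_seminorms r M \<Omega>\<^sub>1"
      using Beurling K'(1) h' unfolding ud_seminorms_def by auto
    ultimately show ?thesis using C(1) by blast
  qed
  obtain P C where P: "finite P" "P \<subseteq> ud_seminorms r M \<Omega>\<^sub>2"
      and C: "\<And>\<phi>. \<phi> \<in> ud_funs r M \<Omega>\<^sub>2 \<Longrightarrow> cmod (u \<phi>) \<le> C * (\<Sum>p\<in>P. p \<phi>)"
    using u unfolding ud_dual_def by blast
  obtain q D where qD: "\<And>p. p \<in> P \<Longrightarrow> q p \<in> ud_seminorms r M \<Omega>\<^sub>1" "\<And>p. p \<in> P \<Longrightarrow> D p \<ge> (0::real)"
      "\<And>p \<phi>. p \<in> P \<Longrightarrow> \<phi> \<in> ud_funs r M \<Omega>\<^sub>1 \<Longrightarrow> p (\<Lambda> \<phi>) \<le> D p * q p \<phi>"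
  proof -
    have "\<forall>p\<in>P. \<exists>q. q \<in> ud_seminorms r M \<Omega>\<^sub>1 \<and> (\<exists>C\<ge>0. \<forall>\<phi>\<in>ud_funs r M \<Omega>\<^sub>1. p (\<Lambda> \<phi>) \<le> C * q \<phi>)"
      using semi P(2) by blast
    from bchoice[OF this] obtain q where q: "\<forall>p\<in>P. q p \<in> ud_seminorms r M \<Omega>\<^sub>1 \<and>
        (\<exists>C\<ge>0. \<forall>\<phi>\<in>ud_funs r M \<Omega>\<^sub>1. p (\<Lambda> \<phi>) \<le> C * q p \<phi>)" ..
    then have "\<forall>p\<in>P. \<exists>C. C \<ge> 0 \<and> (\<forall>\<phi>\<in>ud_funs r M \<Omega>\<^sub>1. p (\<Lambda> \<phi>) \<le> C * q p \<phi>)" by blast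
    from bchoice[OF this] obtain D where "\<forall>p\<in>P. D p \<ge> 0 \<and> (\<forall>\<phi>\<in>ud_funs r M \<Omega>\<^sub>1. p (\<Lambda> \<phi>) \<le> D p * q p \<phi>)" ..
    with q show ?thesis by (intro that[of q D]) blast+
  qed
  have cont: "cmod (u (\<Lambda> \<phi>)) \<le> (\<bar>C\<bar> * (\<Sum>p\<in>P. D p)) * (\<Sum>p\<in>q ` P. p \<phi>)" if \<phi>: "\<phi> \<in> ud_funs r M \<Omega>\<^sub>1" for \<phi>
  proof -
    have le: "p (\<Lambda> \<phi>) \<le> D p * (\<Sum>p\<in>q ` P. p \<phi>)" if p: "p \<in> P" for p
    proof -
      have "p (\<Lambda> \<phi>) \<le> D p * q p \<phi>" by (rule qD(3)[OF p \<phi>])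
      also have "\<dots> \<le> D p * (\<Sum>p\<in>q ` P. p \<phi>)"
        using qD(1) P(1) p ud_seminorms_nonneg[where M = M, OF M _ \<phi>]
        by (intro mult_left_mono qD(2) member_le_sum) auto
      finally show ?thesis .
    qed
    have "cmod (u (\<Lambda> \<phi>)) \<le> C * (\<Sum>p\<in>P. p (\<Lambda> \<phi>))" by (rule C[OF funs[OF \<phi>]])
    also have "\<dots> \<le> \<bar>C\<bar> * (\<Sum>p\<in>P. p (\<Lambda> \<phi>))"
      using P(2) by (intro mult_right_mono sum_nonneg ud_seminorms_nonneg[where M = M, OF M _ funs[OF \<phi>]]) auto
    also have "\<dots> \<le> \<bar>C\<bar> * (\<Sum>p\<in>P. D p * (\<Sum>p\<in>q ` P. p \<phi>))"
      by (intro mult_left_mono sum_mono le) auto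
    finally show ?thesis by (simp add: sum_distrib_right mult.assoc)
  qed
  have u_add: "u (\<lambda>x. \<phi> x + \<psi> x) = u \<phi> + u \<psi>" if "\<phi> \<in> ud_funs r M \<Omega>\<^sub>2" "\<psi> \<in> ud_funs r M \<Omega>\<^sub>2" for \<phi> \<psi>
    using u that unfolding ud_dual_def by blast
  have u_cmult: "u (\<lambda>x. c * \<phi> x) = c * u \<phi>" if "\<phi> \<in> ud_funs r M \<Omega>\<^sub>2" for \<phi> c
    using u that unfolding ud_dual_def by blast
  show ?thesis
    unfolding ud_dual_def
  proof (intro CollectI conjI ballI allI impI)
    let ?u = "\<lambda>\<phi>. if \<phi> \<in> ud_funs r M \<Omega>\<^sub>1 then u (\<Lambda> \<phi>) else 0"
    fix \<phi> assume \<phi>: "\<phi> \<in> ud_funs r M \<Omega>\<^sub>1"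
    show "?u (\<lambda>x. c * \<phi> x) = c * ?u \<phi>" for c
      using \<phi> ud_funs_cmult[where M = M, OF M \<Omega>1 \<phi>] u_cmult[OF funs[OF \<phi>]] cmult[OF ud_funs_smooth_funs[OF \<phi>]] by simp
    fix \<psi> assume \<psi>: "\<psi> \<in> ud_funs r M \<Omega>\<^sub>1"
    show "?u (\<lambda>x. \<phi> x + \<psi> x) = ?u \<phi> + ?u \<psi>"
      using \<phi> \<psi> ud_funs_add[where M = M, OF M \<Omega>1 \<phi> \<psi>] u_add[OF funs[OF \<phi>] funs[OF \<psi>]]
        add[OF ud_funs_smooth_funs[OF \<phi>] ud_funs_smooth_funs[OF \<psi>]] by simp
  next
    show "\<exists>P C. finite P \<and> P \<subseteq> ud_seminorms r M \<Omega>\<^sub>1 \<and> (\<forall>\<phi>\<in>ud_funs r M \<Omega>\<^sub>1.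
        cmod (if \<phi> \<in> ud_funs r M \<Omega>\<^sub>1 then u (\<Lambda> \<phi>) else 0) \<le> C * (\<Sum>p\<in>P. p \<phi>))"
      using P(1) qD(1) cont by (intro exI[of _ "q ` P"] exI[of _ "\<bar>C\<bar> * (\<Sum>p\<in>P. D p)"]) auto
  qed auto
qed

lemma ud_dual_add:
  assumes M: "\<And>p. M p > 0" and f: "f \<in> ud_dual r M \<Omega>" and g: "g \<in> ud_dual r M \<Omega>"
  shows "(\<lambda>\<phi>. f \<phi> + g \<phi>) \<in> ud_dual r M \<Omega>"
proof -
  obtain P C where P: "finite P" "P \<subseteq> ud_seminorms r M \<Omega>"
      "\<And>\<phi>. \<phi> \<in> ud_funs r M \<Omega> \<Longrightarrow> cmod (f \<phi>) \<le> C * (\<Sum>p\<in>P. p \<phi>)"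
    using f unfolding ud_dual_def by blast
  obtain Q D where Q: "finite Q" "Q \<subseteq> ud_seminorms r M \<Omega>"
      "\<And>\<phi>. \<phi> \<in> ud_funs r M \<Omega> \<Longrightarrow> cmod (g \<phi>) \<le> D * (\<Sum>p\<in>Q. p \<phi>)"
    using g unfolding ud_dual_def by blast
  have *: "cmod (f \<phi> + g \<phi>) \<le> (\<bar>C\<bar> + \<bar>D\<bar>) * (\<Sum>p\<in>P \<union> Q. p \<phi>)" if \<phi>: "\<phi> \<in> ud_funs r M \<Omega>" for \<phi>
  proof -
    have nn: "p \<phi> \<ge> 0" if "p \<in> P \<union> Q" for p using that P(2) Q(2) ud_seminorms_nonneg[where M = M, OF M _ \<phi>] by blast
    have "cmod (f \<phi> + g \<phi>) \<le> C * (\<Sum>p\<in>P. p \<phi>) + D * (\<Sum>p\<in>Q. p \<phi>)"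
      using P(3)[OF \<phi>] Q(3)[OF \<phi>] norm_triangle_ineq[of "f \<phi>" "g \<phi>"] by linarith
    also have "\<dots> \<le> \<bar>C\<bar> * (\<Sum>p\<in>P \<union> Q. p \<phi>) + \<bar>D\<bar> * (\<Sum>p\<in>P \<union> Q. p \<phi>)"
      using nn P(1) Q(1) by (intro add_mono mult_mono sum_mono2 sum_nonneg) auto
    finally show ?thesis by (simp add: distrib_right)
  qed
  show ?thesis
    unfolding ud_dual_def
  proof (intro CollectI conjI)
    show "\<exists>P C. finite P \<and> P \<subseteq> ud_seminorms r M \<Omega> \<and> (\<forall>\<phi>\<in>ud_funs r M \<Omega>. cmod (f \<phi> + g \<phi>) \<le> C * (\<Sum>p\<in>P. p \<phi>))"
      using P(1,2) Q(1,2) * by (intro exI[of _ "P \<union> Q"] exI[of _ "\<bar>C\<bar> + \<bar>D\<bar>"]) auto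
  qed (use f g in \<open>auto simp: ud_dual_def algebra_simps\<close>)
qed

lemma ud_dual_cmult:
  assumes f: "f \<in> ud_dual r M \<Omega>"
  shows "(\<lambda>\<phi>. c * f \<phi>) \<in> ud_dual r M \<Omega>"
proof -
  obtain P C where P: "finite P" "P \<subseteq> ud_seminorms r M \<Omega>"
      "\<And>\<phi>. \<phi> \<in> ud_funs r M \<Omega> \<Longrightarrow> cmod (f \<phi>) \<le> C * (\<Sum>p\<in>P. p \<phi>)"
    using f unfolding ud_dual_def by blast
  show ?thesis
    unfolding ud_dual_def
  proof (intro CollectI conjI)
    show "\<exists>P C. finite P \<and> P \<subseteq> ud_seminorms r M \<Omega> \<and> (\<forall>\<phi>\<in>ud_funs r M \<Omega>. cmod (c * f \<phi>) \<le> C * (\<Sum>p\<in>P. p \<phi>))"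
    proof (intro exI[of _ P] exI[of _ "cmod c * C"] conjI ballI P(1,2))
      show "cmod (c * f \<phi>) \<le> cmod c * C * (\<Sum>p\<in>P. p \<phi>)" if "\<phi> \<in> ud_funs r M \<Omega>" for \<phi>
        using mult_left_mono[OF P(3)[OF that], of "cmod c"] by (simp add: norm_mult mult.assoc)
    qed
  qed (use f in \<open>auto simp: ud_dual_def algebra_simps\<close>)
qed

lemma restrict0_smooth_funs:
  assumes "open \<Omega>'" "\<Omega>' \<subseteq> \<Omega>" "smooth_on \<Omega> \<phi>"
  shows "restrict0 \<Omega>' \<phi> \<in> smooth_funs \<Omega>'"
proof -
  have "smooth_on \<Omega>' (restrict0 \<Omega>' \<phi>)"
    by (rule smooth_on_cong[OF assms(1) _ smooth_on_subset[OF assms(3,2)]]) (simp add: restrict0_def)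
  then show ?thesis by (simp add: smooth_funs_iff restrict0_def)
qed

lemma ud_bound_restrict0:
  assumes "open \<Omega>'" "K \<subseteq> \<Omega>'"
  shows "ud_bound M h K B (restrict0 \<Omega>' \<phi>) \<longleftrightarrow> ud_bound M h K B \<phi>"
proof -
  have "pderivs is (restrict0 \<Omega>' \<phi>) x = pderivs is \<phi> x" if "x \<in> K" for "is" x
    using assms that by (intro pderivs_cong[OF assms(1)]) (auto simp: restrict0_def)
  then show ?thesis by (simp add: ud_bound_def)
qed

lemma restrict0_ud_funs:
  assumes M: "\<And>p. M p > 0" and \<Omega>: "open \<Omega>'" "\<Omega>' \<subseteq> \<Omega>" and \<phi>: "\<phi> \<in> ud_funs r M \<Omega>"
  shows "restrict0 \<Omega>' \<phi> \<in> ud_funs r M \<Omega>'"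
  unfolding ud_funs_iff[where M = M, OF M]
proof (intro conjI allI impI)
  show "restrict0 \<Omega>' \<phi> \<in> smooth_funs \<Omega>'" by (rule restrict0_smooth_funs[OF \<Omega> ud_funs_smooth_on[OF \<phi>]])
  fix K assume K: "compact_in K \<Omega>'"
  then have "compact_in K \<Omega>" "K \<subseteq> \<Omega>'" using \<Omega> by (auto simp: compact_in_def)
  then show "case r of Roumieu \<Rightarrow> \<exists>h>0. \<exists>B. ud_bound M h K B (restrict0 \<Omega>' \<phi>)
       | Beurling \<Rightarrow> \<forall>h>0. \<exists>B. ud_bound M h K B (restrict0 \<Omega>' \<phi>)"
    using \<phi> unfolding ud_funs_iff[where M = M, OF M] ud_bound_restrict0[OF \<Omega>(1) \<open>K \<subseteq> \<Omega>'\<close>] by simp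
qed

lemma ud_dual_in_mono:
  assumes M: "\<And>p. M p > 0" and \<Omega>: "open \<Omega>'" "open \<Omega>" "\<Omega>' \<subseteq> \<Omega>" and f: "f \<in> ud_dual_in r M \<Omega>'"
  shows "f \<in> ud_dual_in r M \<Omega>"
proof -
  obtain u where u: "u \<in> ud_dual r M \<Omega>'" "\<And>\<phi>. \<phi> \<in> ud_funs r M UNIV \<Longrightarrow> f \<phi> = u (restrict0 \<Omega>' \<phi>)"
    and f': "f \<in> ud_dual r M UNIV"
    using f unfolding ud_dual_in_def by blast
  let ?u = "\<lambda>\<phi>. if \<phi> \<in> ud_funs r M \<Omega> then u (restrict0 \<Omega>' \<phi>) else 0"
  have "?u \<in> ud_dual r M \<Omega>"
  proof (rule ud_dual_pullback[where M = M, OF M \<Omega>(2) _ _ _ _ _ u(1), where \<beta> = 1])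
    show "\<phi> \<in> smooth_funs \<Omega> \<Longrightarrow> restrict0 \<Omega>' \<phi> \<in> smooth_funs \<Omega>'" for \<phi>
      using restrict0_smooth_funs[OF \<Omega>(1,3)] by (simp add: smooth_funs_iff)
    fix K assume "compact_in K \<Omega>'"
    then have K: "compact_in K \<Omega>" "K \<subseteq> \<Omega>'" using \<Omega> by (auto simp: compact_in_def)
    show "\<exists>K'. compact_in K' \<Omega> \<and> (\<forall>h>0. \<exists>C\<ge>0. \<forall>\<phi>\<in>smooth_funs \<Omega>. \<forall>B.
                ud_bound M h K' B \<phi> \<longrightarrow> ud_bound M (1 * h) K (C * B) (restrict0 \<Omega>' \<phi>))"
      unfolding ud_bound_restrict0[OF \<Omega>(1) K(2)] using K(1)
      by (intro exI[of _ K] conjI allI impI exI[of _ "1::real"]) simp_all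
  qed (auto simp: restrict0_def)
  moreover have "f \<phi> = ?u (restrict0 \<Omega> \<phi>)" if "\<phi> \<in> ud_funs r M UNIV" for \<phi>
  proof -
    have "restrict0 \<Omega>' (restrict0 \<Omega> \<phi>) = restrict0 \<Omega>' \<phi>" using \<Omega>(3) unfolding restrict0_def by (intro ext) auto
    moreover have "restrict0 \<Omega> \<phi> \<in> ud_funs r M \<Omega>" by (rule restrict0_ud_funs[where M = M, OF M \<Omega>(2) _ that]) simp
    ultimately show ?thesis using u(2)[OF that] by simp
  qed
  ultimately show ?thesis
    using f' unfolding ud_dual_in_def by (intro CollectI conjI bexI[of _ ?u] ballI) assumption+
qed

definition dual_op ::
    "regularity \<Rightarrow> (nat \<Rightarrow> real) \<Rightarrow> ((real^'n::finite \<Rightarrow> complex) \<Rightarrow> real^'n \<Rightarrow> complex)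
      \<Rightarrow> ((real^'n \<Rightarrow> complex) \<Rightarrow> complex) \<Rightarrow> (real^'n \<Rightarrow> complex) \<Rightarrow> complex" where
  "dual_op r M A g = (\<lambda>\<phi>. if \<phi> \<in> ud_funs r M UNIV then g (A \<phi>) else 0)"

lemma compact_in_rotation_hull:
  assumes "compact_in K \<Omega>" "rotation_invariant_set \<Omega>"
  shows "compact_in (rotation_hull K) \<Omega>"
  using assms compact_rotation_hull[of K] rotation_hull_least[of \<Omega> K]
    interior_mono[OF rotation_hull_subset[of K]] unfolding compact_in_def by blast

lemma tame_op_estimate:
  assumes "tame_op M A"
  obtains \<beta> where "\<beta> > 0" "\<And>K h. compact K \<Longrightarrow> rotation_invariant_set K \<Longrightarrow> h > 0 \<Longrightarrow> op_bounded M A h (\<beta> * h) K"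
  using assms unfolding tame_op_def by blast

text \<open>
  The topology over \<open>\<Omega>\<close> is given by arbitrary compact subsets, whereas the estimate for \<open>A\<close> requires
  invariant ones; since \<open>\<Omega>\<close> is invariant, it contains their rotation hulls.
\<close>

lemma dual_op_in_ud_dual_in:
  assumes M: "\<And>p. M p > 0" and A: "tame_op M A" and \<Omega>: "open \<Omega>" "rotation_invariant_set \<Omega>"
    and u: "u \<in> ud_dual r M \<Omega>"
  shows "(\<lambda>\<phi>. if \<phi> \<in> ud_funs r M \<Omega> then u (restrict0 \<Omega> (A \<phi>)) else 0) \<in> ud_dual r M \<Omega>"
proof -
  note L = tame_op_linear_local[OF A \<Omega>]
  obtain \<beta> where \<beta>: "\<beta> > 0" "\<And>K h. compact K \<Longrightarrow> rotation_invariant_set K \<Longrightarrow> h > 0 \<Longrightarrow> op_bounded M A h (\<beta> * h) K"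
    by (rule tame_op_estimate[OF A]) blast
  show ?thesis
  proof (rule ud_dual_pullback[where M = M, OF M \<Omega>(1) _ _ _ \<beta>(1) _ u])
    show "\<phi> \<in> smooth_funs \<Omega> \<Longrightarrow> restrict0 \<Omega> (A \<phi>) \<in> smooth_funs \<Omega>" for \<phi>
      by (rule restrict0_smooth_funs[OF \<Omega>(1) order_refl]) (simp add: linear_localD(1)[OF L] smooth_funs_iff)
    show "restrict0 \<Omega> (A (\<lambda>x. \<phi> x + \<psi> x)) = (\<lambda>x. restrict0 \<Omega> (A \<phi>) x + restrict0 \<Omega> (A \<psi>) x)"
      if "\<phi> \<in> smooth_funs \<Omega>" "\<psi> \<in> smooth_funs \<Omega>" for \<phi> \<psi>
      using that linear_localD(2)[OF L, of \<phi> \<psi>] by (auto simp: restrict0_def smooth_funs_iff)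
    show "restrict0 \<Omega> (A (\<lambda>x. c * \<phi> x)) = (\<lambda>x. c * restrict0 \<Omega> (A \<phi>) x)" if "\<phi> \<in> smooth_funs \<Omega>" for c \<phi>
      using that linear_localD(3)[OF L, of \<phi>] by (auto simp: restrict0_def smooth_funs_iff)
    fix K assume K: "compact_in K \<Omega>"
    have K': "compact_in (rotation_hull K) \<Omega>" by (rule compact_in_rotation_hull[OF K \<Omega>(2)])
    have K'2: "compact (rotation_hull K)" "rotation_hull K \<subseteq> \<Omega>" using K' by (auto simp: compact_in_def)
    show "\<exists>K'. compact_in K' \<Omega> \<and> (\<forall>h>0. \<exists>C\<ge>0. \<forall>\<phi>\<in>smooth_funs \<Omega>. \<forall>B.
                ud_bound M h K' B \<phi> \<longrightarrow> ud_bound M (\<beta> * h) K (C * B) (restrict0 \<Omega> (A \<phi>)))"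
    proof (rule exI[of _ "rotation_hull K"], intro conjI K' allI impI)
      fix h :: real assume h: "h > 0"
      obtain C where C: "C \<ge> 0" "\<And>\<phi> B. smooth_on \<Omega> \<phi> \<Longrightarrow> ud_bound M h (rotation_hull K) B \<phi> \<Longrightarrow>
          ud_bound M (\<beta> * h) (rotation_hull K) (C * B) (A \<phi>)"
        using \<beta>(2)[OF K'2(1) rotation_invariant_hull h] \<Omega> K'2(2) by blast
      have "ud_bound M (\<beta> * h) K (C * B) (restrict0 \<Omega> (A \<phi>))"
        if "\<phi> \<in> smooth_funs \<Omega>" "ud_bound M h (rotation_hull K) B \<phi>" for \<phi> B
      proof -
        have "ud_bound M (\<beta> * h) (rotation_hull K) (C * B) (A \<phi>)"
          using that C(2) by (simp add: smooth_funs_iff)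
        then have "ud_bound M (\<beta> * h) K (C * B) (A \<phi>)"
          using rotation_hull_subset[of K] unfolding ud_bound_def by blast
        moreover have "K \<subseteq> \<Omega>" using K by (simp add: compact_in_def)
        ultimately show ?thesis using ud_bound_restrict0[OF \<Omega>(1)] by blast
      qed
      then show "\<exists>C\<ge>0. \<forall>\<phi>\<in>smooth_funs \<Omega>. \<forall>B. ud_bound M h (rotation_hull K) B \<phi> \<longrightarrow>
            ud_bound M (\<beta> * h) K (C * B) (restrict0 \<Omega> (A \<phi>))" using C(1) by blast
    qed
  qed
qed

lemma restrict0_UNIV: "restrict0 UNIV \<phi> = \<phi>"
  by (simp add: restrict0_def)

lemma dual_op_in_ud_dual:
  assumes M: "\<And>p. M p > 0" and A: "tame_op M A" and g: "g \<in> ud_dual r M UNIV"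
  shows "dual_op r M A g \<in> ud_dual r M UNIV"
  using dual_op_in_ud_dual_in[where M = M, OF M A open_UNIV rotation_invariant_UNIV g]
  unfolding dual_op_def restrict0_UNIV .

lemma tame_op_ud_funs:
  assumes M: "\<And>p. M p > 0" and A: "tame_op M A" and \<phi>: "\<phi> \<in> ud_funs r M UNIV"
  shows "A \<phi> \<in> ud_funs r M UNIV"
proof -
  obtain \<beta> where \<beta>: "\<beta> > 0" "\<And>K h. compact K \<Longrightarrow> rotation_invariant_set K \<Longrightarrow> h > 0 \<Longrightarrow> op_bounded M A h (\<beta> * h) K"
    by (rule tame_op_estimate[OF A]) blast
  have s: "smooth_on UNIV \<phi>" by (rule ud_funs_smooth_on[OF \<phi>])
  show ?thesis
  proof (rule ud_funs_image[where M = M, OF M \<beta>(1) _ _ \<phi>])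
    show "A \<phi> \<in> smooth_funs UNIV" using tame_op_smooth[OF A s] by (simp add: smooth_funs_iff)
    fix K :: "(real^'a) set" assume K: "compact_in K UNIV"
    have K': "compact_in (rotation_hull K) UNIV" by (rule compact_in_rotation_hull[OF K rotation_invariant_UNIV])
    have "\<exists>C. ud_bound M (\<beta> * h) K C (A \<phi>)" if h: "h > 0" and B: "ud_bound M h (rotation_hull K) B \<phi>" for h B
    proof -
      have "compact (rotation_hull K)" using K' by (simp add: compact_in_def)
      from \<beta>(2)[OF this rotation_invariant_hull h] obtain C where
        "ud_bound M (\<beta> * h) (rotation_hull K) (C * B) (A \<phi>)"
        using s B rotation_invariant_UNIV by blast
      then show ?thesis using rotation_hull_subset[of K] unfolding ud_bound_def by blast
    qed
    then show "\<exists>K'. compact_in K' UNIV \<and> (\<forall>h>0. \<forall>B. ud_bound M h K' B \<phi> \<longrightarrow> (\<exists>C. ud_bound M (\<beta> * h) K C (A \<phi>)))"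
      using K' by blast
  qed
qed

text \<open>
  The \<open>e\<close>-neighbourhoods of a rotation invariant compact set are rotation invariant and
  arbitrarily small, and over each of them \<open>A\<close> has a continuous transpose.
\<close>

lemma carrier_of_dual_op:
  fixes K :: "(real^'n::finite) set"
  assumes M: "\<And>p. M p > 0" and A: "tame_op M A" and K: "rotation_invariant_set K"
    and g: "carrier_of r M g K"
  shows "carrier_of r M (dual_op r M A g) K"
  unfolding carrier_of_def
proof (intro conjI allI impI)
  show cK: "compact K" using g by (simp add: carrier_of_def)
  fix \<Omega> assume \<Omega>: "open \<Omega> \<and> K \<subseteq> \<Omega>"
  obtain e where e: "e > 0" "(\<Union>x\<in>K. ball x e) \<subseteq> \<Omega>"
    using compact_subset_open_imp_ball_epsilon_subset[OF cK] \<Omega> by blast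
  let ?\<Omega> = "\<Union>x\<in>K. ball x e"
  have o: "open ?\<Omega>" by auto
  have inv: "rotation_invariant_set ?\<Omega>"
  proof (rule rotation_invariant_setI)
    fix U :: "real^'n^'n" and x assume U: "rotation_matrix U" and "x \<in> ?\<Omega>"
    then obtain k where k: "k \<in> K" "dist k x < e" by auto
    have "dist (U *v k) (U *v x) = dist k x"
      using rotation_matrix_norm[OF U, of "k - x"] by (simp add: dist_norm matrix_vector_mult_diff_distrib)
    then have "U *v x \<in> ball (U *v k) e" using k by simp
    then show "U *v x \<in> ?\<Omega>" using rotation_invariant_set_mem[OF K U k(1)] by blast
  qed
  have "K \<subseteq> ?\<Omega>" using e(1) by force
  then have "g \<in> ud_dual_in r M ?\<Omega>" using g o unfolding carrier_of_def by blast
  then obtain u where g': "g \<in> ud_dual r M UNIV" and u: "u \<in> ud_dual r M ?\<Omega>"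
      "\<And>\<phi>. \<phi> \<in> ud_funs r M UNIV \<Longrightarrow> g \<phi> = u (restrict0 ?\<Omega> \<phi>)"
    unfolding ud_dual_in_def by blast
  let ?u = "\<lambda>\<phi>. if \<phi> \<in> ud_funs r M ?\<Omega> then u (restrict0 ?\<Omega> (A \<phi>)) else 0"
  have "?u \<in> ud_dual r M ?\<Omega>" by (rule dual_op_in_ud_dual_in[where M = M, OF M A o inv u(1)])
  moreover have "dual_op r M A g \<phi> = ?u (restrict0 ?\<Omega> \<phi>)" if "\<phi> \<in> ud_funs r M UNIV" for \<phi>
  proof -
    have "A \<phi> x = A (restrict0 ?\<Omega> \<phi>) x" if "x \<in> ?\<Omega>" for x
      by (rule linear_localD(4)[OF tame_op_linear_local[OF A o inv] _ that]) (simp add: restrict0_def)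
    then have "restrict0 ?\<Omega> (A \<phi>) = restrict0 ?\<Omega> (A (restrict0 ?\<Omega> \<phi>))"
      unfolding restrict0_def by (intro ext) simp
    moreover have "restrict0 ?\<Omega> \<phi> \<in> ud_funs r M ?\<Omega>" by (rule restrict0_ud_funs[where M = M, OF M o _ that]) simp
    ultimately show ?thesis
      using u(2)[OF tame_op_ud_funs[where M = M, OF M A that]] that unfolding dual_op_def by presburger
  qed
  moreover have "dual_op r M A g \<in> ud_dual r M UNIV" by (rule dual_op_in_ud_dual[where M = M, OF M A g'])
  ultimately have "dual_op r M A g \<in> ud_dual_in r M ?\<Omega>"
    unfolding ud_dual_in_def by (intro CollectI conjI bexI[of _ ?u] ballI) assumption+
  then show "dual_op r M A g \<in> ud_dual_in r M \<Omega>"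
    using ud_dual_in_mono[where M = M, OF M o _ e(2)] \<Omega> by blast
qed

section \<open>Rotation invariance of Lebesgue measure\<close>

lemma emeasure_unit_ball:
  "emeasure lborel (ball (0::'a::euclidean_space) 1) \<noteq> 0" "emeasure lborel (ball (0::'a::euclidean_space) 1) \<noteq> \<infinity>"
proof -
  show "emeasure lborel (ball (0::'a) 1) \<noteq> 0"
  proof
    assume "emeasure lborel (ball (0::'a) 1) = 0"
    then have "ball (0::'a) 1 \<in> null_sets lborel" by auto
    then have "negligible (ball (0::'a) 1)" by (metis negligible_iff_null_sets null_sets_completionI)
    then show False using open_not_negligible[of "ball (0::'a) 1"] by simp
  qed
  show "emeasure lborel (ball (0::'a) 1) \<noteq> \<infinity>"
    using emeasure_bounded_finite[OF bounded_ball] by (simp add: less_top[symmetric])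
qed

text \<open>
  Uniqueness of invariant measures: a double integral computed in two ways shows that the image measure
  \<open>\<mu>\<close> satisfies \<open>\<mu> A * \<lambda> B = \<lambda> A * \<mu> B\<close> with Lebesgue measure \<open>\<lambda>\<close>.  For \<open>B\<close> one takes the
  unit ball, which has the same measure for both because an orthogonal map preserves it.
\<close>

lemma lborel_distr_orthogonal:
  fixes f :: "'a::euclidean_space \<Rightarrow> 'a"
  assumes f: "orthogonal_transformation f"
  shows "distr lborel borel f = lborel"
proof -
  have lin: "linear f" and nrm: "\<And>x. norm (f x) = norm x"
    using f by (auto simp: orthogonal_transformation orthogonal_transformation_linear)
  have surj: "surj f" using f by (rule orthogonal_transformation_surj)
  have fm [measurable]: "f \<in> borel_measurable borel"
    using lin by (intro borel_measurable_continuous_onI linear_continuous_on) (simp add: linear_linear)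
  define \<mu> where "\<mu> = distr lborel borel f"
  have sets [measurable_cong, simp]: "sets \<mu> = sets borel" and sp [simp]: "space \<mu> = UNIV"
    unfolding \<mu>_def by auto
  have nn: "(\<integral>\<^sup>+x. g x \<partial>\<mu>) = (\<integral>\<^sup>+x. g (f x) \<partial>lborel)" if "g \<in> borel_measurable borel" for g
    unfolding \<mu>_def using that by (simp add: nn_integral_distr)
  have vim: "f -` ball 0 (real n) = ball 0 (real n)" for n by (auto simp: nrm)
  have ball: "emeasure \<mu> (ball 0 (real n)) = emeasure lborel (ball (0::'a) (real n))" for n
    unfolding \<mu>_def by (simp add: emeasure_distr vim)
  have "sigma_finite_measure \<mu>"
  proof
    show "\<exists>A. countable A \<and> A \<subseteq> sets \<mu> \<and> \<Union>A = space \<mu> \<and> (\<forall>a\<in>A. emeasure \<mu> a \<noteq> \<infinity>)"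
    proof (intro exI[of _ "range (\<lambda>n::nat. ball 0 (real n))"] conjI ballI)
      show "\<Union>(range (\<lambda>n::nat. ball (0::'a) (real n))) = space \<mu>"
        using reals_Archimedean2 by (auto simp: dist_norm)
      show "emeasure \<mu> a \<noteq> \<infinity>" if "a \<in> range (\<lambda>n::nat. ball 0 (real n))" for a
      proof -
        from that obtain n :: nat where n: "a = ball 0 (real n)" by (rule rangeE)
        show ?thesis unfolding n ball using emeasure_bounded_finite[OF bounded_ball, of "0::'a" "real n"] by simp
      qed
    qed auto
  qed
  then interpret \<mu>: sigma_finite_measure \<mu> .
  interpret P: pair_sigma_finite \<mu> lborel ..
  have refl: "(\<integral>\<^sup>+x. g (y - x) \<partial>\<mu>) = (\<integral>\<^sup>+x. g x \<partial>\<mu>)" if [measurable]: "g \<in> borel_measurable borel" for g :: "'a \<Rightarrow> ennreal" and y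
  proof -
    obtain z where z: "y = f z" using surj by (metis surjD)
    have "(\<integral>\<^sup>+x. g (y - x) \<partial>\<mu>) = (\<integral>\<^sup>+x. g (f (z + (-1) *\<^sub>R x)) \<partial>lborel)"
      by (subst nn) (auto simp: z linear_diff[OF lin])
    also have "\<dots> = (\<integral>\<^sup>+x. g (f x) \<partial>distr lborel borel (\<lambda>x. z + (-1) *\<^sub>R x))"
      by (subst nn_integral_distr) auto
    also have "distr lborel borel (\<lambda>x. z + (-1) *\<^sub>R x) = lborel"
      using lborel_affine[of "-1" z] by (simp add: density_1)
    finally show ?thesis by (simp add: nn)
  qed
  have trans: "(\<integral>\<^sup>+y. g (y - x) \<partial>lborel) = (\<integral>\<^sup>+y. g y \<partial>lborel)" if [measurable]: "g \<in> borel_measurable borel" for g :: "'a \<Rightarrow> ennreal" and x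
  proof -
    have "(\<integral>\<^sup>+y. g y \<partial>lborel) = (\<integral>\<^sup>+y. g y \<partial>distr lborel borel ((+) (- x)))"
      by (simp only: lborel_distr_plus)
    also have "\<dots> = (\<integral>\<^sup>+y. g (y - x) \<partial>lborel)"
      by (subst nn_integral_distr) (auto simp: add.commute[of "-x"])
    finally show ?thesis ..
  qed
  have key: "emeasure \<mu> A * emeasure lborel B = emeasure lborel A * emeasure \<mu> B"
    if [measurable]: "A \<in> sets borel" "B \<in> sets borel" for A B
  proof -
    let ?I = "\<lambda>A x. indicator A x :: ennreal"
    have "emeasure \<mu> A * emeasure lborel B = (\<integral>\<^sup>+x. ?I A x * emeasure lborel B \<partial>\<mu>)"
      by (simp add: nn_integral_multc)
    also have "\<dots> = (\<integral>\<^sup>+x. (\<integral>\<^sup>+y. ?I A x * ?I B (y - x) \<partial>lborel) \<partial>\<mu>)"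
      using trans[of "?I B"] by (simp add: nn_integral_cmult)
    also have "\<dots> = (\<integral>\<^sup>+y. (\<integral>\<^sup>+x. ?I A x * ?I B (y - x) \<partial>\<mu>) \<partial>lborel)"
      by (rule P.Fubini'[symmetric]) measurable
    also have "\<dots> = (\<integral>\<^sup>+y. (\<integral>\<^sup>+x. ?I A (y - x) * ?I B x \<partial>\<mu>) \<partial>lborel)"
    proof (rule nn_integral_cong)
      fix y
      show "(\<integral>\<^sup>+x. ?I A x * ?I B (y - x) \<partial>\<mu>) = (\<integral>\<^sup>+x. ?I A (y - x) * ?I B x \<partial>\<mu>)"
        using refl[of "\<lambda>x. ?I A (y - x) * ?I B x" y] by simp
    qed
    also have "\<dots> = (\<integral>\<^sup>+x. (\<integral>\<^sup>+y. ?I A (y - x) * ?I B x \<partial>lborel) \<partial>\<mu>)"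
      by (rule P.Fubini') measurable
    also have "\<dots> = (\<integral>\<^sup>+x. emeasure lborel A * ?I B x \<partial>\<mu>)"
      using trans[of "?I A"] by (simp add: nn_integral_multc)
    also have "\<dots> = emeasure lborel A * emeasure \<mu> B"
      by (simp add: nn_integral_cmult)
    finally show ?thesis .
  qed
  show ?thesis
  proof (rule measure_eqI)
    show "emeasure (distr lborel borel f) A = emeasure lborel A" if "A \<in> sets (distr lborel borel f)" for A
    proof -
      let ?b = "emeasure lborel (ball (0::'a) 1)"
      have "emeasure \<mu> A * ?b = emeasure lborel A * ?b"
        using key[of A "ball 0 1"] ball[of 1] that by simp
      moreover note emeasure_unit_ball[where 'a = 'a]
      ultimately have "emeasure \<mu> A * ?b / ?b = emeasure lborel A * ?b / ?b" "?b \<noteq> 0" "?b \<noteq> top" by simp_all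
      then have "emeasure \<mu> A = emeasure lborel A" by (simp only: mult_divide_eq_ennreal not_False_eq_True)
      then show ?thesis unfolding \<mu>_def .
    qed
  qed simp
qed

text \<open>
  The source of random directions.  Taking points of the ball instead of the sphere lets the rotation
  invariance of Lebesgue measure be used directly.
\<close>

definition ball_measure :: "(real^'n::finite) measure" where
  "ball_measure = uniform_measure lborel (ball 0 1)"

lemma sets_ball_measure [measurable_cong, simp]: "sets (ball_measure :: (real^'n) measure) = sets borel"
  by (simp add: ball_measure_def)

lemma space_ball_measure [simp]: "space (ball_measure :: (real^'n) measure) = UNIV"
  by (simp add: ball_measure_def)

lemma emeasure_ball_measure_UNIV: "emeasure (ball_measure :: (real^'n) measure) UNIV = 1"
  unfolding ball_measure_def
  using emeasure_unit_ball[where 'a = "real^'n"] by (simp add: ennreal_divide_self less_top[symmetric])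

lemma finite_ball_measure: "finite_measure (ball_measure :: (real^'n) measure)"
  by (rule finite_measureI) (simp add: emeasure_ball_measure_UNIV)

lemma distr_ball_measure:
  fixes f :: "real^'n::finite \<Rightarrow> real^'n"
  assumes f: "orthogonal_transformation f"
  shows "distr ball_measure borel f = (ball_measure :: (real^'n) measure)"
proof (rule measure_eqI)
  have fm [measurable]: "f \<in> borel_measurable borel"
    using orthogonal_transformation_linear[OF f]
    by (intro borel_measurable_continuous_onI linear_continuous_on) (simp add: linear_linear)
  have nrm: "\<And>x. norm (f x) = norm x" using f by (auto simp: orthogonal_transformation)
  fix A assume "A \<in> sets (distr ball_measure borel f)"
  then have [measurable]: "A \<in> sets borel" by simp
  have "f -` A \<in> sets borel" using measurable_sets[OF fm, of A] by simp
  then have "emeasure (distr ball_measure borel f) A = emeasure lborel (ball 0 1 \<inter> f -` A) / emeasure lborel (ball (0::real^'n) 1)"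
    unfolding ball_measure_def by (subst emeasure_distr) (auto simp: emeasure_uniform_measure)
  also have "ball 0 1 \<inter> f -` A = f -` (ball 0 1 \<inter> A)" by (auto simp: nrm)
  also have "emeasure lborel (f -` (ball 0 1 \<inter> A)) = emeasure (distr lborel borel f) (ball 0 1 \<inter> A)"
    by (subst emeasure_distr) auto
  also have "\<dots> = emeasure lborel (ball 0 1 \<inter> A)" by (simp only: lborel_distr_orthogonal[OF f])
  also have "\<dots> / emeasure lborel (ball (0::real^'n) 1) = emeasure ball_measure A"
    unfolding ball_measure_def by simp
  finally show "emeasure (distr ball_measure borel f) A = emeasure ball_measure A" .
qed simp

lemma integral_ball_measure_rotate:
  fixes g :: "real^'n::finite \<Rightarrow> complex"
  assumes U: "rotation_matrix U" and g: "g \<in> borel_measurable borel"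
  shows "(LINT y|ball_measure. g (U *v y)) = (LINT y|ball_measure. g y)"
proof -
  have orth: "orthogonal_transformation ((*v) U)"
    using U orthogonal_transformation_matrix[of "(*v) U"] by (simp add: rotation_matrix_def)
  have "(*v) U \<in> borel_measurable borel"
    by (intro borel_measurable_continuous_onI continuous_intros)
  then have "(LINT y|distr ball_measure borel ((*v) U). g y) = (LINT y|ball_measure. g (U *v y))"
    using g by (intro integral_distr) auto
  then show ?thesis by (simp add: distr_ball_measure[OF orth])
qed

lemma AE_ball_measure_coord_nonzero: "AE y in (ball_measure :: (real^'n) measure). y $ k \<noteq> 0"
proof -
  have "negligible {y :: real^'n. y $ k = 0}" by (rule negligible_standard_hyperplane_cart)
  then have "AE y in lebesgue. (y :: real^'n) $ k \<noteq> 0"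
    using AE_not_in[of "{y :: real^'n. y $ k = 0}" lebesgue] by (simp add: negligible_iff_null_sets)
  then have "AE y in lborel. (y :: real^'n) $ k \<noteq> 0" by (simp add: AE_completion_iff)
  then show ?thesis unfolding ball_measure_def
    by (intro AE_uniform_measureI) auto
qed

section \<open>Rotations in coordinate planes\<close>

text \<open>
  The rotation of the plane of the coordinates \<open>i\<close> and \<open>j\<close> whose angle has cosine \<open>c\<close> and sine \<open>s\<close>.
  Random angles are going to be given by coordinates of random points, for which this is simpler than
  the angle itself.
\<close>

definition plane_rot :: "'n::finite \<Rightarrow> 'n \<Rightarrow> real \<Rightarrow> real \<Rightarrow> real^'n^'n" where
  "plane_rot i j c s = (\<chi> a b. if a = i \<and> b = i \<or> a = j \<and> b = j then c else if a = i \<and> b = j then - s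
     else if a = j \<and> b = i then s else if a = b then 1 else 0)"

lemma plane_rot_apply:
  assumes "i \<noteq> j"
  shows "(plane_rot i j c s *v x) $ k = (if k = i then c * x $ i - s * x $ j
     else if k = j then s * x $ i + c * x $ j else x $ k)"
proof -
  have two: "(\<Sum>b\<in>UNIV. (if b = i then u else if b = j then v else 0)) = u + (v::real)" for u v
  proof -
    have "(if b = i then u else if b = j then v else 0) = (if b = i then u else 0) + (if b = j then v else 0)" for b
      using assms by simp
    then show ?thesis by (simp add: sum.distrib)
  qed
  show ?thesis
  proof (cases "k = i \<or> k = j")
    case True
    then show ?thesis
    proof
      assume k: "k = i"
      have "(plane_rot i j c s *v x) $ k = (\<Sum>b\<in>UNIV. (if b = i then c * x $ i else if b = j then - s * x $ j else 0))"
        unfolding matrix_vector_mult_def plane_rot_def using assms k by (auto intro!: sum.cong)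
      then show ?thesis using two k assms by simp
    next
      assume k: "k = j"
      have "(plane_rot i j c s *v x) $ k = (\<Sum>b\<in>UNIV. (if b = i then s * x $ i else if b = j then c * x $ j else 0))"
        unfolding matrix_vector_mult_def plane_rot_def using assms k by (auto intro!: sum.cong)
      then show ?thesis using two k assms by simp
    qed
  next
    case False
    have "(plane_rot i j c s *v x) $ k = (\<Sum>b\<in>UNIV. if b = k then x $ k else 0)"
      unfolding matrix_vector_mult_def plane_rot_def vec_lambda_beta using False by (intro sum.cong) auto
    then show ?thesis using False by simp
  qed
qed

lemma sum_two_split:
  fixes f :: "'n \<Rightarrow> real"
  assumes "finite S" "i \<in> S" "j \<in> S" "i \<noteq> j"
  shows "sum f S = f i + f j + sum f (S - {i, j})"
proof -
  have "sum f S = sum f {i, j} + sum f (S - {i, j})"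
    using assms by (metis add.commute empty_subsetI insert_subset sum.subset_diff)
  then show ?thesis using assms by simp
qed

lemma plane_rot_sum_squares:
  assumes "i \<noteq> j" "c\<^sup>2 + s\<^sup>2 = 1" "i \<in> S" "j \<in> S"
  shows "(\<Sum>k\<in>S. ((plane_rot i j c s *v x) $ k)\<^sup>2) = (\<Sum>k\<in>S. (x $ k)\<^sup>2)"
proof -
  have "(c * x $ i - s * x $ j)\<^sup>2 + (s * x $ i + c * x $ j)\<^sup>2 = (c\<^sup>2 + s\<^sup>2) * ((x $ i)\<^sup>2 + (x $ j)\<^sup>2)"
    by (simp add: power2_eq_square algebra_simps)
  then show ?thesis
    using assms by (simp add: sum_two_split[OF finite, of i S j] plane_rot_apply)
qed

lemma norm_vec_squares: "(norm (x :: real^'n))\<^sup>2 = (\<Sum>k\<in>UNIV. (x $ k)\<^sup>2)"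
  by (simp add: norm_vec_def L2_set_def sum_nonneg)

lemma plane_rot_compose:
  assumes "i \<noteq> j"
  shows "plane_rot i j c s ** plane_rot i j c' s' = plane_rot i j (c * c' - s * s') (s * c' + c * s')"
  unfolding matrix_eq matrix_vector_mul_assoc[symmetric] using assms
  by (auto simp: vec_eq_iff plane_rot_apply[OF assms] algebra_simps)

lemma rotation_plane_rot:
  assumes ij: "i \<noteq> j" and cs: "c\<^sup>2 + s\<^sup>2 = 1"
  shows "rotation_matrix (plane_rot i j c s)"
proof -
  have orth: "orthogonal_matrix (plane_rot i j c s)" if "c\<^sup>2 + s\<^sup>2 = 1" for c s
  proof -
    have "norm (plane_rot i j c s *v x) = norm x" for x
      using plane_rot_sum_squares[OF ij that, of UNIV x] norm_vec_squares
      by (metis UNIV_I norm_ge_zero power2_eq_imp_eq)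
    then have "orthogonal_transformation ((*v) (plane_rot i j c s))"
      by (simp add: orthogonal_transformation)
    then show ?thesis by (simp add: orthogonal_transformation_matrix)
  qed
  obtain t where t: "c = cos t" "s = sin t" using sincos_total_2pi[OF cs] by metis
  let ?R = "plane_rot i j (cos (t/2)) (sin (t/2))"
  have "plane_rot i j c s = ?R ** ?R"
    unfolding plane_rot_compose[OF ij] t using cos_add[of "t/2" "t/2"] sin_add[of "t/2" "t/2"] by (simp only: field_sum_of_halves)
  then have "det (plane_rot i j c s) = det ?R * det ?R" by (simp add: det_mul)
  moreover have "det ?R = 1 \<or> det ?R = -1" by (intro det_orthogonal_matrix orth) simp
  ultimately have "det (plane_rot i j c s) = 1" by auto
  then show ?thesis using orth[OF cs] by (simp add: rotation_matrix_def)
qed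

lemma plane_rot_identity: "i \<noteq> j \<Longrightarrow> plane_rot i j 1 0 = mat 1"
  unfolding matrix_eq by (auto simp: vec_eq_iff plane_rot_apply)

lemma measurable_plane_rot [measurable]:
  assumes [measurable]: "c \<in> borel_measurable M" "s \<in> borel_measurable M"
  shows "(\<lambda>y. plane_rot i j (c y) (s y)) \<in> borel_measurable M"
proof -
  have *: "plane_rot i j c s = plane_rot i j 0 0 + c *\<^sub>R (plane_rot i j 1 0 - plane_rot i j 0 0)
      + s *\<^sub>R (plane_rot i j 0 1 - plane_rot i j 0 0)" for c s
    unfolding vec_eq_iff
  proof (intro allI)
    fix a b
    consider "a = i \<and> b = i \<or> a = j \<and> b = j" | "\<not> (a = i \<and> b = i \<or> a = j \<and> b = j)" "a = i \<and> b = j"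
      | "\<not> (a = i \<and> b = i \<or> a = j \<and> b = j)" "\<not> (a = i \<and> b = j)" "a = j \<and> b = i"
      | "\<not> (a = i \<and> b = i \<or> a = j \<and> b = j)" "\<not> (a = i \<and> b = j)" "\<not> (a = j \<and> b = i)" by blast
    then show "plane_rot i j c s $ a $ b = (plane_rot i j 0 0 + c *\<^sub>R (plane_rot i j 1 0 - plane_rot i j 0 0)
      + s *\<^sub>R (plane_rot i j 0 1 - plane_rot i j 0 0)) $ a $ b"
      unfolding plane_rot_def vector_add_component vector_minus_component vector_scaleR_component vec_lambda_beta
      by cases (simp_all only: if_True if_False, simp_all)
  qed
  have "continuous_on UNIV (\<lambda>p. plane_rot i j 0 0 + fst p *\<^sub>R (plane_rot i j 1 0 - plane_rot i j 0 0)
      + snd p *\<^sub>R (plane_rot i j 0 1 - plane_rot i j 0 0))"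
    by (intro continuous_intros)
  moreover have "(\<lambda>p. plane_rot i j (fst p) (snd p)) = (\<lambda>p. plane_rot i j 0 0 + fst p *\<^sub>R (plane_rot i j 1 0 - plane_rot i j 0 0)
      + snd p *\<^sub>R (plane_rot i j 0 1 - plane_rot i j 0 0))"
    by (intro ext) (rule *)
  ultimately have "continuous_on UNIV (\<lambda>p. plane_rot i j (fst p) (snd p))" by (simp only:)
  then have "(\<lambda>p. plane_rot i j (fst p) (snd p)) \<in> borel_measurable borel"
    by (rule borel_measurable_continuous_onI)
  from measurable_compose[OF borel_measurable_Pair[OF assms] this] show ?thesis
    by (simp only: fst_conv snd_conv)
qed

section \<open>Invariant averages over the rotation group\<close>

definition rot_space :: "(real^'n^'n::finite) measure" where
  "rot_space = restrict_space borel {U. rotation_matrix U}"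

definition rot_distribution :: "(real^'n^'n::finite) measure \<Rightarrow> bool" where
  "rot_distribution \<alpha> \<longleftrightarrow> emeasure \<alpha> (space \<alpha>) = 1 \<and> sets \<alpha> = sets rot_space"

definition rot_mean :: "(real^'n^'n::finite) measure \<Rightarrow> (real^'n \<Rightarrow> complex) \<Rightarrow> real^'n \<Rightarrow> complex" where
  "rot_mean \<alpha> \<phi> x = (LINT U|\<alpha>. \<phi> (U *v x))"

text \<open>
  With this order of the factors, convolution of distributions corresponds to composition of mean
  operators.
\<close>

definition rot_convolution :: "(real^'n^'n::finite) measure \<Rightarrow> (real^'n^'n) measure \<Rightarrow> (real^'n^'n) measure" where
  "rot_convolution \<alpha> \<beta> = distr (\<alpha> \<Otimes>\<^sub>M \<beta>) rot_space (\<lambda>(U, V). V ** U)"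

text \<open>
  A class of functions that all averages preserve and to which the theorem of Fubini applies.  It has
  to contain functions that are not continuous, such as functions of the direction of a point.
\<close>

definition loc_bounded :: "(real^'n::finite \<Rightarrow> complex) \<Rightarrow> bool" where
  "loc_bounded \<phi> \<longleftrightarrow> \<phi> \<in> borel_measurable borel \<and> (\<forall>R. bounded (\<phi> ` cball 0 R))"

lemma space_rot_space: "space rot_space = {U. rotation_matrix U}"
  by (simp add: rot_space_def space_restrict_space)

lemma rot_distribution_space: "rot_distribution \<alpha> \<Longrightarrow> space \<alpha> = {U. rotation_matrix U}"
  unfolding rot_distribution_def using sets_eq_imp_space_eq space_rot_space by metis

lemma rot_distribution_finite: "rot_distribution \<alpha> \<Longrightarrow> finite_measure \<alpha>"
  unfolding rot_distribution_def by (intro finite_measureI) simp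

lemma rot_distribution_measure: "rot_distribution \<alpha> \<Longrightarrow> measure \<alpha> (space \<alpha>) = 1"
  unfolding rot_distribution_def measure_def by simp

lemma measurable_ident_rot:
  fixes \<alpha> :: "(real^'n^'n::finite) measure"
  assumes \<alpha>: "rot_distribution \<alpha>"
  shows "(\<lambda>U. U) \<in> borel_measurable \<alpha>"
proof -
  have "(\<lambda>U. U) \<in> borel_measurable (rot_space :: (real^'n^'n) measure)"
    unfolding rot_space_def by (rule measurable_restrict_space1) simp
  then show ?thesis
    using \<alpha> by (simp add: rot_distribution_def cong: measurable_cong_sets)
qed

lemma rotation_family_ident: "rot_distribution \<alpha> \<Longrightarrow> rotation_family \<alpha> (\<lambda>U. U)"
  unfolding rotation_family_def
  using rot_distribution_finite measurable_ident_rot rot_distribution_space by auto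

lemma loc_bounded_rotate_bounded:
  assumes "loc_bounded \<phi>"
  obtains B where "B \<ge> 0" "\<And>U. rotation_matrix U \<Longrightarrow> norm (\<phi> (U *v x)) \<le> B"
proof -
  obtain B where B: "\<And>z. z \<in> cball 0 (norm x) \<Longrightarrow> norm (\<phi> z) \<le> B"
    using assms unfolding loc_bounded_def bounded_iff by blast
  then show ?thesis
    by (intro that[of "max B 0"]) (auto simp: rotation_matrix_norm max.coboundedI1)
qed

lemma measurable_matrix_vector_mult_pair:
  "(\<lambda>p :: (real^'n^'n) \<times> (real^'n). fst p *v snd p) \<in> borel_measurable (borel \<Otimes>\<^sub>M borel)"
  unfolding borel_prod by (intro borel_measurable_continuous_onI continuous_intros)

lemma measurable_matrix_matrix_mult_pair:
  "(\<lambda>p :: (real^'n^'n) \<times> (real^'n^'n). snd p ** fst p) \<in> borel_measurable (borel \<Otimes>\<^sub>M borel)"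
  unfolding borel_prod matrix_matrix_mult_def
  by (intro borel_measurable_continuous_onI continuous_on_vec_lambda continuous_intros continuous_on_component)

lemma measurable_rotate_loc_bounded:
  fixes T :: "'y \<Rightarrow> real^'n^'n"
  assumes \<phi>: "loc_bounded \<phi>" and T: "T \<in> borel_measurable \<mu>" and g: "g \<in> borel_measurable \<mu>"
  shows "(\<lambda>y. \<phi> (T y *v g y)) \<in> borel_measurable \<mu>"
proof -
  have "(\<lambda>y. (T y, g y)) \<in> \<mu> \<rightarrow>\<^sub>M borel \<Otimes>\<^sub>M borel"
    by (rule measurable_Pair[OF T g])
  from measurable_compose[OF this measurable_matrix_vector_mult_pair]
  have "(\<lambda>y. T y *v g y) \<in> borel_measurable \<mu>" by simp
  then show ?thesis by (rule measurable_compose) (use \<phi> in \<open>simp add: loc_bounded_def\<close>)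
qed

lemma integrable_loc_bounded:
  fixes T :: "'y \<Rightarrow> real^'n^'n"
  assumes \<phi>: "loc_bounded \<phi>" and T: "rotation_family \<mu> T"
  shows "integrable \<mu> (\<lambda>y. \<phi> (T y *v x))"
proof -
  interpret finite_measure \<mu> using T by (simp add: rotation_family_def)
  obtain B where B: "B \<ge> 0" "\<And>U. rotation_matrix U \<Longrightarrow> norm (\<phi> (U *v x)) \<le> B"
    by (rule loc_bounded_rotate_bounded[OF \<phi>]) blast
  show ?thesis
    using B T by (intro integrable_const_bound[of _ B] measurable_rotate_loc_bounded[OF \<phi>])
      (auto simp: rotation_family_def)
qed

lemma loc_bounded_average:
  fixes T :: "'y \<Rightarrow> real^'n^'n"
  assumes \<phi>: "loc_bounded \<phi>" and T: "rotation_family \<mu> T"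
  shows "loc_bounded (\<lambda>x. LINT y|\<mu>. \<phi> (T y *v x))"
  unfolding loc_bounded_def
proof (intro conjI allI)
  interpret finite_measure \<mu> using T by (simp add: rotation_family_def)
  have "(\<lambda>p. \<phi> (T (snd p) *v fst p)) \<in> borel_measurable (borel \<Otimes>\<^sub>M \<mu>)"
    using T by (intro measurable_rotate_loc_bounded[OF \<phi>]) (auto simp: rotation_family_def)
  then show "(\<lambda>x. LINT y|\<mu>. \<phi> (T y *v x)) \<in> borel_measurable borel"
    by (intro borel_measurable_lebesgue_integral) (simp add: split_beta)
  fix R
  obtain B where B: "\<And>z. z \<in> cball 0 R \<Longrightarrow> norm (\<phi> z) \<le> B"
    using \<phi> unfolding loc_bounded_def bounded_iff by blast
  show "bounded ((\<lambda>x. LINT y|\<mu>. \<phi> (T y *v x)) ` cball 0 R)"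
    unfolding bounded_iff
  proof (intro exI[of _ "measure \<mu> (space \<mu>) * B"] ballI)
    fix z assume "z \<in> (\<lambda>x. LINT y|\<mu>. \<phi> (T y *v x)) ` cball 0 R"
    then obtain x where x: "norm x \<le> R" "z = (LINT y|\<mu>. \<phi> (T y *v x))" by auto
    have "norm z \<le> (LINT y|\<mu>. norm (\<phi> (T y *v x)))" unfolding x by simp
    also have "\<dots> \<le> (LINT y|\<mu>. B)"
      using integrable_loc_bounded[OF \<phi> T, of x] T x(1)
      by (intro integral_mono) (auto simp: rotation_family_def rotation_matrix_norm intro!: B)
    finally show "norm z \<le> measure \<mu> (space \<mu>) * B" by simp
  qed
qed

lemma loc_bounded_rot_mean: "rot_distribution \<alpha> \<Longrightarrow> loc_bounded \<phi> \<Longrightarrow> loc_bounded (rot_mean \<alpha> \<phi>)"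
  unfolding rot_mean_def[abs_def] by (intro loc_bounded_average rotation_family_ident)

lemma
  fixes \<alpha> \<beta> :: "(real^'n^'n::finite) measure"
  assumes \<alpha>: "rot_distribution \<alpha>" and \<beta>: "rot_distribution \<beta>"
  shows rot_distribution_convolution: "rot_distribution (rot_convolution \<alpha> \<beta>)"
    and rot_mean_convolution: "loc_bounded \<phi> \<Longrightarrow> rot_mean (rot_convolution \<alpha> \<beta>) \<phi> x = rot_mean \<alpha> (rot_mean \<beta> \<phi>) x"
    and AE_rot_convolution: "{U. P U} \<in> sets borel \<Longrightarrow> AE U in \<alpha>. P U \<Longrightarrow> AE U in \<beta>. P U \<Longrightarrow>
        (\<And>U V. P U \<Longrightarrow> P V \<Longrightarrow> P (V ** U)) \<Longrightarrow> AE U in rot_convolution \<alpha> \<beta>. P U"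
proof -
  interpret \<alpha>: finite_measure \<alpha> by (rule rot_distribution_finite[OF \<alpha>])
  interpret \<beta>: finite_measure \<beta> by (rule rot_distribution_finite[OF \<beta>])
  interpret P: pair_sigma_finite \<alpha> \<beta> ..
  note [measurable] = measurable_ident_rot[OF \<alpha>] measurable_ident_rot[OF \<beta>]
  have sp: "space (\<alpha> \<Otimes>\<^sub>M \<beta>) = {U. rotation_matrix U} \<times> {U. rotation_matrix U}"
    by (simp add: space_pair_measure rot_distribution_space[OF \<alpha>] rot_distribution_space[OF \<beta>])
  have "(\<lambda>p. (fst p, snd p)) \<in> \<alpha> \<Otimes>\<^sub>M \<beta> \<rightarrow>\<^sub>M borel \<Otimes>\<^sub>M borel"
    by (intro measurable_Pair measurable_compose[OF measurable_fst measurable_ident_rot[OF \<alpha>]]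
        measurable_compose[OF measurable_snd measurable_ident_rot[OF \<beta>]])
  from measurable_compose[OF this measurable_matrix_matrix_mult_pair]
  have mb: "(\<lambda>(U, V). V ** U) \<in> borel_measurable (\<alpha> \<Otimes>\<^sub>M \<beta>)"
    by (simp add: split_beta)
  have m: "(\<lambda>(U, V). V ** U) \<in> \<alpha> \<Otimes>\<^sub>M \<beta> \<rightarrow>\<^sub>M rot_space"
    unfolding rot_space_def
    by (rule measurable_restrict_space2[OF _ mb]) (auto simp: sp rotation_matrix_mult)
  have sets: "sets (rot_convolution \<alpha> \<beta>) = sets rot_space" by (simp add: rot_convolution_def)
  have "emeasure (rot_convolution \<alpha> \<beta>) (space (rot_convolution \<alpha> \<beta>)) = emeasure (\<alpha> \<Otimes>\<^sub>M \<beta>) (space (\<alpha> \<Otimes>\<^sub>M \<beta>))"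
    unfolding rot_convolution_def space_distr
    by (subst emeasure_distr[OF m sets.top]) (auto simp: sp space_rot_space rotation_matrix_mult intro!: arg_cong[where f = "emeasure _"])
  also have "\<dots> = 1"
    unfolding space_pair_measure using \<alpha> \<beta> by (subst \<beta>.emeasure_pair_measure_Times) (auto simp: rot_distribution_def)
  finally show *: "rot_distribution (rot_convolution \<alpha> \<beta>)" using sets by (simp add: rot_distribution_def)
  show "rot_mean (rot_convolution \<alpha> \<beta>) \<phi> x = rot_mean \<alpha> (rot_mean \<beta> \<phi>) x" if \<phi>: "loc_bounded \<phi>"
  proof -
    obtain B where B: "B \<ge> 0" "\<And>U. rotation_matrix U \<Longrightarrow> norm (\<phi> (U *v x)) \<le> B"
      by (rule loc_bounded_rotate_bounded[OF \<phi>]) blast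
    have meas: "(\<lambda>U. \<phi> (U *v x)) \<in> borel_measurable rot_space"
      unfolding rot_space_def
      by (intro measurable_restrict_space1 measurable_rotate_loc_bounded[OF \<phi>]) auto
    have "rot_mean (rot_convolution \<alpha> \<beta>) \<phi> x = (LINT p|(\<alpha> \<Otimes>\<^sub>M \<beta>). \<phi> ((case p of (U, V) \<Rightarrow> V ** U) *v x))"
      unfolding rot_mean_def rot_convolution_def by (rule integral_distr[OF m meas])
    also have "\<dots> = (LINT p|(\<alpha> \<Otimes>\<^sub>M \<beta>). (case p of (U, V) \<Rightarrow> \<phi> (V *v (U *v x))))"
      by (simp add: split_beta matrix_vector_mul_assoc)
    also have "\<dots> = (LINT U|\<alpha>. (LINT V|\<beta>. \<phi> (V *v (U *v x))))"
    proof (rule P.integral_fst[symmetric])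
      have "finite_measure (\<alpha> \<Otimes>\<^sub>M \<beta>)" by (intro finite_measure_pair_measure \<alpha>.finite_measure_axioms \<beta>.finite_measure_axioms)
      then interpret PP: finite_measure "\<alpha> \<Otimes>\<^sub>M \<beta>" .
      show "integrable (\<alpha> \<Otimes>\<^sub>M \<beta>) (\<lambda>(U, V). \<phi> (V *v (U *v x)))"
      proof (rule PP.integrable_const_bound[of _ B])
        show "AE p in \<alpha> \<Otimes>\<^sub>M \<beta>. norm (case p of (U, V) \<Rightarrow> \<phi> (V *v (U *v x))) \<le> B"
          using B by (intro AE_I2) (auto simp: sp matrix_vector_mul_assoc rotation_matrix_mult)
        have "(\<lambda>p. \<phi> ((case p of (U, V) \<Rightarrow> V ** U) *v x)) \<in> borel_measurable (\<alpha> \<Otimes>\<^sub>M \<beta>)"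
          by (rule measurable_compose[OF m meas])
        then show "(\<lambda>(U, V). \<phi> (V *v (U *v x))) \<in> borel_measurable (\<alpha> \<Otimes>\<^sub>M \<beta>)"
          by (simp add: split_beta matrix_vector_mul_assoc)
      qed
    qed
    finally show ?thesis by (simp add: rot_mean_def)
  qed
  show "AE U in rot_convolution \<alpha> \<beta>. P U"
    if P: "{U. P U} \<in> sets borel" and AE: "AE U in \<alpha>. P U" "AE U in \<beta>. P U"
      and mult: "\<And>U V. P U \<Longrightarrow> P V \<Longrightarrow> P (V ** U)"
  proof -
    have P': "{U \<in> space rot_space. P U} \<in> sets rot_space"
      using P unfolding rot_space_def sets_restrict_space by (auto simp: space_restrict_space)
    have "AE p in \<alpha> \<Otimes>\<^sub>M \<beta>. P (snd p ** fst p)"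
    proof (rule P.AE_pair_measure)
      show "{p \<in> space (\<alpha> \<Otimes>\<^sub>M \<beta>). P (snd p ** fst p)} \<in> sets (\<alpha> \<Otimes>\<^sub>M \<beta>)"
        using measurable_sets[OF mb P] by (simp add: vimage_def split_beta Int_def conj_commute)
      show "AE U in \<alpha>. AE V in \<beta>. P (snd (U, V) ** fst (U, V))"
        using AE(1)
      proof eventually_elim
        case (elim U)
        from AE(2) show ?case by eventually_elim (use elim mult in auto)
      qed
    qed
    then show ?thesis
      unfolding rot_convolution_def AE_distr_iff[OF m P'] by (simp add: split_beta)
  qed
qed

definition plane_distribution :: "'n \<Rightarrow> 'n \<Rightarrow> (real^'n \<Rightarrow> real) \<Rightarrow> (real^'n \<Rightarrow> real) \<Rightarrow> (real^'n^'n::finite) measure" where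
  "plane_distribution i j c s = distr ball_measure rot_space (\<lambda>y. plane_rot i j (c y) (s y))"

lemma
  fixes i j :: "'n::finite"
  assumes ij: "i \<noteq> j" and [measurable]: "c \<in> borel_measurable borel" "s \<in> borel_measurable borel"
    and cs: "\<And>y. (c y)\<^sup>2 + (s y)\<^sup>2 = 1"
  shows rotation_family_plane: "rotation_family ball_measure (\<lambda>y. plane_rot i j (c y) (s y))"
    and rot_distribution_plane: "rot_distribution (plane_distribution i j c s)"
    and rot_mean_plane: "loc_bounded \<phi> \<Longrightarrow>
        rot_mean (plane_distribution i j c s) \<phi> x = (LINT y|ball_measure. \<phi> (plane_rot i j (c y) (s y) *v x))"
    and AE_plane_distribution: "{U. P U} \<in> sets borel \<Longrightarrow> (\<And>y. P (plane_rot i j (c y) (s y))) \<Longrightarrow>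
        AE U in plane_distribution i j c s. P U"
proof -
  let ?T = "\<lambda>y. plane_rot i j (c y) (s y)"
  have mb: "?T \<in> borel_measurable ball_measure" by measurable
  have rot: "rotation_matrix (?T y)" for y by (rule rotation_plane_rot[OF ij cs])
  show "rotation_family ball_measure ?T"
    using mb rot finite_ball_measure by (simp add: rotation_family_def)
  have m: "?T \<in> ball_measure \<rightarrow>\<^sub>M rot_space"
    unfolding rot_space_def by (rule measurable_restrict_space2[OF _ mb]) (use rot in auto)
  have "emeasure (plane_distribution i j c s) (space (plane_distribution i j c s)) = emeasure (ball_measure :: (real^'n) measure) UNIV"
    unfolding plane_distribution_def space_distr
    by (subst emeasure_distr[OF m sets.top]) (simp add: space_rot_space rot)
  then show "rot_distribution (plane_distribution i j c s)"
    by (simp add: rot_distribution_def plane_distribution_def emeasure_ball_measure_UNIV)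
  show "rot_mean (plane_distribution i j c s) \<phi> x = (LINT y|ball_measure. \<phi> (?T y *v x))" if \<phi>: "loc_bounded \<phi>"
  proof -
    have meas: "(\<lambda>U. \<phi> (U *v x)) \<in> borel_measurable rot_space"
      unfolding rot_space_def
      by (intro measurable_restrict_space1 measurable_rotate_loc_bounded[OF \<phi>]) auto
    show ?thesis unfolding rot_mean_def plane_distribution_def by (rule integral_distr[OF m meas])
  qed
  show "AE U in plane_distribution i j c s. P U" if P: "{U. P U} \<in> sets borel" and "\<And>y. P (?T y)"
  proof -
    have P': "{U \<in> space rot_space. P U} \<in> sets rot_space"
      using P unfolding rot_space_def sets_restrict_space by (auto simp: space_restrict_space)
    show ?thesis unfolding plane_distribution_def AE_distr_iff[OF m P'] using that(2) by simp
  qed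
qed

definition fixes_off :: "'n set \<Rightarrow> real^'n^'n::finite \<Rightarrow> bool" where
  "fixes_off S U \<longleftrightarrow> (\<forall>k. k \<notin> S \<longrightarrow> U *v axis k 1 = axis k 1)"

lemma fixes_off_measurable: "{U. fixes_off S U} \<in> sets borel"
proof -
  have "{U. fixes_off S U} = (\<Inter>k\<in>-S. {U. U *v axis k 1 = axis k 1})" by (auto simp: fixes_off_def)
  also have "closed \<dots>" by (intro closed_INT ballI closed_Collect_eq continuous_intros)
  finally show ?thesis by (rule borel_closed)
qed

lemma fixes_off_mult: "fixes_off S U \<Longrightarrow> fixes_off S V \<Longrightarrow> fixes_off S (V ** U)"
  by (simp add: fixes_off_def flip: matrix_vector_mul_assoc)

lemma fixes_off_mono: "fixes_off S U \<Longrightarrow> S \<subseteq> S' \<Longrightarrow> fixes_off S' U"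
  unfolding fixes_off_def by blast

lemma fixes_off_plane_rot: "i \<noteq> j \<Longrightarrow> fixes_off {i, j} (plane_rot i j c s)"
  unfolding fixes_off_def vec_eq_iff by (auto simp: plane_rot_apply axis_def)

text \<open>
  The transpose of a rotation is its inverse, hence it fixes the same vectors.
\<close>

lemma fixes_off_coord:
  fixes U :: "real^'n^'n"
  assumes U: "rotation_matrix U" and f: "fixes_off S U" and k: "k \<notin> S"
  shows "(U *v x) $ k = x $ k"
proof -
  have orth: "orthogonal_transformation ((*v) U)"
    using U orthogonal_transformation_matrix[of "(*v) U"] by (simp add: rotation_matrix_def)
  have "(U *v x) $ k = (U *v x) \<bullet> axis k 1" by (simp add: inner_axis)
  also have "axis k 1 = U *v axis k 1" using f k by (simp add: fixes_off_def)
  also have "(U *v x) \<bullet> (U *v axis k 1) = x \<bullet> axis k 1"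
    using orth by (simp add: orthogonal_transformation_def)
  finally show ?thesis by (simp add: inner_axis)
qed

definition sqnorm_on :: "'n set \<Rightarrow> real^'n::finite \<Rightarrow> real" where
  "sqnorm_on S x = (\<Sum>k\<in>S. (x $ k)\<^sup>2)"

lemma sqnorm_on_nonneg: "sqnorm_on S x \<ge> 0"
  by (simp add: sqnorm_on_def sum_nonneg)

lemma fixes_off_sqnorm:
  fixes U :: "real^'n^'n"
  assumes U: "rotation_matrix U" and f: "fixes_off S U"
  shows "sqnorm_on S (U *v x) = sqnorm_on S x"
proof -
  have split: "(norm z)\<^sup>2 = sqnorm_on S z + sqnorm_on (- S) z" for z :: "real^'n"
    unfolding norm_vec_squares sqnorm_on_def
    by (metis Compl_eq_Diff_UNIV add.commute finite_code sum.subset_diff top_greatest)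
  have "sqnorm_on (- S) (U *v x) = sqnorm_on (- S) x"
    unfolding sqnorm_on_def using fixes_off_coord[OF U f] by (intro sum.cong) auto
  then show ?thesis using split[of "U *v x"] split[of x] rotation_matrix_norm[OF U, of x] by simp
qed

definition invariant_on :: "'n set \<Rightarrow> (real^'n \<Rightarrow> complex) \<Rightarrow> bool" where
  "invariant_on S \<phi> \<longleftrightarrow> (\<forall>x x'. (\<forall>k. k \<notin> S \<longrightarrow> x $ k = x' $ k) \<longrightarrow> sqnorm_on S x = sqnorm_on S x' \<longrightarrow> \<phi> x = \<phi> x')"

text \<open>
  For two or more coordinates \<open>S\<close>, the Haar measure of the group of rotations in them has these
  properties.  What matters
  is only that averages depend on the coordinates outside \<open>S\<close> and the length of the \<open>S\<close>-part, that
  is, on the invariants of that group.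
\<close>

definition haar_on :: "'n set \<Rightarrow> (real^'n^'n::finite) measure \<Rightarrow> bool" where
  "haar_on S \<alpha> \<longleftrightarrow> rot_distribution \<alpha> \<and> (AE U in \<alpha>. fixes_off S U) \<and>
     (\<forall>\<phi>. loc_bounded \<phi> \<longrightarrow> invariant_on S (rot_mean \<alpha> \<phi>))"

lemma integral_ball_measure_cong_AE:
  fixes f g :: "real^'n::finite \<Rightarrow> complex"
  assumes "f \<in> borel_measurable borel" "g \<in> borel_measurable borel" "\<And>y. y $ k \<noteq> 0 \<Longrightarrow> f y = g y"
  shows "(LINT y|ball_measure. f y) = (LINT y|ball_measure. g y)"
  using AE_ball_measure_coord_nonzero[of k] assms
  by (intro integral_cong_AE) (auto elim!: eventually_mono)

lemma measurable_component [measurable]: "(\<lambda>x :: real^'n. x $ k) \<in> borel_measurable borel"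
  by (intro borel_measurable_continuous_onI continuous_intros continuous_on_component)

lemma measurable_sqnorm_on [measurable]: "(\<lambda>x :: real^'n::finite. sqnorm_on S x) \<in> borel_measurable borel"
  unfolding sqnorm_on_def by measurable

text \<open>
  The cosine, and below the sine, of the polar angle of the point \<open>(a, b)\<close>.  At the origin, which has no
  polar angle, the values of the angle \<open>0\<close> keep the sum of the squares equal to \<open>1\<close>.
\<close>

definition dir_cos :: "real \<Rightarrow> real \<Rightarrow> real" where
  "dir_cos a b = (if a\<^sup>2 + b\<^sup>2 = 0 then 1 else a / sqrt (a\<^sup>2 + b\<^sup>2))"

definition dir_sin :: "real \<Rightarrow> real \<Rightarrow> real" where
  "dir_sin a b = (if a\<^sup>2 + b\<^sup>2 = 0 then 0 else b / sqrt (a\<^sup>2 + b\<^sup>2))"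

lemma dir_cos_sin: "(dir_cos a b)\<^sup>2 + (dir_sin a b)\<^sup>2 = 1"
  by (simp add: dir_cos_def dir_sin_def power_divide add_divide_distrib[symmetric])

lemma measurable_dir [measurable]:
  assumes [measurable]: "f \<in> borel_measurable M" "g \<in> borel_measurable M"
  shows "(\<lambda>x. dir_cos (f x) (g x)) \<in> borel_measurable M" "(\<lambda>x. dir_sin (f x) (g x)) \<in> borel_measurable M"
  unfolding dir_cos_def dir_sin_def by measurable

lemma plane_rot_between:
  fixes x x' :: "real^'n::finite"
  assumes ij: "i \<noteq> j" and eq: "\<And>k. k \<notin> {i, j} \<Longrightarrow> x $ k = x' $ k"
    and sq: "(x $ i)\<^sup>2 + (x $ j)\<^sup>2 = (x' $ i)\<^sup>2 + (x' $ j)\<^sup>2"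
  obtains c s where "c\<^sup>2 + s\<^sup>2 = 1" "x' = plane_rot i j c s *v x"
proof (cases "(x $ i)\<^sup>2 + (x $ j)\<^sup>2 = 0")
  case True
  then have "x $ i = 0" "x $ j = 0" "x' $ i = 0" "x' $ j = 0"
    using sq sum_power2_eq_zero_iff by metis+
  then have "x' = plane_rot i j 1 0 *v x"
    unfolding vec_eq_iff plane_rot_apply[OF ij] using eq by auto
  then show ?thesis using that[of 1 0] by simp
next
  case False
  define R where "R = (x $ i)\<^sup>2 + (x $ j)\<^sup>2"
  have R: "R \<noteq> 0" using False by (simp add: R_def)
  define c where "c = (x $ i * x' $ i + x $ j * x' $ j) / R"
  define s where "s = (x $ i * x' $ j - x $ j * x' $ i) / R"
  have "(x $ i * x' $ i + x $ j * x' $ j)\<^sup>2 + (x $ i * x' $ j - x $ j * x' $ i)\<^sup>2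
      = ((x $ i)\<^sup>2 + (x $ j)\<^sup>2) * ((x' $ i)\<^sup>2 + (x' $ j)\<^sup>2)"
    by (simp add: power2_eq_square algebra_simps)
  also have "\<dots> = R\<^sup>2" using sq by (simp add: R_def power2_eq_square)
  finally have 1: "c\<^sup>2 + s\<^sup>2 = 1"
    using R by (simp add: c_def s_def power_divide flip: add_divide_distrib)
  have "c * x $ i - s * x $ j = x' $ i" "s * x $ i + c * x $ j = x' $ j"
  proof -
    have "R * (c * x $ i - s * x $ j) = R * x' $ i"
      using R by (simp add: c_def s_def right_diff_distrib) (simp add: R_def power2_eq_square algebra_simps)
    then show "c * x $ i - s * x $ j = x' $ i" using R by simp
    have "R * (s * x $ i + c * x $ j) = R * x' $ j"
      using R by (simp add: c_def s_def distrib_left) (simp add: R_def power2_eq_square algebra_simps)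
    then show "s * x $ i + c * x $ j = x' $ j" using R by simp
  qed
  then have "x' = plane_rot i j c s *v x"
    unfolding vec_eq_iff plane_rot_apply[OF ij] using eq by auto
  then show ?thesis using that 1 by blast
qed

lemma continuous_on_if_const:
  "(P \<Longrightarrow> continuous_on S f) \<Longrightarrow> (\<not> P \<Longrightarrow> continuous_on S g) \<Longrightarrow> continuous_on S (\<lambda>x. if P then f x else g x)"
  by (cases P) auto

text \<open>
  The angle is the polar angle of \<open>(y $ j, y $ i)\<close> for a random \<open>y\<close>.  Rotating \<open>x\<close> in the plane amounts
  to rotating \<open>y\<close>, which does not change the distribution of \<open>y\<close>.
\<close>

lemma haar_on_plane:
  fixes i j :: "'n::finite"
  assumes ij: "i \<noteq> j"
  shows "haar_on {i, j} (plane_distribution i j (\<lambda>y. dir_cos (y $ j) (y $ i)) (\<lambda>y. dir_sin (y $ j) (y $ i)))"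
proof -
  let ?c = "\<lambda>y :: real^'n. dir_cos (y $ j) (y $ i)" and ?s = "\<lambda>y :: real^'n. dir_sin (y $ j) (y $ i)"
  have m [measurable]: "?c \<in> borel_measurable borel" "?s \<in> borel_measurable borel" by measurable
  note cs = dir_cos_sin
  let ?\<alpha> = "plane_distribution i j ?c ?s"
  let ?T = "\<lambda>y. plane_rot i j (?c y) (?s y)"
  have "AE U in ?\<alpha>. fixes_off {i, j} U"
    by (rule AE_plane_distribution[OF ij m cs fixes_off_measurable fixes_off_plane_rot[OF ij]])
  moreover have "invariant_on {i, j} (rot_mean ?\<alpha> \<phi>)" if \<phi>: "loc_bounded \<phi>" for \<phi>
    unfolding invariant_on_def
  proof (intro allI impI)
    fix x x' :: "real^'n"
    assume eq: "\<forall>k. k \<notin> {i, j} \<longrightarrow> x $ k = x' $ k" and sq: "sqnorm_on {i, j} x = sqnorm_on {i, j} x'"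
    obtain a b where ab: "a\<^sup>2 + b\<^sup>2 = 1" "x' = plane_rot i j a b *v x"
      by (rule plane_rot_between[OF ij, of x x']) (use eq sq ij in \<open>auto simp: sqnorm_on_def\<close>)
    let ?P = "plane_rot i j a (- b)"
    have P: "rotation_matrix ?P" using ab by (intro rotation_plane_rot[OF ij]) simp
    have TP: "?T y *v x' = ?T (?P *v y) *v x" if y: "y $ j \<noteq> 0" for y
    proof -
      let ?r = "(y $ j)\<^sup>2 + (y $ i)\<^sup>2"
      have r: "?r \<noteq> 0" using y by (simp add: sum_power2_eq_zero_iff)
      have Pj: "(?P *v y) $ j = a * y $ j - b * y $ i" and Pi: "(?P *v y) $ i = a * y $ i + b * y $ j"
        using ij by (auto simp: plane_rot_apply)
      have "((?P *v y) $ j)\<^sup>2 + ((?P *v y) $ i)\<^sup>2 = (a\<^sup>2 + b\<^sup>2) * ?r"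
        unfolding Pi Pj by (simp add: power2_eq_square algebra_simps)
      then have r': "((?P *v y) $ j)\<^sup>2 + ((?P *v y) $ i)\<^sup>2 = ?r" using ab by simp
      have "?c (?P *v y) = ?c y * a - ?s y * b" "?s (?P *v y) = ?s y * a + ?c y * b"
        unfolding dir_cos_def dir_sin_def r' if_not_P[OF r] unfolding Pi Pj
        by (simp_all add: diff_divide_distrib add_divide_distrib mult.commute)
      then show ?thesis
        unfolding ab(2) matrix_vector_mul_assoc plane_rot_compose[OF ij] by simp
    qed
    have meas: "(\<lambda>y. \<phi> (?T y *v z)) \<in> borel_measurable borel" for z
      by (intro measurable_rotate_loc_bounded[OF \<phi>]) measurable
    have "rot_mean ?\<alpha> \<phi> x' = (LINT y|ball_measure. \<phi> (?T y *v x'))"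
      by (rule rot_mean_plane[OF ij m cs \<phi>])
    also have "\<dots> = (LINT y|ball_measure. \<phi> (?T (?P *v y) *v x))"
    proof (rule integral_ball_measure_cong_AE[where k = j, OF meas])
      have "(\<lambda>y. ?P *v y) \<in> borel_measurable borel"
        by (intro borel_measurable_continuous_onI continuous_intros)
      from measurable_compose[OF this meas] show "(\<lambda>y. \<phi> (?T (?P *v y) *v x)) \<in> borel_measurable borel" .
      show "\<phi> (?T y *v x') = \<phi> (?T (?P *v y) *v x)" if "y $ j \<noteq> 0" for y
        unfolding TP[OF that] ..
    qed
    also have "\<dots> = (LINT y|ball_measure. \<phi> (?T y *v x))"
      by (rule integral_ball_measure_rotate[OF P meas])
    also have "\<dots> = rot_mean ?\<alpha> \<phi> x" by (rule rot_mean_plane[OF ij m cs \<phi>, symmetric])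
    finally show "rot_mean ?\<alpha> \<phi> x = rot_mean ?\<alpha> \<phi> x'" ..
  qed
  ultimately show ?thesis unfolding haar_on_def using rot_distribution_plane[OF ij m cs] by blast
qed

lemma integrable_rotations_directions:
  fixes \<psi> :: "real^'n::finite \<Rightarrow> complex" and f :: "real^'n \<Rightarrow> real^'n"
  assumes \<alpha>: "rot_distribution \<alpha>" and \<psi>: "loc_bounded \<psi>" "\<And>y. norm (\<psi> y) \<le> B" and f: "f \<in> borel_measurable borel"
  shows "integrable (\<alpha> \<Otimes>\<^sub>M ball_measure) (\<lambda>(U, y). \<psi> (U *v f y))"
proof -
  interpret \<alpha>: finite_measure \<alpha> by (rule rot_distribution_finite[OF \<alpha>])
  interpret \<gamma>: finite_measure "ball_measure :: (real^'n) measure" by (rule finite_ball_measure)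
  have "finite_measure (\<alpha> \<Otimes>\<^sub>M (ball_measure :: (real^'n) measure))"
    by (intro finite_measure_pair_measure \<alpha>.finite_measure_axioms \<gamma>.finite_measure_axioms)
  then interpret PP: finite_measure "\<alpha> \<Otimes>\<^sub>M (ball_measure :: (real^'n) measure)" .
  have 1: "fst \<in> borel_measurable (\<alpha> \<Otimes>\<^sub>M (ball_measure :: (real^'n) measure))"
    by (rule measurable_compose[OF measurable_fst measurable_ident_rot[OF \<alpha>]])
  have 2: "(\<lambda>p. f (snd p)) \<in> borel_measurable (\<alpha> \<Otimes>\<^sub>M (ball_measure :: (real^'n) measure))"
    by (rule measurable_compose[OF measurable_snd]) (use f in simp)
  show ?thesis
    using \<psi>(2) measurable_rotate_loc_bounded[OF \<psi>(1) 1 2]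
    by (intro PP.integrable_const_bound[of _ B]) (auto simp: split_beta)
qed

text \<open>
  The distribution of directions is invariant under each single rotation, hence under random ones.
\<close>

lemma integral_ball_measure_rot_mean:
  fixes \<psi> :: "real^'n::finite \<Rightarrow> complex"
  assumes \<alpha>: "rot_distribution \<alpha>" and \<psi>: "loc_bounded \<psi>" "\<And>y. norm (\<psi> y) \<le> B"
  shows "(LINT y|ball_measure. rot_mean \<alpha> \<psi> y) = (LINT y|ball_measure. \<psi> y)"
proof -
  interpret \<alpha>: finite_measure \<alpha> by (rule rot_distribution_finite[OF \<alpha>])
  interpret \<gamma>: finite_measure "ball_measure :: (real^'n) measure" by (rule finite_ball_measure)
  interpret P: pair_sigma_finite \<alpha> "ball_measure :: (real^'n) measure" ..
  have "(LINT y|ball_measure. rot_mean \<alpha> \<psi> y) = (LINT U|\<alpha>. (LINT y|ball_measure. \<psi> (U *v y)))"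
    unfolding rot_mean_def
    by (rule P.Fubini_integral) (use integrable_rotations_directions[OF \<alpha> \<psi>, of "\<lambda>y. y"] in simp)
  also have "\<dots> = (LINT U|\<alpha>. (LINT y|ball_measure. \<psi> y))"
    using \<psi>(1) by (intro Bochner_Integration.integral_cong refl integral_ball_measure_rotate)
      (auto simp: rot_distribution_space[OF \<alpha>] loc_bounded_def)
  also have "\<dots> = (LINT y|ball_measure. \<psi> y)"
    using rot_distribution_measure[OF \<alpha>] by simp
  finally show ?thesis .
qed

text \<open>
  Every rotation in the coordinates \<open>insert j S\<close> is a product of a rotation in \<open>S\<close>, a rotation in the
  plane of \<open>i\<close> and \<open>j\<close>, and another rotation in \<open>S\<close>; the angle in the middle has to have the
  distribution of the angle between the \<open>j\<close>-th axis and a random direction.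
  
  Let \<open>\<rho>\<close> be the length of the \<open>S\<close>-part.  The outer average makes \<open>\<phi>\<close> a function \<open>\<phi>\<^sub>1\<close> of the
  coordinates outside \<open>S\<close> and \<open>\<rho>\<close>.  On the points that agree with \<open>x\<close> outside \<open>insert j S\<close> and have
  the same total length \<open>R\<close> of the remaining part, \<open>\<phi>\<^sub>1\<close> thus depends on the \<open>j\<close>-th coordinate only.
  If \<open>U\<close> is the inner rotation, and \<open>y\<close> the random direction that determines the angle, then after
  rotation this coordinate is
  \<open>(x $ j * y $ j + \<rho> x * \<rho> y * U $ i $ i) / R y\<close>.  This is symmetric in \<open>x\<close> and \<open>y\<close>, so that \<open>U\<close> can be
  made to act on \<open>y\<close> instead of \<open>x\<close>, where it is absorbed by the invariance of the distribution of
  \<open>y\<close>.  There remains \<open>(x $ j * y $ j + \<rho> x * y $ i) / R y\<close>; a rotation of \<open>y\<close> in the plane of \<open>i\<close> and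
  \<open>j\<close> transforms this into \<open>R x * y $ j / R y\<close>, in which \<open>x\<close> enters only through \<open>R x\<close>.
\<close>

lemma haar_on_step:
  fixes i j :: "'n::finite"
  assumes \<alpha>: "haar_on S \<alpha>" and i: "i \<in> S" and j: "j \<notin> S"
  shows "haar_on (insert j S) (rot_convolution \<alpha> (rot_convolution
     (plane_distribution i j (\<lambda>y. dir_cos (y $ j) (sqrt (sqnorm_on S y))) (\<lambda>y. dir_sin (y $ j) (sqrt (sqnorm_on S y)))) \<alpha>))"
    (is "haar_on ?S' (rot_convolution \<alpha> (rot_convolution ?\<beta> \<alpha>))")
proof -
  have ij: "i \<noteq> j" using i j by blast
  let ?\<rho> = "\<lambda>y :: real^'n. sqrt (sqnorm_on S y)"
  let ?c = "\<lambda>y :: real^'n. dir_cos (y $ j) (?\<rho> y)" and ?s = "\<lambda>y :: real^'n. dir_sin (y $ j) (?\<rho> y)"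
  have m [measurable]: "?c \<in> borel_measurable borel" "?s \<in> borel_measurable borel" by measurable
  note cs = dir_cos_sin
  let ?T = "\<lambda>y. plane_rot i j (?c y) (?s y)"
  have r\<alpha>: "rot_distribution \<alpha>" and fix\<alpha>: "AE U in \<alpha>. fixes_off S U"
    and inv\<alpha>: "\<And>\<phi>. loc_bounded \<phi> \<Longrightarrow> invariant_on S (rot_mean \<alpha> \<phi>)"
    using \<alpha> unfolding haar_on_def by blast+
  have r\<beta>: "rot_distribution ?\<beta>" by (rule rot_distribution_plane[OF ij m cs])
  have r\<beta>\<alpha>: "rot_distribution (rot_convolution ?\<beta> \<alpha>)" by (rule rot_distribution_convolution[OF r\<beta> r\<alpha>])
  interpret \<alpha>: finite_measure \<alpha> by (rule rot_distribution_finite[OF r\<alpha>])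
  interpret \<gamma>: finite_measure "ball_measure :: (real^'n) measure" by (rule finite_ball_measure)
  interpret P: pair_sigma_finite \<alpha> "ball_measure :: (real^'n) measure" ..
  have rot\<alpha>: "AE U in \<alpha>. rotation_matrix U \<and> fixes_off S U"
    using fix\<alpha> AE_space[of \<alpha>] rot_distribution_space[OF r\<alpha>] by (auto elim: eventually_elim2)
  have S': "sqnorm_on ?S' z = (z $ j)\<^sup>2 + sqnorm_on S z" for z :: "real^'n"
    using j by (simp add: sqnorm_on_def)
  have "AE U in \<alpha>. fixes_off ?S' U"
    using fix\<alpha> by (auto elim!: eventually_mono intro: fixes_off_mono)
  moreover have "AE U in ?\<beta>. fixes_off ?S' U"
    by (rule AE_plane_distribution[OF ij m cs fixes_off_measurable])
       (rule fixes_off_mono[OF fixes_off_plane_rot[OF ij]], use i in auto)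
  ultimately have "AE U in rot_convolution \<alpha> (rot_convolution ?\<beta> \<alpha>). fixes_off ?S' U"
    by (intro AE_rot_convolution[OF r\<alpha> r\<beta>\<alpha>] AE_rot_convolution[OF r\<beta> r\<alpha>] fixes_off_measurable fixes_off_mult)
  moreover have "invariant_on ?S' (rot_mean (rot_convolution \<alpha> (rot_convolution ?\<beta> \<alpha>)) \<phi>)"
    if \<phi>: "loc_bounded \<phi>" for \<phi>
  proof -
    define \<phi>\<^sub>1 where "\<phi>\<^sub>1 = rot_mean \<alpha> \<phi>"
    have \<phi>1: "loc_bounded \<phi>\<^sub>1" unfolding \<phi>\<^sub>1_def by (rule loc_bounded_rot_mean[OF r\<alpha> \<phi>])
    have inv1: "invariant_on S \<phi>\<^sub>1" unfolding \<phi>\<^sub>1_def by (rule inv\<alpha>[OF \<phi>])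
    define \<phi>\<^sub>2 where "\<phi>\<^sub>2 = rot_mean ?\<beta> \<phi>\<^sub>1"
    have \<phi>2: "loc_bounded \<phi>\<^sub>2" unfolding \<phi>\<^sub>2_def by (rule loc_bounded_rot_mean[OF r\<beta> \<phi>1])
    have conv: "rot_mean (rot_convolution \<alpha> (rot_convolution ?\<beta> \<alpha>)) \<phi> x = rot_mean \<alpha> \<phi>\<^sub>2 x" for x
    proof -
      have "rot_mean (rot_convolution ?\<beta> \<alpha>) \<phi> = \<phi>\<^sub>2"
        unfolding \<phi>\<^sub>2_def \<phi>\<^sub>1_def by (rule ext) (rule rot_mean_convolution[OF r\<beta> r\<alpha> \<phi>])
      then show ?thesis by (simp only: rot_mean_convolution[OF r\<alpha> r\<beta>\<alpha> \<phi>])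
    qed
    \<comment> \<open>\<open>F x t\<close> is the value of \<open>\<phi>\<^sub>1\<close> at points with the invariants of \<open>x\<close> and \<open>j\<close>-th coordinate \<open>t\<close>.\<close>
    define V where "V x t = (\<chi> k. if k = j then t else if k = i then sqrt (sqnorm_on ?S' x - t\<^sup>2)
       else if k \<in> S then 0 else x $ k)" for x :: "real^'n" and t
    define F where "F x t = (if t\<^sup>2 \<le> sqnorm_on ?S' x then \<phi>\<^sub>1 (V x t) else 0)" for x :: "real^'n" and t
    have V_S: "sqnorm_on S (V x t) = sqnorm_on ?S' x - t\<^sup>2" if "t\<^sup>2 \<le> sqnorm_on ?S' x" for x t
    proof -
      have "sqnorm_on S (V x t) = (\<Sum>k\<in>S. if k = i then sqnorm_on ?S' x - t\<^sup>2 else 0)"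
        unfolding sqnorm_on_def[of S "V x t"] using that j by (intro sum.cong) (auto simp: V_def)
      then show ?thesis using i by simp
    qed
    have F: "\<phi>\<^sub>1 z = F x (z $ j)"
      if "\<And>k. k \<notin> ?S' \<Longrightarrow> z $ k = x $ k" "sqnorm_on ?S' z = sqnorm_on ?S' x" for z x
    proof -
      have le: "(z $ j)\<^sup>2 \<le> sqnorm_on ?S' x" using that(2) S'[of z] sqnorm_on_nonneg[of S z] by linarith
      have "\<phi>\<^sub>1 z = \<phi>\<^sub>1 (V x (z $ j))"
      proof -
        have "\<forall>k. k \<notin> S \<longrightarrow> z $ k = V x (z $ j) $ k" using that(1) i by (auto simp: V_def)
        moreover have "sqnorm_on S z = sqnorm_on S (V x (z $ j))"
          unfolding V_S[OF le] using S'[of z] that(2) by simp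
        ultimately show ?thesis using inv1 unfolding invariant_on_def by blast
      qed
      then show ?thesis using le by (simp add: F_def)
    qed
    have Fm [measurable]: "F x \<in> borel_measurable borel" for x
    proof -
      have "V x \<in> borel_measurable borel"
        unfolding V_def
        by (intro borel_measurable_continuous_onI continuous_on_vec_lambda continuous_on_if_const continuous_intros)
      from measurable_compose[OF this, of \<phi>\<^sub>1] have "(\<lambda>t. \<phi>\<^sub>1 (V x t)) \<in> borel_measurable borel"
        using \<phi>1 by (simp add: loc_bounded_def)
      then show ?thesis unfolding F_def by measurable
    qed
    have "\<exists>B. \<forall>t. norm (F x t) \<le> B" for x
    proof -
      obtain B where B: "\<And>z. z \<in> cball 0 (norm x) \<Longrightarrow> norm (\<phi>\<^sub>1 z) \<le> B"
        using \<phi>1 unfolding loc_bounded_def bounded_iff by blast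
      have "norm (V x t) \<le> norm x" if "t\<^sup>2 \<le> sqnorm_on ?S' x" for t
      proof -
        have split: "(norm z)\<^sup>2 = sqnorm_on ?S' z + sqnorm_on (- ?S') z" for z :: "real^'n"
          unfolding norm_vec_squares sqnorm_on_def
          by (metis Compl_eq_Diff_UNIV add.commute finite_code sum.subset_diff top_greatest)
        have "sqnorm_on (- ?S') (V x t) = sqnorm_on (- ?S') x"
          unfolding sqnorm_on_def using i by (intro sum.cong) (auto simp: V_def)
        moreover have "sqnorm_on ?S' (V x t) = sqnorm_on ?S' x"
          unfolding S'[of "V x t"] V_S[OF that] by (simp add: V_def)
        ultimately have "(norm (V x t))\<^sup>2 = (norm x)\<^sup>2" unfolding split by simp
        then show ?thesis by (simp add: power2_eq_iff_nonneg)
      qed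
      then have "norm (F x t) \<le> max B 0" for t
        unfolding F_def using B[of "V x t"] by (auto simp: max.coboundedI1)
      then show ?thesis by blast
    qed
    then obtain BF where BF: "\<And>x t. norm (F x t) \<le> BF x" by metis
    let ?r = "\<lambda>y. sqrt (sqnorm_on ?S' y)"
    have main: "rot_mean \<alpha> \<phi>\<^sub>2 x = (LINT y|ball_measure. F x (sqrt (sqnorm_on ?S' x) * y $ j / ?r y))" for x
    proof -
      define \<rho> where "\<rho> = ?\<rho> x"
      have \<rho>2: "\<rho>\<^sup>2 = sqnorm_on S x" by (simp add: \<rho>_def sqnorm_on_nonneg)
      \<comment> \<open>By invariance, \<open>x\<close> and \<open>y\<close> may be replaced by vectors whose \<open>S\<close>-part points in direction \<open>i\<close>.\<close>
      define rep where "rep y = (\<chi> k. if k = i then ?\<rho> y else if k \<in> S then 0 else y $ k)" for y :: "real^'n"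
      have rep_S: "sqnorm_on S (rep y) = sqnorm_on S y" for y
      proof -
        have "sqnorm_on S (rep y) = (\<Sum>k\<in>S. if k = i then sqnorm_on S y else 0)"
          unfolding sqnorm_on_def[of S "rep y"] by (intro sum.cong) (auto simp: rep_def sqnorm_on_nonneg)
        then show ?thesis using i by simp
      qed
      have rep_off: "rep y $ k = y $ k" if "k \<notin> S" for y k
        using that i by (auto simp: rep_def)
      have rep_inv: "\<psi> (rep y) = \<psi> y" if "invariant_on S \<psi>" for \<psi> y
        using that rep_S rep_off unfolding invariant_on_def by blast
      have U_i: "(U *v rep y) $ i = ?\<rho> y * U $ i $ i"
        if U: "rotation_matrix U" "fixes_off S U" for U y
      proof -
        have "rep y = ?\<rho> y *\<^sub>R axis i 1 + (\<Sum>k\<in>-S. y $ k *\<^sub>R axis k 1)"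
        proof -
          have "(\<Sum>k\<in>-S. y $ k *\<^sub>R axis k 1 :: real^'n) $ l = (if l \<in> S then 0 else y $ l)" for l
          proof -
            have "(\<Sum>k\<in>-S. y $ k *\<^sub>R axis k 1 :: real^'n) $ l = (\<Sum>k\<in>-S. if k = l then y $ l else 0)"
              unfolding sum_component by (intro sum.cong) (auto simp: axis_def)
            then show ?thesis by simp
          qed
          then show ?thesis unfolding vec_eq_iff using i by (auto simp: rep_def axis_def)
        qed
        then have "U *v rep y = ?\<rho> y *\<^sub>R (U *v axis i 1) + (\<Sum>k\<in>-S. y $ k *\<^sub>R (U *v axis k 1))"
          by (simp add: matrix_vector_right_distrib matrix_vector_mult_scaleR linear_sum[OF matrix_vector_mul_linear])
        also have "(\<Sum>k\<in>-S. y $ k *\<^sub>R (U *v axis k 1)) = (\<Sum>k\<in>-S. y $ k *\<^sub>R axis k 1)"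
          using U(2) by (intro sum.cong) (auto simp: fixes_off_def)
        finally have "(U *v rep y) $ i = ?\<rho> y * (U *v axis i 1) $ i + (\<Sum>k\<in>-S. y $ k *\<^sub>R axis k 1 :: real^'n) $ i" by simp
        moreover have "(\<Sum>k\<in>-S. y $ k *\<^sub>R axis k 1 :: real^'n) $ i = 0"
          unfolding sum_component using i by (intro sum.neutral) (auto simp: axis_def)
        ultimately show ?thesis by (simp add: matrix_vector_mult_basis column_def)
      qed
      \<comment> \<open>The quotient is the \<open>j\<close>-th coordinate after the rotation, once \<open>U\<close> has been moved to \<open>y\<close>; see \<open>step\<close>.\<close>
      define G where "G y = F x ((x $ j * y $ j + \<rho> * y $ i) / ?r y)" for y :: "real^'n"
      have Gm [measurable]: "G \<in> borel_measurable borel" unfolding G_def by measurable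
      have Glb: "loc_bounded G"
        unfolding loc_bounded_def bounded_iff using Gm BF by (auto simp: G_def)
      have step: "(LINT y|ball_measure. \<phi>\<^sub>1 (?T y *v (U *v rep x))) = (LINT y|ball_measure. G (U *v rep y))"
        if U: "rotation_matrix U" "fixes_off S U" for U
      proof (rule integral_ball_measure_cong_AE[where k = j])
        show "(\<lambda>y. \<phi>\<^sub>1 (?T y *v (U *v rep x))) \<in> borel_measurable borel"
          by (intro measurable_rotate_loc_bounded[OF \<phi>1]) measurable
        have "(\<lambda>y. U *v rep y) \<in> borel_measurable borel"
        proof -
          have "rep \<in> borel_measurable borel"
          proof -
            have "continuous_on UNIV rep"
              unfolding rep_def sqnorm_on_def
              by (intro continuous_on_vec_lambda continuous_on_if_const continuous_intros continuous_on_component)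
            then show ?thesis by (rule borel_measurable_continuous_onI)
          qed
          moreover have "(*v) U \<in> borel_measurable borel"
            by (intro borel_measurable_continuous_onI continuous_intros)
          ultimately show ?thesis by (rule measurable_compose)
        qed
        from measurable_compose[OF this Gm]
        show "(\<lambda>y. G (U *v rep y)) \<in> borel_measurable borel" .
        fix y :: "real^'n" assume y: "y $ j \<noteq> 0"
        have r: "(y $ j)\<^sup>2 + (?\<rho> y)\<^sup>2 = sqnorm_on ?S' y" by (simp add: S' sqnorm_on_nonneg)
        have r0: "sqnorm_on ?S' y \<noteq> 0"
          using y sqnorm_on_nonneg[of S y] unfolding S' by (metis add_nonneg_eq_0_iff power_eq_0_iff zero_le_power2)
        let ?z = "?T y *v (U *v rep x)"
        have zj: "?z $ j = (x $ j * y $ j + \<rho> * (?\<rho> y * U $ i $ i)) / ?r y"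
        proof -
          have "?z $ j = ?s y * (\<rho> * U $ i $ i) + ?c y * x $ j"
            using ij fixes_off_coord[OF U j, of "rep x"] rep_off[OF j] U_i[OF U, of x]
            by (simp add: plane_rot_apply \<rho>_def)
          then show ?thesis unfolding dir_cos_def dir_sin_def r using r0
            by (simp add: add_divide_distrib mult_ac)
        qed
        have "\<phi>\<^sub>1 ?z = F x (?z $ j)"
        proof (rule F)
          show "?z $ k = x $ k" if "k \<notin> ?S'" for k
            using that i fixes_off_coord[OF U, of k "rep x"] rep_off[of k x] by (auto simp: plane_rot_apply[OF ij])
          have "sqnorm_on ?S' ?z = sqnorm_on ?S' (U *v rep x)"
            unfolding sqnorm_on_def using i by (intro plane_rot_sum_squares[OF ij cs]) auto
          also have "\<dots> = sqnorm_on ?S' x"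
            unfolding S' fixes_off_sqnorm[OF U] rep_S using fixes_off_coord[OF U j] rep_off[OF j] by simp
          finally show "sqnorm_on ?S' ?z = sqnorm_on ?S' x" .
        qed
        also have "\<dots> = G (U *v rep y)"
        proof -
          have "sqnorm_on ?S' (U *v rep y) = sqnorm_on ?S' y"
            unfolding S' fixes_off_sqnorm[OF U] rep_S using fixes_off_coord[OF U j] rep_off[OF j] by simp
          then show ?thesis unfolding zj G_def
            using fixes_off_coord[OF U j, of "rep y"] rep_off[OF j] U_i[OF U, of y] by (simp add: mult.assoc)
        qed
        finally show "\<phi>\<^sub>1 ?z = G (U *v rep y)" .
      qed
      have GB: "norm (G y) \<le> BF x" for y using BF by (simp add: G_def)
      note int = integrable_rotations_directions[OF r\<alpha> Glb GB]
      have rep_m: "rep \<in> borel_measurable borel"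
        unfolding rep_def sqnorm_on_def
        by (intro borel_measurable_continuous_onI continuous_on_vec_lambda continuous_on_if_const
              continuous_intros continuous_on_component)
      have "rot_mean \<alpha> \<phi>\<^sub>2 x = rot_mean \<alpha> \<phi>\<^sub>2 (rep x)"
        by (rule rep_inv[OF inv\<alpha>[OF \<phi>2], symmetric])
      also have "\<dots> = (LINT U|\<alpha>. (LINT y|ball_measure. G (U *v rep y)))"
        unfolding rot_mean_def[of \<alpha>]
      proof (rule integral_cong_AE)
        show "(\<lambda>U. \<phi>\<^sub>2 (U *v rep x)) \<in> borel_measurable \<alpha>"
          by (intro measurable_rotate_loc_bounded[OF \<phi>2] measurable_ident_rot[OF r\<alpha>]) auto
        show "(\<lambda>U. LINT y|ball_measure. G (U *v rep y)) \<in> borel_measurable \<alpha>"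
          using int[OF rep_m] by (intro \<gamma>.borel_measurable_lebesgue_integral) (auto dest: borel_measurable_integrable)
        show "AE U in \<alpha>. \<phi>\<^sub>2 (U *v rep x) = (LINT y|ball_measure. G (U *v rep y))"
          using rot\<alpha>
        proof eventually_elim
          case (elim U)
          then show ?case
            unfolding \<phi>\<^sub>2_def rot_mean_plane[OF ij m cs \<phi>1] by (intro step) auto
        qed
      qed
      also have "\<dots> = (LINT y|ball_measure. (LINT U|\<alpha>. G (U *v rep y)))"
        by (rule P.Fubini_integral[OF int[OF rep_m], symmetric])
      also have "\<dots> = (LINT y|ball_measure. rot_mean \<alpha> G y)"
        using rep_inv[OF inv\<alpha>[OF Glb]] unfolding rot_mean_def by simp
      also have "\<dots> = (LINT y|ball_measure. G y)"
        by (rule integral_ball_measure_rot_mean[OF r\<alpha> Glb GB])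
      also have "\<dots> = (LINT y|ball_measure. F x (sqrt (sqnorm_on ?S' x) * y $ j / ?r y))"
      proof (cases "sqnorm_on ?S' x = 0")
        case True
        then have "(x $ j)\<^sup>2 = 0" "\<rho>\<^sup>2 = 0"
          using S'[of x] \<rho>2 sqnorm_on_nonneg[of S x] zero_le_power2[of "x $ j"] by linarith+
        then show ?thesis using True by (simp add: G_def)
      next
        case False
        define R where "R = sqrt (sqnorm_on ?S' x)"
        have R: "R > 0" "R\<^sup>2 = (x $ j)\<^sup>2 + \<rho>\<^sup>2"
        proof -
          have "sqnorm_on ?S' x > 0" using False sqnorm_on_nonneg[of ?S' x] by simp
          then show "R > 0" "R\<^sup>2 = (x $ j)\<^sup>2 + \<rho>\<^sup>2" by (simp_all add: R_def \<rho>2 flip: S')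
        qed
        \<comment> \<open>The rotation that takes \<open>(x $ j, \<rho>)\<close>, in the coordinates \<open>j\<close> and \<open>i\<close>, to \<open>(R, 0)\<close>.\<close>
        let ?Q = "plane_rot i j (x $ j / R) (\<rho> / R)"
        have q: "(x $ j / R)\<^sup>2 + (\<rho> / R)\<^sup>2 = 1"
          unfolding power_divide add_divide_distrib[symmetric] R(2)[symmetric] using R(1) by simp
        have "G y = F x (R * (?Q *v y) $ j / ?r (?Q *v y))" for y
        proof -
          have "sqnorm_on ?S' (?Q *v y) = sqnorm_on ?S' y"
            unfolding sqnorm_on_def using i by (intro plane_rot_sum_squares[OF ij q]) auto
          moreover have "R * (?Q *v y) $ j = x $ j * y $ j + \<rho> * y $ i"
            using ij R by (simp add: plane_rot_apply distrib_left)
          ultimately show ?thesis by (simp add: G_def)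
        qed
        then have "(LINT y|ball_measure. G y) = (LINT y|ball_measure. F x (R * (?Q *v y) $ j / ?r (?Q *v y)))" by simp
        also have "\<dots> = (LINT y|ball_measure. F x (R * y $ j / ?r y))"
          by (rule integral_ball_measure_rotate[OF rotation_plane_rot[OF ij q]]) measurable
        finally show ?thesis by (simp add: R_def)
      qed
      finally show ?thesis .
    qed
    show ?thesis
      unfolding invariant_on_def
    proof (intro allI impI)
      fix x x' :: "real^'n"
      assume eq: "\<forall>k. k \<notin> ?S' \<longrightarrow> x $ k = x' $ k" and sq: "sqnorm_on ?S' x = sqnorm_on ?S' x'"
      have "V x t = V x' t" for t using eq sq by (auto simp: V_def vec_eq_iff)
      then have V: "V x = V x'" by (rule ext)
      have "F x = F x'" unfolding F_def sq V ..
      then show "rot_mean (rot_convolution \<alpha> (rot_convolution ?\<beta> \<alpha>)) \<phi> x = rot_mean (rot_convolution \<alpha> (rot_convolution ?\<beta> \<alpha>)) \<phi> x'"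
        unfolding conv main using sq by simp
    qed
  qed
  ultimately show ?thesis
    unfolding haar_on_def using rot_distribution_convolution[OF r\<alpha> r\<beta>\<alpha>] by blast
qed

text \<open>
  Induction on the set of coordinates.  The predicate \<open>good\<close> records whatever is inherited from averages
  over plane rotations by their convolutions; this is all that is used of the construction.
\<close>

theorem haar_on_exists:
  fixes good :: "(real^'n^'n::finite) measure \<Rightarrow> bool"
  assumes n: "CARD('n) \<ge> 2"
    and plane: "\<And>i j c s. i \<noteq> j \<Longrightarrow> c \<in> borel_measurable borel \<Longrightarrow> s \<in> borel_measurable borel \<Longrightarrow>
       (\<And>y. (c y)\<^sup>2 + (s y)\<^sup>2 = 1) \<Longrightarrow> good (plane_distribution i j c s)"
    and conv: "\<And>\<alpha> \<beta>. rot_distribution \<alpha> \<Longrightarrow> rot_distribution \<beta> \<Longrightarrow> good \<alpha> \<Longrightarrow> good \<beta> \<Longrightarrow> good (rot_convolution \<alpha> \<beta>)"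
  shows "\<exists>\<alpha>. haar_on UNIV \<alpha> \<and> good \<alpha>"
proof -
  have "card S \<ge> 2 \<longrightarrow> (\<exists>\<alpha>. haar_on S \<alpha> \<and> good \<alpha>)" for S :: "'n set"
  proof (induction S rule: finite_induct[OF finite])
    case (2 j S)
    show ?case
    proof
      assume card: "2 \<le> card (insert j S)"
      show "\<exists>\<alpha>. haar_on (insert j S) \<alpha> \<and> good \<alpha>"
      proof (cases "card S \<ge> 2")
        case True
        then obtain \<alpha> where \<alpha>: "haar_on S \<alpha>" "good \<alpha>" using 2 by blast
        then have r\<alpha>: "rot_distribution \<alpha>" by (simp add: haar_on_def)
        obtain i where i: "i \<in> S" using True by (metis all_not_in_conv card.empty not_numeral_le_zero)
        have ij: "i \<noteq> j" using i 2 by blast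
        let ?c = "\<lambda>y :: real^'n. dir_cos (y $ j) (sqrt (sqnorm_on S y))"
        let ?s = "\<lambda>y :: real^'n. dir_sin (y $ j) (sqrt (sqnorm_on S y))"
        have m: "?c \<in> borel_measurable borel" "?s \<in> borel_measurable borel" by measurable
        have r\<beta>: "rot_distribution (plane_distribution i j ?c ?s)"
          by (rule rot_distribution_plane[OF ij m dir_cos_sin])
        have "good (rot_convolution \<alpha> (rot_convolution (plane_distribution i j ?c ?s) \<alpha>))"
          by (intro conv rot_distribution_convolution r\<alpha> r\<beta> \<alpha>(2) plane ij m dir_cos_sin)
        then show ?thesis using haar_on_step[OF \<alpha>(1) i 2(2)] by blast
      next
        case False
        then have "card S = 1" using card 2 by simp
        then obtain i where S: "S = {i}" by (auto simp: card_1_singleton_iff)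
        have ij: "i \<noteq> j" using 2 S by blast
        have m: "(\<lambda>y :: real^'n. dir_cos (y $ j) (y $ i)) \<in> borel_measurable borel"
          "(\<lambda>y :: real^'n. dir_sin (y $ j) (y $ i)) \<in> borel_measurable borel" by measurable
        show ?thesis
          using haar_on_plane[OF ij] plane[OF ij m dir_cos_sin] S by (auto simp: insert_commute)
      qed
    qed
  qed simp
  then show ?thesis using n by blast
qed

section \<open>The spherical mean as an average over rotations\<close>

lemma sphere_measure_eq:
  "(sphere_measure :: (real^'n) measure) = density (distr ball_measure borel sgn)
     (\<lambda>_. of_nat CARD('n) * emeasure lborel (ball (0::real^'n) 1))"
proof (rule measure_eqI)
  fix A assume "A \<in> sets (sphere_measure :: (real^'n) measure)"
  then have A [measurable]: "A \<in> sets borel" by (simp add: sphere_measure_def)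
  have sgn [measurable]: "(sgn :: real^'n \<Rightarrow> real^'n) \<in> borel_measurable borel"
    unfolding sgn_div_norm[abs_def] by measurable
  have sA: "sgn -` A \<in> sets (borel :: (real^'n) measure)" using measurable_sets[OF sgn A] by simp
  let ?b = "emeasure lborel (ball (0::real^'n) 1)"
  have m: "sgn \<in> borel_measurable (restrict_space lborel (ball (0::real^'n) 1))"
    by (rule measurable_restrict_space1) simp
  have "emeasure (sphere_measure :: (real^'n) measure) A = of_nat CARD('n) * emeasure lborel (ball 0 1 \<inter> sgn -` A)"
    unfolding sphere_measure_def using A
    by (simp add: emeasure_distr[OF m] emeasure_restrict_space space_restrict_space Int_commute)
  also have "\<dots> = of_nat CARD('n) * (emeasure lborel (ball 0 1 \<inter> sgn -` A) / ?b * ?b)"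
    using emeasure_unit_ball[where 'a = "real^'n"] by (simp add: ennreal_divide_times less_top[symmetric])
  also have "\<dots> = of_nat CARD('n) * ?b * (emeasure lborel (ball 0 1 \<inter> sgn -` A) / ?b)"
    by (simp only: mult_ac)
  also have "emeasure lborel (ball 0 1 \<inter> sgn -` A) / ?b = emeasure (distr ball_measure borel sgn) A"
    using sA by (subst emeasure_distr) (auto simp: ball_measure_def)
  also have "of_nat CARD('n) * ?b * \<dots> = emeasure (density (distr ball_measure borel sgn) (\<lambda>_. of_nat CARD('n) * ?b)) A"
    using A by (subst emeasure_density_const) auto
  finally show "emeasure (sphere_measure :: (real^'n) measure) A = \<dots>" .
qed (simp add: sphere_measure_def)

text \<open>
  Surface measure is a multiple of the distribution of the direction of a random point of the ball.
\<close>

lemma fun_spherical_mean_eq: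
  fixes \<phi> :: "real^'n::finite \<Rightarrow> complex"
  assumes \<phi>: "\<phi> \<in> borel_measurable borel"
  shows "fun_spherical_mean \<phi> x = (LINT y|ball_measure. \<phi> (norm x *\<^sub>R sgn y))"
proof -
  define c where "c = enn2real (of_nat CARD('n) * emeasure lborel (ball (0::real^'n) 1))"
  have fin: "of_nat CARD('n) * emeasure lborel (ball (0::real^'n) 1) \<noteq> top"
    using emeasure_unit_ball[where 'a = "real^'n"] by (simp add: ennreal_mult_eq_top_iff)
  then have ec: "of_nat CARD('n) * emeasure lborel (ball (0::real^'n) 1) = ennreal c"
    unfolding c_def by (simp add: less_top[symmetric])
  have "of_nat CARD('n) * emeasure lborel (ball (0::real^'n) 1) \<noteq> 0"
    using emeasure_unit_ball[where 'a = "real^'n"] by simp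
  then have c: "c > 0" using fin unfolding c_def by (simp add: enn2real_positive_iff less_top[symmetric] zero_less_iff_neq_zero)
  have sgn [measurable]: "(sgn :: real^'n \<Rightarrow> real^'n) \<in> borel_measurable borel"
    unfolding sgn_div_norm[abs_def] by measurable
  have m [measurable]: "(\<lambda>w. \<phi> (norm x *\<^sub>R w)) \<in> borel_measurable borel"
    using \<phi> by (intro measurable_compose[OF _ \<phi>]) measurable
  have sm: "(sphere_measure :: (real^'n) measure) = density (distr ball_measure borel sgn) (\<lambda>_. ennreal c)"
    unfolding sphere_measure_eq ec ..
  have "(LINT w|sphere_measure. \<phi> (norm x *\<^sub>R w)) = (LINT w|distr ball_measure borel sgn. c *\<^sub>R \<phi> (norm x *\<^sub>R w))"
    unfolding sm by (rule integral_density) (use c in auto)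
  also have "\<dots> = c *\<^sub>R (LINT w|distr ball_measure borel sgn. \<phi> (norm x *\<^sub>R w))" by simp
  also have "(LINT w|distr ball_measure borel sgn. \<phi> (norm x *\<^sub>R w)) = (LINT y|ball_measure. \<phi> (norm x *\<^sub>R sgn y))"
    by (rule integral_distr) auto
  finally have I: "(LINT w|sphere_measure. \<phi> (norm x *\<^sub>R w)) = c *\<^sub>R (LINT y|ball_measure. \<phi> (norm x *\<^sub>R sgn y))" .
  have "emeasure (sphere_measure :: (real^'n) measure) UNIV = ennreal c * emeasure (distr ball_measure borel (sgn :: real^'n \<Rightarrow> real^'n)) UNIV"
    unfolding sm by (subst emeasure_density_const) auto
  also have "emeasure (distr ball_measure borel (sgn :: real^'n \<Rightarrow> real^'n)) UNIV = 1"
    by (subst emeasure_distr) (auto simp: emeasure_ball_measure_UNIV)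
  finally have "measure (sphere_measure :: (real^'n) measure) UNIV = c"
    using c by (simp add: measure_def)
  then show ?thesis unfolding fun_spherical_mean_def I using c by simp
qed

lemma sgn_rotate:
  fixes U :: "real^'n^'n"
  assumes "rotation_matrix U"
  shows "sgn (U *v y) = U *v sgn y"
  by (simp add: sgn_div_norm rotation_matrix_norm[OF assms] matrix_vector_mult_scaleR)

lemma loc_bounded_continuous: "continuous_on UNIV \<phi> \<Longrightarrow> loc_bounded (\<phi> :: real^'n::finite \<Rightarrow> complex)"
  unfolding loc_bounded_def
  by (intro conjI allI compact_imp_bounded compact_continuous_image compact_cball)
     (auto intro: borel_measurable_continuous_onI continuous_on_subset)

lemma measurable_sphere_projection:
  fixes \<phi> :: "real^'n::finite \<Rightarrow> complex"
  assumes "\<phi> \<in> borel_measurable borel"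
  shows "(\<lambda>y. \<phi> (r *\<^sub>R sgn y)) \<in> borel_measurable borel"
proof -
  have sgn [measurable]: "(sgn :: real^'n \<Rightarrow> real^'n) \<in> borel_measurable borel"
    unfolding sgn_div_norm[abs_def] by measurable
  show ?thesis by (rule measurable_compose[OF _ assms]) measurable
qed

lemma fun_spherical_mean_rotate:
  fixes \<phi> :: "real^'n::finite \<Rightarrow> complex"
  assumes \<phi>: "\<phi> \<in> borel_measurable borel" and U: "rotation_matrix U"
  shows "fun_spherical_mean (\<lambda>x. \<phi> (U *v x)) = fun_spherical_mean \<phi>"
proof
  fix x
  have "(\<lambda>x. \<phi> (U *v x)) \<in> borel_measurable borel"
    by (rule measurable_compose[OF _ \<phi>]) (intro borel_measurable_continuous_onI continuous_intros)
  then have "fun_spherical_mean (\<lambda>x. \<phi> (U *v x)) x = (LINT y|ball_measure. \<phi> (norm x *\<^sub>R sgn (U *v y)))"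
    by (simp add: fun_spherical_mean_eq sgn_rotate[OF U] matrix_vector_mult_scaleR)
  also have "\<dots> = (LINT y|ball_measure. \<phi> (norm x *\<^sub>R sgn y))"
    by (rule integral_ball_measure_rotate[OF U measurable_sphere_projection[OF \<phi>]])
  finally show "fun_spherical_mean (\<lambda>x. \<phi> (U *v x)) x = fun_spherical_mean \<phi> x"
    by (simp add: fun_spherical_mean_eq[OF \<phi>])
qed

text \<open>
  Uniqueness of the invariant average.  Averaging \<open>\<phi>\<close> over directions does not change if one averages
  over rotations first; and the average over rotations is constant on spheres, so that the average over
  directions has no effect on it.
\<close>

lemma fun_spherical_mean_eq_rot_mean:
  fixes \<phi> :: "real^'n::finite \<Rightarrow> complex"
  assumes \<alpha>: "haar_on UNIV \<alpha>" and \<phi>: "loc_bounded \<phi>"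
  shows "fun_spherical_mean \<phi> x = rot_mean \<alpha> \<phi> x"
proof -
  have r\<alpha>: "rot_distribution \<alpha>" and inv: "invariant_on UNIV (rot_mean \<alpha> \<phi>)"
    using \<alpha> \<phi> unfolding haar_on_def by auto
  have \<phi>m: "\<phi> \<in> borel_measurable borel" using \<phi> by (simp add: loc_bounded_def)
  define \<psi> where "\<psi> y = \<phi> (norm x *\<^sub>R sgn y)" for y
  obtain B where B: "\<And>z. z \<in> cball 0 (norm x) \<Longrightarrow> norm (\<phi> z) \<le> B"
    using \<phi> unfolding loc_bounded_def bounded_iff by blast
  have \<psi>B: "norm (\<psi> y) \<le> B" for y
    unfolding \<psi>_def by (rule B) (simp add: norm_sgn)
  have \<psi>m: "\<psi> \<in> borel_measurable borel"
    unfolding \<psi>_def by (rule measurable_sphere_projection[OF \<phi>m])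
  have \<psi>: "loc_bounded \<psi>" using \<psi>m \<psi>B unfolding loc_bounded_def bounded_iff by blast
  have radial: "rot_mean \<alpha> \<phi> (norm x *\<^sub>R sgn y) = rot_mean \<alpha> \<phi> x" if "y \<noteq> 0" for y
  proof -
    have "sqnorm_on UNIV (norm x *\<^sub>R sgn y) = sqnorm_on UNIV x"
      unfolding sqnorm_on_def norm_vec_squares[symmetric] using that by (simp add: norm_sgn)
    then show ?thesis using inv unfolding invariant_on_def by blast
  qed
  have "fun_spherical_mean \<phi> x = (LINT y|ball_measure. \<psi> y)"
    by (simp add: fun_spherical_mean_eq[OF \<phi>m] \<psi>_def)
  also have "\<dots> = (LINT y|ball_measure. rot_mean \<alpha> \<psi> y)"
    by (rule integral_ball_measure_rot_mean[OF r\<alpha> \<psi> \<psi>B, symmetric])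
  also have "\<dots> = (LINT y|ball_measure. rot_mean \<alpha> \<phi> (norm x *\<^sub>R sgn y))"
    unfolding rot_mean_def \<psi>_def
    by (intro Bochner_Integration.integral_cong refl)
       (auto simp: rot_distribution_space[OF r\<alpha>] sgn_rotate matrix_vector_mult_scaleR intro!: Bochner_Integration.integral_cong)
  also have "\<dots> = (LINT y|(ball_measure :: (real^'n) measure). rot_mean \<alpha> \<phi> x)"
  proof (rule integral_ball_measure_cong_AE)
    have "rot_mean \<alpha> \<phi> \<in> borel_measurable borel"
      using loc_bounded_rot_mean[OF r\<alpha> \<phi>] by (simp add: loc_bounded_def)
    then show "(\<lambda>y. rot_mean \<alpha> \<phi> (norm x *\<^sub>R sgn y)) \<in> borel_measurable borel"
      by (rule measurable_sphere_projection)
    \<comment> \<open>Any coordinate will do to ensure that \<open>y\<close> is not the origin.\<close>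
    show "rot_mean \<alpha> \<phi> (norm x *\<^sub>R sgn y) = rot_mean \<alpha> \<phi> x" if "y $ undefined \<noteq> 0" for y :: "real^'n"
      by (rule radial) (use that in auto)
  qed simp
  also have "\<dots> = rot_mean \<alpha> \<phi> x"
    by (simp add: measure_def emeasure_ball_measure_UNIV)
  finally show ?thesis .
qed

section \<open>Circle averages are cohomologous to the identity\<close>

lemma matrix_inv_rotation:
  fixes U :: "real^'n^'n"
  assumes "rotation_matrix U"
  shows "matrix_inv U = transpose U"
proof -
  have 1: "U ** transpose U = mat 1" "transpose U ** U = mat 1"
    using assms by (auto simp: rotation_matrix_def orthogonal_matrix_def)
  have "matrix_inv U = matrix_inv U ** (U ** transpose U)" by (simp add: 1)
  also have "\<dots> = (matrix_inv U ** U) ** transpose U" by (simp only: matrix_mul_assoc)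
  also have "matrix_inv U ** U = mat 1"
    using 1 unfolding matrix_inv_def by (metis (mono_tags, lifting) someI_ex)
  finally show ?thesis by simp
qed

lemma dual_rotate_eq: "dual_rotate r M U g = dual_op r M (\<lambda>\<phi> x. \<phi> (matrix_inv U *v x)) g"
  by (simp add: dual_rotate_def dual_op_def)

lemma tame_op_rotate:
  fixes U :: "real^'n^'n"
  assumes U: "rotation_matrix U" and M: "\<And>p. M p > 0"
  shows "tame_op M (\<lambda>\<phi> x. \<phi> (U *v x))"
proof -
  have "rotation_family (ball_measure :: (real^'n) measure) (\<lambda>_. U)"
    using U finite_ball_measure by (simp add: rotation_family_def)
  moreover have "bounded_weight (ball_measure :: (real^'n) measure) (\<lambda>_. 1) 1"
    by (simp add: bounded_weight_def)
  ultimately have "tame_op M (rot_avg (ball_measure :: (real^'n) measure) (\<lambda>_. 1) (\<lambda>_. U))"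
    by (rule tame_op_rot_avg) (use M in auto)
  moreover have "rot_avg (ball_measure :: (real^'n) measure) (\<lambda>_. 1) (\<lambda>_. U) = (\<lambda>\<phi> x. \<phi> (U *v x))"
    by (intro ext) (simp add: rot_avg_def measure_def emeasure_ball_measure_UNIV)
  ultimately show ?thesis by simp
qed

text \<open>
  The vector field that generates the rotations of the plane of \<open>i\<close> and \<open>j\<close>.
\<close>

definition rot_field :: "'n \<Rightarrow> 'n \<Rightarrow> (real^'n::finite \<Rightarrow> complex) \<Rightarrow> real^'n \<Rightarrow> complex" where
  "rot_field i j \<phi> x = of_real (x $ i) * pderiv_dir j \<phi> x - of_real (x $ j) * pderiv_dir i \<phi> x"

lemma tame_op_rot_field:
  assumes M: "\<And>p. M p > 0" and M1: "cond_M1 M" and M2: "cond_M2' M"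
  shows "tame_op M (rot_field i j)"
  unfolding rot_field_def[abs_def]
  by (intro tame_op_diff tame_op_compose[OF tame_op_coord_mult tame_op_pderiv_dir] M M1 M2)

lemma rot_field_derivative:
  assumes ij: "i \<noteq> j" and \<phi>: "smooth_on UNIV \<phi>"
  shows "((\<lambda>t. \<phi> (plane_rot i j (cos t) (sin t) *v x)) has_vector_derivative
     rot_field i j \<phi> (plane_rot i j (cos t) (sin t) *v x)) (at t)"
proof -
  let ?R = "\<lambda>t. plane_rot i j (cos t) (sin t) *v x"
  let ?D = "\<lambda>t. (\<chi> k. if k = i then - (?R t $ j) else if k = j then ?R t $ i else 0)"
  have comp: "((\<lambda>t. ?R t $ k) has_vector_derivative ?D t $ k) (at t)" for k
    using ij by (auto simp: plane_rot_apply has_real_derivative_iff_has_vector_derivative[symmetric]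
        intro!: derivative_eq_intros)
  have "(?R has_vector_derivative ?D t) (at t)"
    unfolding has_vector_derivative_def has_derivative_componentwise_within[of ?R]
  proof
    fix b :: "real^'a" assume "b \<in> Basis"
    then obtain k where b: "b = axis k 1" by (auto simp: Basis_vec_def)
    show "((\<lambda>t. ?R t \<bullet> b) has_derivative (\<lambda>h. (h *\<^sub>R ?D t) \<bullet> b)) (at t)"
      using comp[of k] unfolding b inner_axis has_vector_derivative_def by (simp add: inner_axis)
  qed
  moreover have "(\<phi> has_derivative (\<lambda>h. \<Sum>k\<in>UNIV. of_real (h $ k) * pderiv_dir k \<phi> (?R t))) (at (?R t))"
    by (rule has_derivative_pderiv_dir[OF smooth_on_differentiable[OF \<phi>]]) simp
  ultimately have "((\<lambda>t. \<phi> (?R t)) has_derivative (\<lambda>h. \<Sum>k\<in>UNIV. of_real ((h *\<^sub>R ?D t) $ k) * pderiv_dir k \<phi> (?R t))) (at t)"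
    unfolding has_vector_derivative_def by (rule has_derivative_compose)
  moreover have "(\<Sum>k\<in>UNIV. of_real ((h *\<^sub>R ?D t) $ k) * pderiv_dir k \<phi> (?R t)) = h *\<^sub>R rot_field i j \<phi> (?R t)" for h
  proof -
    have "of_real ((h *\<^sub>R ?D t) $ k) * pderiv_dir k \<phi> (?R t) =
       (if k = i then of_real (- h * ?R t $ j) * pderiv_dir i \<phi> (?R t) else 0) +
       (if k = j then of_real (h * ?R t $ i) * pderiv_dir j \<phi> (?R t) else 0)" for k
      using ij by auto
    then show ?thesis by (simp add: sum.distrib rot_field_def scaleR_conv_of_real algebra_simps)
  qed
  ultimately show ?thesis unfolding has_vector_derivative_def by (simp only:)
qed

abbreviation circle_rot :: "'n::finite \<Rightarrow> 'n \<Rightarrow> real \<Rightarrow> real^'n^'n" where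
  "circle_rot i j t \<equiv> plane_rot i j (cos t) (sin t)"

lemma circle_rot_add: "i \<noteq> j \<Longrightarrow> circle_rot i j s *v (circle_rot i j t *v x) = circle_rot i j (s + t) *v x"
  by (simp add: matrix_vector_mul_assoc plane_rot_compose cos_add sin_add algebra_simps)

text \<open>
  The solution \<open>G\<close> of the cohomological equation, on all orbits of the circle at once; along an orbit the
  vector field is the derivative with respect to the angle.
\<close>

definition circle_solution :: "'n \<Rightarrow> 'n \<Rightarrow> (real^'n::finite \<Rightarrow> complex) \<Rightarrow> real^'n \<Rightarrow> complex" where
  "circle_solution i j \<phi> = rot_avg (restrict_space lborel {-pi..pi}) coboundary_kernel (circle_rot i j)
     (rot_field i j (rot_field i j (rot_field i j \<phi>)))"

lemma rotation_family_circle: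
  fixes i j :: "'n::finite"
  assumes ij: "i \<noteq> j"
  shows "rotation_family (restrict_space lborel {-pi..pi}) (circle_rot i j)"
  unfolding rotation_family_def
proof (intro conjI ballI)
  show "finite_measure (restrict_space lborel {-pi..pi})"
    by (rule finite_measureI) (simp add: emeasure_restrict_space space_restrict_space)
  have "(cos :: real \<Rightarrow> real) \<in> borel_measurable borel" "(sin :: real \<Rightarrow> real) \<in> borel_measurable borel"
    by (auto intro!: borel_measurable_continuous_onI continuous_intros)
  then have "(cos :: real \<Rightarrow> real) \<in> borel_measurable (restrict_space lborel {-pi..pi})"
      "(sin :: real \<Rightarrow> real) \<in> borel_measurable (restrict_space lborel {-pi..pi})"
    by (auto intro!: measurable_restrict_space1)
  then show "circle_rot i j \<in> borel_measurable (restrict_space lborel {-pi..pi})"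
    by (rule measurable_plane_rot)
  show "rotation_matrix (circle_rot i j t)" for t by (rule rotation_plane_rot[OF ij]) simp
qed

lemma bounded_weight_coboundary_kernel:
  obtains c where "c \<ge> 0" "bounded_weight (restrict_space lborel {-pi..pi}) coboundary_kernel c"
proof -
  have "bounded (coboundary_kernel ` {-pi..pi})"
    by (intro compact_imp_bounded compact_continuous_image continuous_coboundary_kernel) auto
  then obtain c where c: "\<And>t. t \<in> {-pi..pi} \<Longrightarrow> norm (coboundary_kernel t) \<le> c"
    unfolding bounded_iff by blast
  have "coboundary_kernel \<in> borel_measurable (restrict_space lborel {-pi..pi})"
    by (intro measurable_restrict_space1) (simp add: borel_measurable_continuous_onI continuous_coboundary_kernel)
  then show ?thesis using c
    by (intro that[of "max c 0"]) (auto simp: bounded_weight_def space_restrict_space max.coboundedI1)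
qed

lemma tame_op_circle_solution:
  fixes i j :: "'n::finite"
  assumes ij: "i \<noteq> j" and M: "\<And>p. M p > 0" "cond_M1 M" "cond_M2' M"
  shows "tame_op M (circle_solution i j)"
proof -
  obtain c where c: "c \<ge> 0" "bounded_weight (restrict_space lborel {-pi..pi}) coboundary_kernel c"
    by (rule bounded_weight_coboundary_kernel)
  have L: "tame_op M (rot_field i j)" by (rule tame_op_rot_field[where M = M, OF M])
  have H: "tame_op M (rot_avg (restrict_space lborel {-pi..pi}) coboundary_kernel (circle_rot i j))"
    by (rule tame_op_rot_avg[OF rotation_family_circle[OF ij] c(2,1) M(1)])
  show ?thesis
    unfolding circle_solution_def[abs_def]
    by (rule tame_op_compose[OF H tame_op_compose[OF L tame_op_compose[OF L L]]])
qed

lemma smooth_on_rot_field: "smooth_on UNIV \<phi> \<Longrightarrow> smooth_on UNIV (rot_field i j \<phi>)"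
  unfolding rot_field_def by (intro smooth_on_diff smooth_on_coord_mult smooth_on_pderiv_dir open_UNIV)

text \<open>
  The constant \<open>m\<close> is the mean of \<open>\<phi>\<close> over the orbit of \<open>x\<close>.  It is given up here, because all that
  matters is that it is the same for all points of the orbit.
\<close>

lemma circle_solution_equation:
  fixes i j :: "'n::finite" and \<phi> :: "real^'n \<Rightarrow> complex"
  assumes ij: "i \<noteq> j" and \<phi>: "smooth_on UNIV \<phi>"
  obtains m where "\<And>\<tau>. \<phi> (circle_rot i j \<tau> *v x) - m = circle_solution i j \<phi> (circle_rot i j \<tau> *v x)
     - circle_solution i j \<phi> (circle_rot i j (diophantine_angle + \<tau>) *v x)"
proof -
  let ?L = "rot_field i j" and ?R = "circle_rot i j"
  let ?\<phi>3 = "?L (?L (?L \<phi>))"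
  have s1: "smooth_on UNIV (?L \<phi>)" and s2: "smooth_on UNIV (?L (?L \<phi>))" and s3: "smooth_on UNIV ?\<phi>3"
    using \<phi> by (intro smooth_on_rot_field; assumption?)+
  have contR: "continuous_on UNIV (\<lambda>t. ?R t *v x)"
  proof -
    have "continuous_on UNIV (\<lambda>t. (?R t *v x) $ k)" for k
      unfolding plane_rot_apply[OF ij] by (intro continuous_on_if_const continuous_intros)
    then have "continuous_on UNIV (\<lambda>t. \<chi> k. (?R t *v x) $ k)" by (intro continuous_on_vec_lambda)
    then show ?thesis by simp
  qed
  have c3: "continuous_on UNIV (\<lambda>t. ?\<phi>3 (?R t *v x))"
    using continuous_on_compose2[OF smooth_on_continuous_on[OF s3] contR] by simp
  have c3': "continuous_on S (\<lambda>t. ?\<phi>3 (?R (t + \<tau>) *v x))" for S \<tau>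
    by (rule continuous_on_compose2[OF c3, of S "\<lambda>t. t + \<tau>"]) (auto intro!: continuous_intros)
  have sol: "circle_solution i j \<phi> (?R \<tau> *v x) = integral {-pi..pi} (\<lambda>t. coboundary_kernel t * ?\<phi>3 (?R (t + \<tau>) *v x))" for \<tau>
  proof -
    have cont: "continuous_on {-pi..pi} (\<lambda>t. coboundary_kernel t * ?\<phi>3 (?R (t + \<tau>) *v x))"
      by (intro continuous_intros continuous_coboundary_kernel c3')
    have "circle_solution i j \<phi> (?R \<tau> *v x) = (LINT t|restrict_space lborel {-pi..pi}. coboundary_kernel t * ?\<phi>3 (?R (t + \<tau>) *v x))"
      unfolding circle_solution_def rot_avg_def circle_rot_add[OF ij] ..
    also have "\<dots> = (LINT t:{-pi..pi}|lborel. coboundary_kernel t * ?\<phi>3 (?R (t + \<tau>) *v x))"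
      unfolding set_lebesgue_integral_def by (rule integral_restrict_space) simp
    also have "\<dots> = integral {-pi..pi} (\<lambda>t. coboundary_kernel t * ?\<phi>3 (?R (t + \<tau>) *v x))"
      by (rule set_borel_integral_eq_integral(2)[OF borel_integrable_atLeastAtMost'[OF cont]])
    finally show ?thesis .
  qed
  let ?m = "fourier_coeff (\<lambda>t. \<phi> (?R t *v x)) 0 / (2 * pi)"
  show thesis
  proof (rule that[of ?m])
    fix \<tau>
    have "\<phi> (?R \<tau> *v x) - ?m = integral {-pi..pi} (\<lambda>t. coboundary_kernel t *
        (?\<phi>3 (?R (t + \<tau>) *v x) - ?\<phi>3 (?R (t + \<tau> + diophantine_angle) *v x)))"
      by (rule circle_cohomological_equation[OF rot_field_derivative[OF ij \<phi>] rot_field_derivative[OF ij s1]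
            rot_field_derivative[OF ij s2] c3]) simp
    also have "\<dots> = circle_solution i j \<phi> (?R \<tau> *v x) - circle_solution i j \<phi> (?R (diophantine_angle + \<tau>) *v x)"
      unfolding sol right_diff_distrib add.assoc add.commute[of diophantine_angle]
      by (intro integral_diff integrable_continuous_interval continuous_intros continuous_coboundary_kernel c3')
    finally show "\<phi> (?R \<tau> *v x) - ?m = circle_solution i j \<phi> (?R \<tau> *v x) - circle_solution i j \<phi> (?R (diophantine_angle + \<tau>) *v x)" .
  qed
qed

section \<open>Functionals that are invariant modulo a space of functionals\<close>

text \<open>
  Limits of members of \<open>N\<close> need not belong to \<open>N\<close>; this is what excludes integration over rotations and
  leaves finite sums of transposes.
\<close>

definition tame_closed :: "regularity \<Rightarrow> (nat \<Rightarrow> real) \<Rightarrow> ((real^'n::finite \<Rightarrow> complex) \<Rightarrow> complex) set \<Rightarrow> bool" where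
  "tame_closed r M N \<longleftrightarrow> (\<forall>f\<in>N. \<forall>g\<in>N. (\<lambda>\<phi>. f \<phi> + g \<phi>) \<in> N) \<and> (\<forall>f\<in>N. \<forall>A. tame_op M A \<longrightarrow> dual_op r M A f \<in> N)"

lemma tame_closed_add: "tame_closed r M N \<Longrightarrow> f \<in> N \<Longrightarrow> g \<in> N \<Longrightarrow> (\<lambda>\<phi>. f \<phi> + g \<phi>) \<in> N"
  unfolding tame_closed_def by blast

lemma tame_closed_dual_op: "tame_closed r M N \<Longrightarrow> f \<in> N \<Longrightarrow> tame_op M A \<Longrightarrow> dual_op r M A f \<in> N"
  unfolding tame_closed_def by blast

definition invariant_mod :: "regularity \<Rightarrow> (nat \<Rightarrow> real) \<Rightarrow> ((real^'n::finite \<Rightarrow> complex) \<Rightarrow> complex) set \<Rightarrow>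
    ((real^'n \<Rightarrow> complex) \<Rightarrow> complex) \<Rightarrow> bool" where
  "invariant_mod r M N g \<longleftrightarrow> (\<forall>U. rotation_matrix U \<longrightarrow> (\<lambda>\<phi>. dual_rotate r M U g \<phi> - g \<phi>) \<in> N)"

text \<open>
  What is wanted of the spherical mean, for arbitrary distributions of rotations; in this form it passes
  from plane rotations to convolutions.
\<close>

definition mean_mod :: "regularity \<Rightarrow> (nat \<Rightarrow> real) \<Rightarrow> (real^'n^'n::finite) measure \<Rightarrow> bool" where
  "mean_mod r M \<alpha> \<longleftrightarrow> (\<forall>N. \<forall>g\<in>ud_dual r M UNIV. tame_closed r M N \<longrightarrow> invariant_mod r M N g \<longrightarrow>
     (\<lambda>\<phi>. dual_op r M (rot_mean \<alpha>) g \<phi> - g \<phi>) \<in> N)"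

lemma rot_mean_eq_rot_avg: "rot_mean \<alpha> = rot_avg \<alpha> (\<lambda>_. 1) (\<lambda>U. U)"
  by (intro ext) (simp add: rot_mean_def rot_avg_def)

lemma bounded_weight_1: "bounded_weight \<mu> (\<lambda>_. 1) 1"
  by (simp add: bounded_weight_def)

lemma tame_op_rot_mean:
  "rot_distribution \<alpha> \<Longrightarrow> (\<And>p. M p > 0) \<Longrightarrow> tame_op M (rot_mean \<alpha>)"
  unfolding rot_mean_eq_rot_avg by (intro tame_op_rot_avg[OF rotation_family_ident bounded_weight_1]) auto

lemma ud_funs_loc_bounded: "\<phi> \<in> ud_funs r M UNIV \<Longrightarrow> loc_bounded \<phi>"
  by (intro loc_bounded_continuous smooth_on_continuous_on ud_funs_smooth_on)

lemma ud_dual_zero: "g \<in> ud_dual r M UNIV \<Longrightarrow> \<phi> \<notin> ud_funs r M UNIV \<Longrightarrow> g \<phi> = 0"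
  unfolding ud_dual_def by blast

lemma ud_dual_addD:
  "g \<in> ud_dual r M \<Omega> \<Longrightarrow> \<phi> \<in> ud_funs r M \<Omega> \<Longrightarrow> \<psi> \<in> ud_funs r M \<Omega> \<Longrightarrow> g (\<lambda>x. \<phi> x + \<psi> x) = g \<phi> + g \<psi>"
  unfolding ud_dual_def by blast

lemma ud_dual_cmultD:
  "g \<in> ud_dual r M \<Omega> \<Longrightarrow> \<phi> \<in> ud_funs r M \<Omega> \<Longrightarrow> g (\<lambda>x. c * \<phi> x) = c * g \<phi>"
  unfolding ud_dual_def by blast

lemma ud_dual_diff:
  assumes M: "\<And>p. M p > 0" and g: "g \<in> ud_dual r M UNIV"
    and \<phi>: "\<phi> \<in> ud_funs r M UNIV" and \<psi>: "\<psi> \<in> ud_funs r M UNIV"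
  shows "g (\<lambda>x. \<phi> x - \<psi> x) = g \<phi> - g \<psi>"
proof -
  have "(\<lambda>x. (-1) * \<psi> x) \<in> ud_funs r M UNIV" by (rule ud_funs_cmult[where M = M, OF M open_UNIV \<psi>])
  then have "g (\<lambda>x. \<phi> x + (-1) * \<psi> x) = g \<phi> + g (\<lambda>x. (-1) * \<psi> x)"
    by (rule ud_dual_addD[OF g \<phi>])
  also have "g (\<lambda>x. (-1) * \<psi> x) = (-1) * g \<psi>"
    by (rule ud_dual_cmultD[OF g \<psi>])
  finally show ?thesis by simp
qed

text \<open>
  If \<open>A\<close> and \<open>B\<close> are the transposed mean operators, then the convolution gives \<open>B (A g)\<close>, and
  \<open>B (A g) - g = B (A g - g) + (B g - g)\<close>.
\<close>

lemma mean_mod_convolution: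
  fixes \<alpha> \<beta> :: "(real^'n^'n::finite) measure"
  assumes M: "\<And>p. M p > 0" and \<alpha>: "rot_distribution \<alpha>" "mean_mod r M \<alpha>" and \<beta>: "rot_distribution \<beta>" "mean_mod r M \<beta>"
  shows "mean_mod r M (rot_convolution \<alpha> \<beta>)"
  unfolding mean_mod_def
proof (intro allI ballI impI)
  fix N and g :: "(real^'n \<Rightarrow> complex) \<Rightarrow> complex" assume g: "g \<in> ud_dual r M UNIV" and N: "tame_closed r M N" and inv: "invariant_mod r M N g"
  let ?A = "rot_mean \<alpha>" and ?B = "rot_mean \<beta>"
  have tB: "tame_op M ?B" by (rule tame_op_rot_mean[OF \<beta>(1) M])
  have 1: "(\<lambda>\<phi>. dual_op r M ?A g \<phi> - g \<phi>) \<in> N" and 2: "(\<lambda>\<phi>. dual_op r M ?B g \<phi> - g \<phi>) \<in> N"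
    using \<alpha>(2) \<beta>(2) g N inv unfolding mean_mod_def by blast+
  have 3: "dual_op r M ?B (\<lambda>\<phi>. dual_op r M ?A g \<phi> - g \<phi>) \<in> N"
    by (rule tame_closed_dual_op[OF N 1 tB])
  have "(\<lambda>\<phi>. dual_op r M ?B (\<lambda>\<phi>. dual_op r M ?A g \<phi> - g \<phi>) \<phi> + (dual_op r M ?B g \<phi> - g \<phi>)) \<in> N"
    by (rule tame_closed_add[OF N 3 2])
  also have "(\<lambda>\<phi>. dual_op r M ?B (\<lambda>\<phi>. dual_op r M ?A g \<phi> - g \<phi>) \<phi> + (dual_op r M ?B g \<phi> - g \<phi>))
      = (\<lambda>\<phi>. dual_op r M (rot_mean (rot_convolution \<alpha> \<beta>)) g \<phi> - g \<phi>)"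
  proof
    fix \<phi>
    show "dual_op r M ?B (\<lambda>\<phi>. dual_op r M ?A g \<phi> - g \<phi>) \<phi> + (dual_op r M ?B g \<phi> - g \<phi>)
        = dual_op r M (rot_mean (rot_convolution \<alpha> \<beta>)) g \<phi> - g \<phi>"
    proof (cases "\<phi> \<in> ud_funs r M UNIV")
      case True
      have "rot_mean (rot_convolution \<alpha> \<beta>) \<phi> = ?A (?B \<phi>)"
        by (rule ext) (rule rot_mean_convolution[OF \<alpha>(1) \<beta>(1) ud_funs_loc_bounded[OF True]])
      then show ?thesis using True tame_op_ud_funs[where M = M, OF M tB True] by (simp add: dual_op_def)
    qed (simp add: dual_op_def)
  qed
  finally show "(\<lambda>\<phi>. dual_op r M (rot_mean (rot_convolution \<alpha> \<beta>)) g \<phi> - g \<phi>) \<in> N" .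
qed

text \<open>
  Let \<open>A\<close> be the solution operator, \<open>W\<close> the average, and \<open>R\<close> the rotation by the diophantine angle.  On
  each orbit \<open>\<phi> - m = A \<phi> - (A \<phi>) \<circ> R\<close> with a constant \<open>m\<close>, which \<open>W\<close> preserves.  Since \<open>W\<close> commutes
  with \<open>R\<close>, subtracting the average of the equation from the equation removes \<open>m\<close> and gives
  \<open>\<phi> - W \<phi> = B \<phi> - (B \<phi>) \<circ> R\<close> with \<open>B = A - W A\<close>.  So invariance of \<open>g\<close> under the single rotation
  \<open>R\<close> is enough.
\<close>

lemma mean_mod_plane:
  fixes i j :: "'n::finite"
  assumes M: "\<And>p. M p > 0" "cond_M1 M" "cond_M2' M"
    and ij: "i \<noteq> j" and m: "c \<in> borel_measurable borel" "s \<in> borel_measurable borel"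
    and cs: "\<And>y. (c y)\<^sup>2 + (s y)\<^sup>2 = 1"
  shows "mean_mod r M (plane_distribution i j c s)"
  unfolding mean_mod_def
proof (intro allI ballI impI)
  fix N and g :: "(real^'n \<Rightarrow> complex) \<Rightarrow> complex"
  assume g: "g \<in> ud_dual r M UNIV" and N: "tame_closed r M N" and inv: "invariant_mod r M N g"
  let ?W = "rot_mean (plane_distribution i j c s)" and ?A = "circle_solution i j"
  let ?T = "\<lambda>y. plane_rot i j (c y) (s y)" and ?R = "circle_rot i j" and ?\<beta> = "diophantine_angle"
  define B where "B \<phi> x = ?A \<phi> x - ?W (?A \<phi>) x" for \<phi> x
  have rd: "rot_distribution (plane_distribution i j c s)" by (rule rot_distribution_plane[OF ij m cs])
  have tA: "tame_op M ?A" by (rule tame_op_circle_solution[where M = M, OF ij M])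
  have tW: "tame_op M ?W" by (rule tame_op_rot_mean[OF rd M(1)])
  have tB: "tame_op M B"
    unfolding B_def[abs_def] by (rule tame_op_diff[where M = M, OF tA tame_op_compose[OF tW tA] M(1)])
  have rot: "rotation_matrix (?R ?\<beta>)" by (rule rotation_plane_rot[OF ij]) simp
  have eq: "?W \<phi> x = \<phi> x - (B \<phi> x - B \<phi> (?R ?\<beta> *v x))" if \<phi>: "\<phi> \<in> ud_funs r M UNIV" for \<phi> x
  proof -
    have s: "smooth_on UNIV \<phi>" by (rule ud_funs_smooth_on[OF \<phi>])
    obtain z where z: "\<And>\<tau>. \<phi> (?R \<tau> *v x) - z = ?A \<phi> (?R \<tau> *v x) - ?A \<phi> (?R (?\<beta> + \<tau>) *v x)"
      by (rule circle_solution_equation[OF ij s, of x]) blast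
    have lA: "loc_bounded (?A \<phi>)"
      by (intro loc_bounded_continuous smooth_on_continuous_on tame_op_smooth[OF tA s])
    have l: "loc_bounded \<phi>" by (rule ud_funs_loc_bounded[OF \<phi>])
    have y: "\<phi> (?T y *v x) = z + (?A \<phi> (?T y *v x) - ?A \<phi> (?T y *v (?R ?\<beta> *v x)))" for y
    proof -
      obtain \<tau> where \<tau>: "c y = cos \<tau>" "s y = sin \<tau>" using sincos_total_2pi[OF cs[of y]] by metis
      have "?R \<tau> *v (?R ?\<beta> *v x) = ?R (?\<beta> + \<tau>) *v x" by (simp only: circle_rot_add[OF ij] add.commute)
      then show ?thesis using z[of \<tau>] unfolding \<tau> by (simp add: algebra_simps)
    qed
    note fam = rotation_family_plane[OF ij m cs]
    interpret \<gamma>: finite_measure "ball_measure :: (real^'n) measure" by (rule finite_ball_measure)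
    have "?W \<phi> x = (LINT y|ball_measure. z + (?A \<phi> (?T y *v x) - ?A \<phi> (?T y *v (?R ?\<beta> *v x))))"
      unfolding rot_mean_plane[OF ij m cs l] y ..
    also have "\<dots> = z + ((LINT y|ball_measure. ?A \<phi> (?T y *v x)) - (LINT y|ball_measure. ?A \<phi> (?T y *v (?R ?\<beta> *v x))))"
      using integrable_loc_bounded[OF lA fam] by (simp add: measure_def emeasure_ball_measure_UNIV)
    also have "\<dots> = z + (?W (?A \<phi>) x - ?W (?A \<phi>) (?R ?\<beta> *v x))"
      unfolding rot_mean_plane[OF ij m cs lA] ..
    finally have "?W \<phi> x = z + (?W (?A \<phi>) x - ?W (?A \<phi>) (?R ?\<beta> *v x))" .
    moreover have "\<phi> x - z = ?A \<phi> x - ?A \<phi> (?R ?\<beta> *v x)"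
      using z[of 0] by (simp add: plane_rot_identity[OF ij])
    ultimately show ?thesis unfolding B_def by (simp add: algebra_simps)
  qed
  \<comment> \<open>Functionals are rotated by composing functions with the inverse rotation.\<close>
  let ?U = "transpose (?R ?\<beta>)"
  have U: "rotation_matrix ?U" "matrix_inv ?U = ?R ?\<beta>"
    using rotation_matrix_transpose[OF rot] matrix_inv_rotation[OF rotation_matrix_transpose[OF rot]] by simp_all
  have "(\<lambda>\<phi>. dual_rotate r M ?U g \<phi> - g \<phi>) \<in> N" using inv U(1) unfolding invariant_mod_def by blast
  then have "dual_op r M B (\<lambda>\<phi>. dual_rotate r M ?U g \<phi> - g \<phi>) \<in> N"
    by (rule tame_closed_dual_op[OF N _ tB])
  also have "dual_op r M B (\<lambda>\<phi>. dual_rotate r M ?U g \<phi> - g \<phi>) = (\<lambda>\<phi>. dual_op r M ?W g \<phi> - g \<phi>)"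
  proof
    fix \<phi>
    show "dual_op r M B (\<lambda>\<phi>. dual_rotate r M ?U g \<phi> - g \<phi>) \<phi> = dual_op r M ?W g \<phi> - g \<phi>"
    proof (cases "\<phi> \<in> ud_funs r M UNIV")
      case True
      have B: "B \<phi> \<in> ud_funs r M UNIV" by (rule tame_op_ud_funs[where M = M, OF M(1) tB True])
      have BR: "(\<lambda>x. B \<phi> (?R ?\<beta> *v x)) \<in> ud_funs r M UNIV"
        by (rule tame_op_ud_funs[where M = M, OF M(1) tame_op_rotate[OF rot] B]) (rule M(1))
      have D: "(\<lambda>x. B \<phi> x - B \<phi> (?R ?\<beta> *v x)) \<in> ud_funs r M UNIV"
      proof -
        have "(\<lambda>x. B \<phi> x + (-1) * B \<phi> (?R ?\<beta> *v x)) \<in> ud_funs r M UNIV"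
          by (intro ud_funs_add ud_funs_cmult M(1) open_UNIV B BR)
        then show ?thesis by simp
      qed
      have "g (?W \<phi>) = g (\<lambda>x. \<phi> x - (B \<phi> x - B \<phi> (?R ?\<beta> *v x)))"
        using eq[OF True] by (intro arg_cong[where f = g] ext)
      also have "\<dots> = g \<phi> - (g (B \<phi>) - g (\<lambda>x. B \<phi> (?R ?\<beta> *v x)))"
        by (simp only: ud_dual_diff[where M = M, OF M(1) g True D] ud_dual_diff[where M = M, OF M(1) g B BR])
      finally show ?thesis using True B by (simp add: dual_op_def dual_rotate_def U(2))
    qed (simp add: dual_op_def ud_dual_zero[OF g])
  qed
  finally show "(\<lambda>\<phi>. dual_op r M ?W g \<phi> - g \<phi>) \<in> N" .
qed

text \<open>
  The operator \<open>A\<close> is the mean with respect to an invariant distribution of rotations.  It agrees with the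
  spherical mean on the functions in question, and unlike the latter it is known to be tame.
\<close>

theorem spherical_mean_mod:
  assumes n: "CARD('n::finite) \<ge> 2" and M: "\<And>p. M p > 0" "cond_M1 M" "cond_M2' M"
  obtains A :: "(real^'n \<Rightarrow> complex) \<Rightarrow> real^'n \<Rightarrow> complex" where "tame_op M A"
    "\<And>g :: (real^'n \<Rightarrow> complex) \<Rightarrow> complex. dual_spherical_mean r M g = dual_op r M A g"
    "\<And>N. \<And>g :: (real^'n \<Rightarrow> complex) \<Rightarrow> complex. g \<in> ud_dual r M UNIV \<Longrightarrow> tame_closed r M N \<Longrightarrow> invariant_mod r M N g \<Longrightarrow>
       (\<lambda>\<phi>. dual_spherical_mean r M g \<phi> - g \<phi>) \<in> N"
proof -
  obtain \<alpha> :: "(real^'n^'n) measure" where \<alpha>: "haar_on UNIV \<alpha>" "mean_mod r M \<alpha>"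
    using haar_on_exists[of "mean_mod r M", OF n mean_mod_plane[where M = M, OF M] mean_mod_convolution[where M = M, OF M(1)]]
    by blast
  have r\<alpha>: "rot_distribution \<alpha>" using \<alpha>(1) by (simp add: haar_on_def)
  have eq: "dual_spherical_mean r M g = dual_op r M (rot_mean \<alpha>) g" for g
  proof
    fix \<phi>
    show "dual_spherical_mean r M g \<phi> = dual_op r M (rot_mean \<alpha>) g \<phi>"
    proof (cases "\<phi> \<in> ud_funs r M UNIV")
      case True
      have "fun_spherical_mean \<phi> = rot_mean \<alpha> \<phi>"
        by (rule ext) (rule fun_spherical_mean_eq_rot_mean[OF \<alpha>(1) ud_funs_loc_bounded[OF True]])
      then show ?thesis using True by (simp add: dual_spherical_mean_def dual_op_def)
    qed (simp add: dual_spherical_mean_def dual_op_def)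
  qed
  show thesis
  proof (rule that[of "rot_mean \<alpha>"])
    show "tame_op M (rot_mean \<alpha>)" by (rule tame_op_rot_mean[OF r\<alpha> M(1)])
    show "(\<lambda>\<phi>. dual_spherical_mean r M g \<phi> - g \<phi>) \<in> N"
      if "g \<in> ud_dual r M UNIV" "tame_closed r M N" "invariant_mod r M N g" for N and g :: "(real^'n \<Rightarrow> complex) \<Rightarrow> complex"
      using \<alpha>(2) that unfolding mean_mod_def eq by blast
  qed (rule eq)
qed

section \<open>Sections, functionals and carriers\<close>

context vector_space_sheaf
begin

lemma res_zero: "open U \<Longrightarrow> open V \<Longrightarrow> V \<subseteq> U \<Longrightarrow> res U V 0 = 0"
  using res_scale[of U V 0 0] subspace_0[OF sections_subspace[of U]] by simp

lemma res_diff: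
  assumes "open U" "open V" "V \<subseteq> U" "s \<in> F U" "t \<in> F U"
  shows "res U V (s - t) = res U V s - res U V t"
proof -
  have "scale (- 1) t \<in> F U" using subspace_scale[OF sections_subspace[OF assms(1)] assms(5)] .
  then have "res U V (s + scale (- 1) t) = res U V s + res U V (scale (- 1) t)"
    by (rule res_add[OF assms(1-4)])
  then show ?thesis using res_scale[OF assms(1-3,5), of "- 1"] by simp
qed

text \<open>
  Locality concerns sections over the union of a cover, so global sections are first restricted to it.
\<close>

lemma locality_UNIV:
  assumes U: "\<forall>V\<in>\<U>. open V" and s: "s \<in> F UNIV" and t: "t \<in> F UNIV"
    and eq: "\<forall>V\<in>\<U>. res UNIV V s = res UNIV V t"
  shows "res UNIV (\<Union>\<U>) s = res UNIV (\<Union>\<U>) t"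
proof (rule locality[OF U])
  have o: "open (\<Union>\<U>)" using U by blast
  show "res UNIV (\<Union>\<U>) s \<in> F (\<Union>\<U>)" "res UNIV (\<Union>\<U>) t \<in> F (\<Union>\<U>)"
    using o s t by (auto intro: res_in)
  show "\<forall>V\<in>\<U>. res (\<Union>\<U>) V (res UNIV (\<Union>\<U>) s) = res (\<Union>\<U>) V (res UNIV (\<Union>\<U>) t)"
  proof
    fix V assume V: "V \<in> \<U>"
    then have "V \<subseteq> \<Union>\<U>" "open V" using U by auto
    then show "res (\<Union>\<U>) V (res UNIV (\<Union>\<U>) s) = res (\<Union>\<U>) V (res UNIV (\<Union>\<U>) t)"
      using res_res[OF open_UNIV o _ _ _ s] res_res[OF open_UNIV o _ _ _ t] eq V by simp
  qed
qed

lemma zero_section: "open U \<Longrightarrow> 0 \<in> F U"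
  by (rule subspace_0[OF sections_subspace])

lemma section_support_subset_iff:
  assumes s: "s \<in> F UNIV" and K: "closed K"
  shows "section_support s \<subseteq> K \<longleftrightarrow> res UNIV (- K) s = 0"
proof
  assume "res UNIV (- K) s = 0"
  then have "- K \<subseteq> \<Union>{V. open V \<and> res UNIV V s = 0}" using K by auto
  then show "section_support s \<subseteq> K" unfolding section_support_def by blast
next
  let ?\<U> = "{V. open V \<and> res UNIV V s = 0}"
  have oK: "open (- K)" using K by (rule open_Compl)
  assume "section_support s \<subseteq> K"
  then have sub: "- K \<subseteq> \<Union>?\<U>" unfolding section_support_def by blast
  have o: "open (\<Union>?\<U>)" by blast
  have "res UNIV (\<Union>?\<U>) s = res UNIV (\<Union>?\<U>) 0"
    by (rule locality_UNIV) (auto simp: s zero_section res_zero)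
  then have "res UNIV (\<Union>?\<U>) s = 0" using res_zero[OF open_UNIV o] by simp
  then have "res (\<Union>?\<U>) (- K) (res UNIV (\<Union>?\<U>) s) = 0" using res_zero[OF o oK sub] by simp
  then show "res UNIV (- K) s = 0" using res_res[OF open_UNIV o oK sub subset_UNIV s] by simp
qed

end

context ultradistribution_sheaf
begin

lemma iota_section: "g \<in> ud_dual r M UNIV \<Longrightarrow> \<iota> g \<in> B UNIV"
  using iota_bij unfolding bij_betw_def by blast

lemma iota_diff:
  assumes "g \<in> ud_dual r M UNIV" "h \<in> ud_dual r M UNIV"
  shows "\<iota> (\<lambda>\<phi>. g \<phi> - h \<phi>) = \<iota> g - \<iota> h"
proof -
  have "\<iota> (\<lambda>\<phi>. g \<phi> + (-1) * h \<phi>) = \<iota> g + scale (-1) (\<iota> h)"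
    using iota_add[OF assms(1) ud_dual_cmult[OF assms(2), of "-1"]] iota_scale[OF assms(2), of "-1"] by simp
  then show ?thesis by simp
qed

lemma ud_dual_supp_iff:
  assumes K: "compact K" and g: "g \<in> ud_dual r M UNIV"
  shows "g \<in> ud_dual_supp r M K \<longleftrightarrow> res UNIV (- K) (\<iota> g) = 0"
proof -
  have "g \<in> ud_dual_supp r M K \<longleftrightarrow> \<iota> g \<in> \<iota> ` ud_dual_supp r M K"
  proof
    assume "\<iota> g \<in> \<iota> ` ud_dual_supp r M K"
    then obtain h where h: "h \<in> ud_dual_supp r M K" "\<iota> g = \<iota> h" by blast
    then have "h \<in> ud_dual r M UNIV" by (simp add: ud_dual_supp_def)
    then have "g = h" using h(2) g iota_bij unfolding bij_betw_def inj_on_def by blast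
    then show "g \<in> ud_dual_supp r M K" using h by simp
  qed blast
  also have "\<dots> \<longleftrightarrow> section_support (\<iota> g) \<subseteq> K"
    unfolding iota_supp[OF K] using iota_section[OF g] by blast
  also have "\<dots> \<longleftrightarrow> res UNIV (- K) (\<iota> g) = 0"
    by (rule section_support_subset_iff[OF iota_section[OF g] compact_imp_closed[OF K]])
  finally show ?thesis .
qed

text \<open>
  The section of a functional has compact support, and the functionals with support in that compact set
  have a smallest carrier.  So every functional has a smallest carrier, and being carried by \<open>K\<close> is
  the same as having support in \<open>K\<close>.
\<close>

lemma carrier_of_iff:
  assumes K: "compact K" and g: "g \<in> ud_dual r M UNIV"
  shows "carrier_of r M g K \<longleftrightarrow> res UNIV (- K) (\<iota> g) = 0"
proof
  assume c: "carrier_of r M g K"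
  have "compact (section_support (\<iota> g))" using g iota_bij unfolding bij_betw_def by blast
  moreover have "res UNIV (- section_support (\<iota> g)) (\<iota> g) = 0"
    using section_support_subset_iff[OF iota_section[OF g] compact_imp_closed[OF calculation]] by simp
  ultimately have "g \<in> ud_dual_supp r M (section_support (\<iota> g))" using ud_dual_supp_iff[OF _ g] by simp
  then obtain S where "is_support r M g S" unfolding ud_dual_supp_def by blast
  then have "g \<in> ud_dual_supp r M K" using c g unfolding ud_dual_supp_def is_support_def by blast
  then show "res UNIV (- K) (\<iota> g) = 0" using ud_dual_supp_iff[OF K g] by simp
next
  assume "res UNIV (- K) (\<iota> g) = 0"
  then have "g \<in> ud_dual_supp r M K" using ud_dual_supp_iff[OF K g] by simp
  then obtain S where "carrier_of r M g S" "S \<subseteq> K" unfolding ud_dual_supp_def is_support_def by blast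
  then show "carrier_of r M g K" using K unfolding carrier_of_def by blast
qed

lemma res_dual_diff:
  assumes "g \<in> ud_dual r M UNIV" "h \<in> ud_dual r M UNIV" "open V"
  shows "res UNIV V (\<iota> (\<lambda>\<phi>. g \<phi> - h \<phi>)) = res UNIV V (\<iota> g) - res UNIV V (\<iota> h)"
  unfolding iota_diff[OF assms(1,2)]
  using res_diff[OF open_UNIV assms(3) subset_UNIV iota_section[OF assms(1)] iota_section[OF assms(2)]] .

lemma ud_dual_diff_mem:
  assumes M: "\<And>p. M p > 0" and g: "g \<in> ud_dual r M UNIV" and h: "h \<in> ud_dual r M UNIV"
  shows "(\<lambda>\<phi>. g \<phi> - h \<phi>) \<in> ud_dual r M UNIV"
  using ud_dual_add[where M = M, OF M g ud_dual_cmult[OF h, of "-1"]] by simp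

text \<open>
  For sums one passes to the sheaf: that two functionals carried by \<open>K\<close> have a sum carried by \<open>K\<close> is the
  additivity of restriction to the complement.
\<close>

lemma carried_tame_closed:
  fixes K :: "(real^'n) set"
  assumes M: "\<And>p. M p > 0" and K: "compact K" "rotation_invariant_set K"
  shows "tame_closed r M {g \<in> ud_dual r M UNIV. carrier_of r M g K}"
  unfolding tame_closed_def
proof (intro conjI ballI allI impI)
  let ?N = "{g \<in> ud_dual r M UNIV. carrier_of r M g K}"
  fix f assume f: "f \<in> ?N"
  show "dual_op r M A f \<in> ?N" if A: "tame_op M A" for A :: "(real^'n \<Rightarrow> complex) \<Rightarrow> real^'n \<Rightarrow> complex"
    using f dual_op_in_ud_dual[where M = M, OF M A] carrier_of_dual_op[where M = M, OF M A K(2)] by simp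
  fix g assume g: "g \<in> ?N"
  have d: "(\<lambda>\<phi>. f \<phi> + g \<phi>) \<in> ud_dual r M UNIV" using f g by (intro ud_dual_add M) auto
  have oK: "open (- K)" using compact_imp_closed[OF K(1)] by auto
  have "res UNIV (- K) (\<iota> (\<lambda>\<phi>. f \<phi> + g \<phi>)) = res UNIV (- K) (\<iota> f) + res UNIV (- K) (\<iota> g)"
    using f g oK by (simp add: iota_add res_add iota_section)
  also have "\<dots> = 0" using f g carrier_of_iff[OF K(1), of f] carrier_of_iff[OF K(1), of g] by simp
  finally show "(\<lambda>\<phi>. f \<phi> + g \<phi>) \<in> ?N" using d carrier_of_iff[OF K(1) d] by simp
qed

lemma rotation_invariant_closure:
  fixes V :: "(real^'n) set"
  assumes "rotation_invariant_set V"
  shows "rotation_invariant_set (closure V)"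
proof (rule rotation_invariant_setI)
  fix U :: "real^'n^'n" and x assume U: "rotation_matrix U" and x: "x \<in> closure V"
  have "(*v) U ` closure V \<subseteq> closure V"
    by (rule image_closure_subset)
       (use rotation_invariant_set_mem[OF assms U] closure_subset in \<open>auto intro!: continuous_intros\<close>)
  then show "U *v x \<in> closure V" using x by blast
qed

lemma rotation_invariant_Diff:
  fixes V W :: "(real^'n) set"
  assumes "rotation_invariant_set V" "rotation_invariant_set W"
  shows "rotation_invariant_set (V - W)"
proof (rule rotation_invariant_setI)
  fix U :: "real^'n^'n" and x assume U: "rotation_matrix U" and x: "x \<in> V - W"
  have "U *v x \<notin> W"
  proof
    assume "U *v x \<in> W"
    then have "transpose U *v (U *v x) \<in> W"
      by (rule rotation_invariant_set_mem[OF assms(2) rotation_matrix_transpose[OF U]])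
    then show False using x U
      by (simp add: matrix_vector_mul_assoc rotation_matrix_def orthogonal_matrix_def del: transpose_matrix_vector)
  qed
  then show "U *v x \<in> V - W" using x rotation_invariant_set_mem[OF assms(1) U] by blast
qed

text \<open>
  The section vanishes on the complement of \<open>closure V\<close>; by locality it vanishes on \<open>W\<close> if and only if it
  vanishes on the union of the two, which is the complement of \<open>closure V - W\<close>.
\<close>

lemma vanishing_iff_carrier:
  assumes V: "bounded V" and W: "open W" and g: "g \<in> ud_dual r M UNIV" and c: "carrier_of r M g (closure V)"
  shows "res UNIV W (\<iota> g) = 0 \<longleftrightarrow> carrier_of r M g (closure V - W)"
proof -
  have K: "compact (closure V)" using V by (simp add: compact_closure)
  have K': "compact (closure V - W)" using K W by (rule compact_diff)
  note o = open_Compl[OF compact_imp_closed[OF K]] open_Compl[OF compact_imp_closed[OF K']]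
  have 0: "res UNIV (- closure V) (\<iota> g) = 0" using c carrier_of_iff[OF K g] by simp
  show ?thesis unfolding carrier_of_iff[OF K' g]
  proof
    assume "res UNIV W (\<iota> g) = 0"
    then have "res UNIV (\<Union>{W, - closure V}) (\<iota> g) = res UNIV (\<Union>{W, - closure V}) 0"
      using 0 W o(1) by (intro locality_UNIV) (auto simp: iota_section[OF g] zero_section res_zero)
    moreover have "\<Union>{W, - closure V} = - (closure V - W)" by auto
    ultimately show "res UNIV (- (closure V - W)) (\<iota> g) = 0" using res_zero[OF open_UNIV o(2)] by simp
  next
    assume "res UNIV (- (closure V - W)) (\<iota> g) = 0"
    moreover have sub: "W \<subseteq> - (closure V - W)" by blast
    ultimately show "res UNIV W (\<iota> g) = 0"
      using res_res[OF open_UNIV o(2) W sub _ iota_section[OF g]] res_zero[OF o(2) W sub] by simp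
  qed
qed

text \<open>
  The difference of the functionals vanishes on \<open>W\<close>, so it is carried by the invariant compact set
  \<open>closure V - W\<close>, and hence so is its image.  This makes rotations and spherical means of sections independent of representatives and
  compatible with restriction.
\<close>

lemma res_dual_op_cong:
  fixes A :: "(real^'n \<Rightarrow> complex) \<Rightarrow> real^'n \<Rightarrow> complex"
  assumes M: "\<And>p. M p > 0" and A: "tame_op M A"
    and V: "bounded V" "rotation_invariant_set V" and W: "open W" "rotation_invariant_set W"
    and g: "g \<in> ud_dual r M UNIV" "carrier_of r M g (closure V)"
    and h: "h \<in> ud_dual r M UNIV" "carrier_of r M h (closure V)"
    and eq: "res UNIV W (\<iota> g) = res UNIV W (\<iota> h)"
  shows "res UNIV W (\<iota> (dual_op r M A g)) = res UNIV W (\<iota> (dual_op r M A h))"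
proof -
  let ?d = "\<lambda>\<phi>. g \<phi> - h \<phi>"
  have K: "compact (closure V)" using V(1) by (simp add: compact_closure)
  have oK: "open (- closure V)" by auto
  have d: "?d \<in> ud_dual r M UNIV" by (rule ud_dual_diff_mem[OF M g(1) h(1)])
  have cd: "carrier_of r M ?d (closure V)"
    unfolding carrier_of_iff[OF K d] res_dual_diff[OF g(1) h(1) oK]
    using carrier_of_iff[OF K g(1)] carrier_of_iff[OF K h(1)] g(2) h(2) by simp
  have K': "rotation_invariant_set (closure V - W)"
    by (intro rotation_invariant_Diff rotation_invariant_closure V W)
  have "res UNIV W (\<iota> ?d) = 0" using res_dual_diff[OF g(1) h(1) W(1)] eq by simp
  then have "carrier_of r M ?d (closure V - W)" using vanishing_iff_carrier[OF V(1) W(1) d cd] by blast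
  then have "carrier_of r M (dual_op r M A ?d) (closure V - W)"
    by (rule carrier_of_dual_op[where M = M, OF M A K'])
  moreover have dA: "dual_op r M A ?d \<in> ud_dual r M UNIV" by (rule dual_op_in_ud_dual[where M = M, OF M A d])
  moreover have "carrier_of r M (dual_op r M A ?d) (closure V)"
    by (rule carrier_of_dual_op[where M = M, OF M A rotation_invariant_closure[OF V(2)] cd])
  ultimately have "res UNIV W (\<iota> (dual_op r M A ?d)) = 0"
    using vanishing_iff_carrier[OF V(1) W(1)] by blast
  moreover have "dual_op r M A ?d = (\<lambda>\<phi>. dual_op r M A g \<phi> - dual_op r M A h \<phi>)"
    by (rule ext) (simp add: dual_op_def)
  moreover have "dual_op r M A g \<in> ud_dual r M UNIV" "dual_op r M A h \<in> ud_dual r M UNIV"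
    by (intro dual_op_in_ud_dual[where M = M, OF M A] g h)+
  ultimately show ?thesis using res_dual_diff[OF _ _ W(1)] by simp
qed

lemma empty_sections: "s \<in> B {} \<Longrightarrow> t \<in> B {} \<Longrightarrow> s = t"
  using locality[of "{}" s t] by simp

text \<open>
  A section on a bounded open set, together with zero outside the closure, extends to a global section by
  flabbiness; its support is compact, hence it comes from a functional.
\<close>

lemma representative:
  assumes V: "open V" "bounded V" and s: "s \<in> B V"
  shows "representative V s \<in> ud_dual r M UNIV" "carrier_of r M (representative V s) (closure V)"
    "res UNIV V (\<iota> (representative V s)) = s"
proof -
  have K: "compact (closure V)" using V by (simp add: compact_closure)
  have oK: "open (- closure V)" by auto
  define \<sigma> where "\<sigma> W = (if W = V then s else 0)" for W
  \<comment> \<open>Otherwise \<open>\<sigma>\<close> would assign \<open>s\<close> to both members of the cover.\<close>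
  have ne: "- closure V \<noteq> V"
  proof
    assume eq: "- closure V = V"
    then have "V = {}" using closure_subset[of V] by blast
    then show False using eq by simp
  qed
  have "\<exists>t\<in>B (\<Union>{V, - closure V}). \<forall>W\<in>{V, - closure V}. res (\<Union>{V, - closure V}) W t = \<sigma> W"
  proof (rule gluing)
    have e: "V \<inter> - closure V = {}" "- closure V \<inter> V = {}" using closure_subset[of V] by auto
    show "\<forall>W\<in>{V, - closure V}. \<forall>W'\<in>{V, - closure V}. res W (W \<inter> W') (\<sigma> W) = res W' (W \<inter> W') (\<sigma> W')"
    proof (intro ballI)
      fix W W' assume W: "W \<in> {V, - closure V}" "W' \<in> {V, - closure V}"
      show "res W (W \<inter> W') (\<sigma> W) = res W' (W \<inter> W') (\<sigma> W')"
      proof (cases "W = W'")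
        case False
        then have i: "W \<inter> W' = {}" using W e by auto
        have "res W {} (\<sigma> W) \<in> B {}" "res W' {} (\<sigma> W') \<in> B {}"
          using W V(1) oK s ne by (auto intro!: res_in simp: \<sigma>_def zero_section)
        then show ?thesis unfolding i by (rule empty_sections)
      qed simp
    qed
  qed (use V(1) oK s ne in \<open>auto simp: \<sigma>_def zero_section\<close>)
  then obtain t where t: "t \<in> B (V \<union> - closure V)" "res (V \<union> - closure V) V t = s"
      "res (V \<union> - closure V) (- closure V) t = 0"
    using ne by (auto simp: \<sigma>_def)
  have o: "open (V \<union> - closure V)" using V oK by auto
  from t(1) have "t \<in> res UNIV (V \<union> - closure V) ` B UNIV" unfolding flabby[OF o] .
  then obtain w where w: "w \<in> B UNIV" "res UNIV (V \<union> - closure V) w = t" by (elim imageE) (rule that, simp_all)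
  have "res UNIV (- closure V) w = 0"
    using res_res[OF open_UNIV o oK _ _ w(1)] w(2) t(3) by simp
  then have "section_support w \<subseteq> closure V"
    using section_support_subset_iff[OF w(1) closed_closure] by blast
  then obtain g where g: "g \<in> ud_dual_supp r M (closure V)" "w = \<iota> g"
    using iota_supp[OF K] w(1) by blast
  have "section_class V g = s"
    unfolding section_class_def using res_res[OF open_UNIV o V(1) _ _ w(1)] w(2) t(2) g(2) by simp
  with g(1) have "\<exists>g. g \<in> ud_dual_supp r M (closure V) \<and> section_class V g = s" by blast
  then have r: "representative V s \<in> ud_dual_supp r M (closure V) \<and> section_class V (representative V s) = s"
    unfolding representative_def by (rule someI_ex)
  then show 1: "representative V s \<in> ud_dual r M UNIV" by (simp add: ud_dual_supp_def)
  show "carrier_of r M (representative V s) (closure V)"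
    using r ud_dual_supp_iff[OF K 1] carrier_of_iff[OF K 1] by simp
  show "res UNIV V (\<iota> (representative V s)) = s" using r by (simp add: section_class_def)
qed

lemma admissible_cover: "\<Union>{V :: (real^'n) set. admissible V} = UNIV"
proof -
  have "x \<in> \<Union>{V :: (real^'n) set. admissible V}" for x :: "real^'n"
  proof -
    have "admissible (ball (0 :: real^'n) (norm x + 1))"
      unfolding admissible_def
      by (auto intro!: rotation_invariant_setI simp: rotation_matrix_norm)
    moreover have "x \<in> ball 0 (norm x + 1)" by simp
    ultimately show ?thesis by blast
  qed
  then show ?thesis by blast
qed

lemma section_eqI:
  assumes "s \<in> B UNIV" "t \<in> B UNIV" "\<And>V. admissible V \<Longrightarrow> res UNIV V s = res UNIV V t"
  shows "s = t"
proof -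
  have "res UNIV (\<Union>{V. admissible V}) s = res UNIV (\<Union>{V. admissible V}) t"
    using assms by (intro locality_UNIV) (auto simp: admissible_def)
  then show ?thesis using assms(1,2) by (simp add: admissible_cover res_id)
qed

lemma admissible_Int: "admissible V \<Longrightarrow> admissible W \<Longrightarrow> admissible (V \<inter> W)"
  unfolding admissible_def
  by (auto intro!: rotation_invariant_setI intro: rotation_invariant_set_mem bounded_subset)

text \<open>
  The local spherical means agree on overlaps because representatives on \<open>V\<close> and on a smaller \<open>W\<close> define the
  same section on \<open>W\<close>.  So they glue, and the result is unique because the admissible sets form a cover.
\<close>

lemma spherical_mean_properties:
  fixes A :: "(real^'n \<Rightarrow> complex) \<Rightarrow> real^'n \<Rightarrow> complex"
  assumes M: "\<And>p. M p > 0" and A: "tame_op M A" "\<And>g. dual_spherical_mean r M g = dual_op r M A g"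
    and f: "f \<in> B UNIV"
  shows "spherical_mean f \<in> B UNIV"
    and "admissible V \<Longrightarrow> res UNIV V (spherical_mean f) = local_spherical_mean V (res UNIV V f)"
    and "(\<And>V. admissible V \<Longrightarrow> local_spherical_mean V (res UNIV V f) = res UNIV V f) \<Longrightarrow> spherical_mean f = f"
proof -
  let ?\<U> = "{V :: (real^'n) set. admissible V}"
  let ?\<sigma> = "\<lambda>V. local_spherical_mean V (res UNIV V f)"
  let ?g = "\<lambda>V. representative V (res UNIV V f)"
  have rep: "?g V \<in> ud_dual r M UNIV" "carrier_of r M (?g V) (closure V)" "res UNIV V (\<iota> (?g V)) = res UNIV V f"
    if "admissible V" for V
    using representative[of V "res UNIV V f"] that f by (auto simp: admissible_def res_in)
  have \<sigma>: "?\<sigma> V = res UNIV V (\<iota> (dual_op r M A (?g V)))" for V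
    by (simp add: local_spherical_mean_def section_class_def A(2))
  have dA: "dual_op r M A (?g V) \<in> ud_dual r M UNIV" if "admissible V" for V
    by (rule dual_op_in_ud_dual[where M = M, OF M A(1) rep(1)[OF that]])
  have overlap: "res V W (?\<sigma> V) = ?\<sigma> W" if V: "admissible V" and W: "admissible W" and WV: "W \<subseteq> V" for V W
  proof -
    have V': "open V" "bounded V" "rotation_invariant_set V" and W': "open W" "bounded W" "rotation_invariant_set W"
      using V W by (auto simp: admissible_def)
    have cW: "carrier_of r M (?g W) (closure V)"
    proof -
      have "compact (closure V)" using V' by (simp add: compact_closure)
      moreover have "closure W \<subseteq> closure V" by (rule closure_mono[OF WV])
      ultimately show ?thesis using rep(2)[OF W] unfolding carrier_of_def by blast
    qed
    have "res UNIV W (\<iota> (?g V)) = res V W (res UNIV V (\<iota> (?g V)))"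
      by (rule res_res[OF open_UNIV V'(1) W'(1) WV subset_UNIV iota_section[OF rep(1)[OF V]], symmetric])
    also have "\<dots> = res UNIV W (\<iota> (?g W))"
      unfolding rep(3)[OF V] rep(3)[OF W] by (rule res_res[OF open_UNIV V'(1) W'(1) WV subset_UNIV f])
    finally have "res UNIV W (\<iota> (dual_op r M A (?g V))) = res UNIV W (\<iota> (dual_op r M A (?g W)))"
      by (intro res_dual_op_cong[OF M A(1) V'(2,3) W'(1,3) rep(1,2)[OF V] rep(1)[OF W] cW])
    then show ?thesis
      unfolding \<sigma> using res_res[OF open_UNIV V'(1) W'(1) WV subset_UNIV iota_section[OF dA[OF V]]] by simp
  qed
  have "\<exists>s\<in>B (\<Union>?\<U>). \<forall>V\<in>?\<U>. res (\<Union>?\<U>) V s = ?\<sigma> V"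
  proof (rule gluing)
    show "\<forall>V\<in>?\<U>. open V" by (auto simp: admissible_def)
    show "\<forall>V\<in>?\<U>. ?\<sigma> V \<in> B V"
      unfolding \<sigma> using dA by (auto simp: admissible_def intro!: res_in iota_section)
    show "\<forall>V\<in>?\<U>. \<forall>W\<in>?\<U>. res V (V \<inter> W) (?\<sigma> V) = res W (V \<inter> W) (?\<sigma> W)"
      using overlap admissible_Int by (metis Int_lower1 Int_lower2 mem_Collect_eq)
  qed
  then obtain s where s: "s \<in> B UNIV" "\<And>V. admissible V \<Longrightarrow> res UNIV V s = ?\<sigma> V"
    unfolding admissible_cover by blast
  have unique: "spherical_mean f = t" if "t \<in> B UNIV" "\<And>V. admissible V \<Longrightarrow> res UNIV V t = ?\<sigma> V" for t
    unfolding spherical_mean_def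
  proof (rule the_equality)
    fix s assume s: "s \<in> B UNIV \<and> (\<forall>V. admissible V \<longrightarrow> res UNIV V s = ?\<sigma> V)"
    show "s = t"
    proof (rule section_eqI)
      fix V :: "(real^'n) set" assume V: "admissible V"
      then have "res UNIV V s = ?\<sigma> V" using s by blast
      also have "\<dots> = res UNIV V t" by (rule that(2)[OF V, symmetric])
      finally show "res UNIV V s = res UNIV V t" .
    qed (use s that(1) in blast)+
  qed (use that in blast)
  have eq: "spherical_mean f = s" by (rule unique[OF s])
  show "spherical_mean f \<in> B UNIV" unfolding eq by (rule s(1))
  show "admissible V \<Longrightarrow> res UNIV V (spherical_mean f) = ?\<sigma> V" unfolding eq by (rule s(2))
  show "(\<And>V. admissible V \<Longrightarrow> ?\<sigma> V = res UNIV V f) \<Longrightarrow> spherical_mean f = f"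
    by (rule unique[OF f]) (rule sym)
qed

lemma dual_rotate_spherical_mean:
  fixes U :: "real^'n^'n"
  assumes M: "\<And>p. M p > 0" and U: "rotation_matrix U"
  shows "dual_rotate r M U (dual_spherical_mean r M g) = dual_spherical_mean r M g"
proof
  fix \<phi>
  have U': "rotation_matrix (matrix_inv U)"
    using rotation_matrix_transpose[OF U] matrix_inv_rotation[OF U] by simp
  show "dual_rotate r M U (dual_spherical_mean r M g) \<phi> = dual_spherical_mean r M g \<phi>"
  proof (cases "\<phi> \<in> ud_funs r M UNIV")
    case True
    have 1: "(\<lambda>x. \<phi> (matrix_inv U *v x)) \<in> ud_funs r M UNIV"
      by (rule tame_op_ud_funs[where M = M, OF M tame_op_rotate[OF U'] True]) (rule M)
    have 2: "\<phi> \<in> borel_measurable borel"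
      using ud_funs_loc_bounded[OF True] by (simp add: loc_bounded_def)
    have "fun_spherical_mean (\<lambda>x. \<phi> (matrix_inv U *v x)) = fun_spherical_mean \<phi>"
      by (rule fun_spherical_mean_rotate[OF 2 U'])
    then show ?thesis using True 1 by (simp add: dual_rotate_def dual_spherical_mean_def)
  qed (simp add: dual_rotate_def dual_spherical_mean_def)
qed

text \<open>
  On each admissible \<open>V\<close>, both properties of \<open>f\<close> are statements about a representative modulo functionals
  carried by \<open>closure V - V\<close>.
\<close>

lemma rotation_invariant_iff:
  assumes n: "CARD('n) \<ge> 2" and M: "\<And>p. M p > 0" "cond_M1 M" "cond_M2' M" and f: "f \<in> B UNIV"
  shows "rotation_invariant f \<longleftrightarrow> f = spherical_mean f"
proof -
  obtain A :: "(real^'n \<Rightarrow> complex) \<Rightarrow> real^'n \<Rightarrow> complex" where A: "tame_op M A"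
    "\<And>g :: (real^'n \<Rightarrow> complex) \<Rightarrow> complex. dual_spherical_mean r M g = dual_op r M A g"
    "\<And>N. \<And>g :: (real^'n \<Rightarrow> complex) \<Rightarrow> complex. g \<in> ud_dual r M UNIV \<Longrightarrow> tame_closed r M N \<Longrightarrow> invariant_mod r M N g \<Longrightarrow>
       (\<lambda>\<phi>. dual_spherical_mean r M g \<phi> - g \<phi>) \<in> N"
    by (rule spherical_mean_mod[where M = M and r = r, OF n M]) blast
  let ?g = "\<lambda>V. representative V (res UNIV V f)"
  have rep: "?g V \<in> ud_dual r M UNIV" "carrier_of r M (?g V) (closure V)" "res UNIV V (\<iota> (?g V)) = res UNIV V f"
    if "admissible V" for V
    using representative[of V "res UNIV V f"] that f by (auto simp: admissible_def res_in)
  have tR: "tame_op M (\<lambda>\<phi> x. \<phi> (matrix_inv U *v x))" if "rotation_matrix U" for U :: "real^'n^'n"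
    using rotation_matrix_transpose[OF that] matrix_inv_rotation[OF that] by (intro tame_op_rotate M(1)) simp
  have rot: "dual_rotate r M U g \<in> ud_dual r M UNIV" "carrier_of r M g K \<Longrightarrow> carrier_of r M (dual_rotate r M U g) K"
    if "g \<in> ud_dual r M UNIV" "rotation_matrix U" "rotation_invariant_set K" for U :: "real^'n^'n" and g K
    unfolding dual_rotate_eq
    by (rule dual_op_in_ud_dual[where M = M, OF M(1) tR[OF that(2)] that(1)],
        rule carrier_of_dual_op[where M = M, OF M(1) tR[OF that(2)] that(3)])
  show ?thesis
  proof
    assume inv: "rotation_invariant f"
    have "local_spherical_mean V (res UNIV V f) = res UNIV V f" if V: "admissible V" for V
    proof -
      have V': "open V" "bounded V" "rotation_invariant_set V" using V by (auto simp: admissible_def)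
      have K: "compact (closure V)" using V' by (simp add: compact_closure)
      note cl = rotation_invariant_closure[OF V'(3)]
      let ?N = "{g \<in> ud_dual r M UNIV. carrier_of r M g (closure V - V)}"
      have N: "tame_closed r M ?N"
        by (intro carried_tame_closed M(1) compact_diff K V'(1) rotation_invariant_Diff cl V'(3))
      note g = rep[OF V]
      have "(\<lambda>\<phi>. dual_rotate r M U (?g V) \<phi> - ?g V \<phi>) \<in> ?N" if U: "rotation_matrix U" for U
      proof -
        let ?h = "dual_rotate r M U (?g V)"
        have h: "?h \<in> ud_dual r M UNIV" "carrier_of r M ?h (closure V)"
          using rot[OF g(1) U cl] g(2) by auto
        have d: "(\<lambda>\<phi>. ?h \<phi> - ?g V \<phi>) \<in> ud_dual r M UNIV" by (rule ud_dual_diff_mem[OF M(1) h(1) g(1)])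
        have oK: "open (- closure V)" by auto
        have cd: "carrier_of r M (\<lambda>\<phi>. ?h \<phi> - ?g V \<phi>) (closure V)"
          unfolding carrier_of_iff[OF K d] res_dual_diff[OF h(1) g(1) oK]
          using carrier_of_iff[OF K h(1)] carrier_of_iff[OF K g(1)] g(2) h(2) by simp
        have "res UNIV V (\<iota> ?h) = res UNIV V f"
          using inv V U unfolding rotation_invariant_def local_rotate_def section_class_def by blast
        then have "res UNIV V (\<iota> (\<lambda>\<phi>. ?h \<phi> - ?g V \<phi>)) = 0"
          unfolding res_dual_diff[OF h(1) g(1) V'(1)] g(3) by simp
        then show ?thesis using vanishing_iff_carrier[OF V'(2,1) d cd] d by simp
      qed
      then have "invariant_mod r M ?N (?g V)" unfolding invariant_mod_def by blast
      then have m: "(\<lambda>\<phi>. dual_spherical_mean r M (?g V) \<phi> - ?g V \<phi>) \<in> ?N"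
        by (rule A(3)[OF g(1) N])
      have s: "dual_spherical_mean r M (?g V) \<in> ud_dual r M UNIV"
        unfolding A(2) by (rule dual_op_in_ud_dual[where M = M, OF M(1) A(1) g(1)])
      have sub: "V \<subseteq> - (closure V - V)" by blast
      have o: "open (- (closure V - V))"
        by (rule open_Compl[OF compact_imp_closed[OF compact_diff[OF K V'(1)]]])
      have "res UNIV (- (closure V - V)) (\<iota> (\<lambda>\<phi>. dual_spherical_mean r M (?g V) \<phi> - ?g V \<phi>)) = 0"
        using m carrier_of_iff[OF compact_diff[OF K V'(1)]] by blast
      then have "res UNIV V (\<iota> (\<lambda>\<phi>. dual_spherical_mean r M (?g V) \<phi> - ?g V \<phi>)) = 0"
        using res_res[OF open_UNIV o V'(1) sub subset_UNIV iota_section] m res_zero[OF o V'(1) sub] by force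
      then have "res UNIV V (\<iota> (dual_spherical_mean r M (?g V))) = res UNIV V (\<iota> (?g V))"
        unfolding res_dual_diff[OF s g(1) V'(1)] by simp
      then show ?thesis by (simp add: local_spherical_mean_def section_class_def g(3))
    qed
    then show "f = spherical_mean f"
      using spherical_mean_properties(3)[OF M(1) A(1,2) f] by simp
  next
    assume eq: "f = spherical_mean f"
    show "rotation_invariant f"
      unfolding rotation_invariant_def
    proof (intro allI impI)
      fix V :: "(real^'n) set" and U :: "real^'n^'n" assume V: "admissible V" and U: "rotation_matrix U"
      have V': "open V" "bounded V" "rotation_invariant_set V" using V by (auto simp: admissible_def)
      note cl = rotation_invariant_closure[OF V'(3)]
      note g = rep[OF V]
      let ?h = "dual_spherical_mean r M (?g V)"
      have h: "?h \<in> ud_dual r M UNIV" "carrier_of r M ?h (closure V)"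
        unfolding A(2)
        using dual_op_in_ud_dual[where M = M, OF M(1) A(1) g(1)] carrier_of_dual_op[where M = M, OF M(1) A(1) cl g(2)] by auto
      have "res UNIV V f = res UNIV V (spherical_mean f)" by (rule arg_cong[where f = "res UNIV V", OF eq])
      also have "\<dots> = res UNIV V (\<iota> ?h)"
        using spherical_mean_properties(2)[OF M(1) A(1,2) f V] by (simp add: local_spherical_mean_def section_class_def)
      finally have fh: "res UNIV V f = res UNIV V (\<iota> ?h)" .
      have "res UNIV V (\<iota> (dual_rotate r M U (?g V))) = res UNIV V (\<iota> (dual_rotate r M U ?h))"
        unfolding dual_rotate_eq
        by (rule res_dual_op_cong[OF M(1) tR[OF U] V'(2,3,1,3) g(1,2) h trans[OF g(3) fh]])
      also have "\<dots> = res UNIV V (\<iota> ?h)" by (simp only: dual_rotate_spherical_mean[OF M(1) U])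
      also have "\<dots> = res UNIV V f" by (rule fh[symmetric])
      finally show "local_rotate V U (res UNIV V f) = res UNIV V f"
        by (simp add: local_rotate_def section_class_def)
    qed
  qed
qed

end

theorem theorem5:
  fixes M :: "nat \<Rightarrow> real"
    and r :: regularity
    and scale :: "complex \<Rightarrow> 's::ab_group_add \<Rightarrow> 's"
    and B :: "(real^'n::finite) set \<Rightarrow> 's set"
    and res :: "(real^'n) set \<Rightarrow> (real^'n) set \<Rightarrow> 's \<Rightarrow> 's"
    and \<iota> :: "((real^'n \<Rightarrow> complex) \<Rightarrow> complex) \<Rightarrow> 's"
    and f :: 's
  assumes "CARD('n) \<ge> 2"
    and "\<And>p. M p > 0" and "M 0 = 1"
    and "cond_M0 r M" and "cond_M1 M" and "cond_M2' M" and "cond_QA M"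
    and "ultradistribution_sheaf scale B res r M \<iota>"
    and "f \<in> B UNIV"
  shows "ultradistribution_sheaf.rotation_invariant res r M \<iota> f \<longleftrightarrow>
         f = ultradistribution_sheaf.spherical_mean B res r M \<iota> f"
proof -
  interpret ultradistribution_sheaf scale B res r M \<iota> by fact
  show ?thesis by (rule rotation_invariant_iff) fact+
qed

end
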